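(* Let $\mathcal K$ be a 2-category, $n$ a positive integer and $1\le k\le n$. The following assignments define a 2-functor $C_k:\mathsf{Wdl}^{(n)}(\overline{\mathcal K})\to\mathsf{Wdl}^{(n-1)}(\overline{\mathcal K})$. A 0-cell $\{\lambda_{i,j}:s_js_i\to s_is_j\}_{0\le i<j\le n}$ is sent to the 0-cell whose $n$ monads are, in this order, $s_0,\dots,s_{k-2}$, the monad $(s_{k-1}s_k,\bar\lambda_{k-1,k})$ in $\overline{\mathcal K}$ induced by $\lambda_{k-1,k}$, and $s_{k+1},\dots,s_n$, with weak distributive laws: $\lambda_{i,j}:s_js_i\to s_is_j$ if $i,j\notin\{k-1,k\}$; $s_{k-1}\lambda_{k,j}.\lambda_{k-1,j}s_k.s_j\bar\lambda_{k-1,k}:s_j(s_{k-1}s_k)\to(s_{k-1}s_k)s_j$ if $k<j$; and $\lambda_{i,k-1}s_k.s_{k-1}\lambda_{i,k}.\bar\lambda_{k-1,k}s_i:(s_{k-1}s_k)s_i\to s_i(s_{k-1}s_k)$ if $i<k-1$. A 1-cell $(v,\{\xi_i:s'_iv\to vs_i\}_{0\le i\le n})$ is sent to the 1-cell with the same $v$ and the 2-cells $\xi_i$ for $0\le i<k-1$, then $v\bar\lambda_{k-1,k}.\xi_{k-1}s_k.s'_{k-1}\xi_k:(s'_{k-1}s'_k)v\to v(s_{k-1}s_k)$, then $\xi_{i+1}:s'_{i+1}v\to vs_{i+1}$ for $k-1<i<n$. A 2-cell is sent to itself. (In particular, these are a 0-cell, 1-cell and 2-cell of $\mathsf{Wdl}^{(n-1)}(\overline{\mathcal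 K})$ respectively.)
   Context: Conventions. For 1-cells, $uw$ is the horizontal composite ($w$ applied first); for 2-cells $\alpha,\beta$, $\alpha\beta$ is their horizontal composite; a 1-cell written next to a 2-cell means whiskering by its identity 2-cell; $\alpha.\beta$ is vertical composition ($\beta$ first). A monad $(A,t)$ has multiplication $\mu:tt\to t$ and unit $\eta:1_A\to t$; decorations of $t$ (indices, primes) carry over to $\mu,\eta$. Local idempotent closure $\overline{\mathcal K}$: same 0-cells as $\mathcal K$; 1-cells $A\to B$ are pairs $(v,\bar v)$ with $v:A\to B$ a 1-cell of $\mathcal K$ and $\bar v:v\to v$ an idempotent 2-cell; 2-cells $(v,\bar v)\to(v',\bar v')$ are 2-cells $\omega:v\to v'$ of $\mathcal K$ with $\bar v'.\omega=\omega=\omega.\bar v$; compositions are induced from $\mathcal K$ (horizontal composite of $(u,\bar u),(w,\bar w)$ is $(uw,\bar u\bar w)$), the identity 2-cell of $(v,\bar v)$ is $\bar v$. A monad $(A,(t,\bar t))$ in $\overline{\mathcal K}$ is given by 2-cells $\mu,\eta$ of $\mathcal K$ satisfying the monad axioms in $\overline{\mathcal K}$ (so $\mu.t\eta=\mu.\eta t=\bar t$); we often write just $t$, and write $v$ for $(v,\bar v)$. For $\mathcal L\in\{\mathcal K,\overline{\mathcal K}\}$, $\mathsf{Mnd}(\mathcal L)$ has as 0-cells the monads $(A,t)$ in $\mathcal L$; 1-cells $(A,t)\to(A',t')$ are pairs $(v,\psi)$ with $v:A\to A'$ and $\psi:t'v\to vt$ in $\mathcal L$, $\psi.\mu'v=v\mu.\psi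 t.t'\psi$, $\psi.\eta'v=v\eta$; 2-cells $(v,\psi)\to(v',\psi')$ are $\omega:v\to v'$ with $\psi'.t'\omega=\omega t.\psi$. A weak distributive law in $\mathcal L$: monads $(A,t),(A,s)$ in $\mathcal L$ and a 2-cell $\lambda:ts\to st$ of $\mathcal L$ with $\lambda.\mu s=s\mu.\lambda t.t\lambda$, $\lambda.t\mu=\mu t.s\lambda.\lambda s$, $\lambda.\eta s=\mu t.s\lambda.st\eta.s\eta$, $\lambda.t\eta=s\mu.\lambda t.\eta st.\eta t$. Its idempotent is $\bar\lambda:=\mu t.s\lambda.st\eta=s\mu.\lambda t.\eta st$. For $\lambda$ in $\overline{\mathcal K}$, the induced monad (weak wreath product) is $(A,(st,\bar\lambda))$ in $\overline{\mathcal K}$ with multiplication $\mu\mu.s\lambda t$ and unit $\lambda.\eta\eta$. $\mathsf{Wdl}(\mathcal L)$: 0-cells are weak distributive laws in $\mathcal L$; a 1-cell from $\lambda:ts\to st$ (on $A$) to $\lambda':t's'\to s't'$ (on $A'$) is $(v,\xi,\zeta)$ with $(v,\xi):(A,t)\to(A',t')$, $(v,\zeta):(A,s)\to(A',s')$ 1-cells of $\mathsf{Mnd}(\mathcal L)$ and $v\lambda.\xi s.t'\zeta=v\bar\lambda.\zeta t.s'\xi.\lambda'v$; 2-cells are 2-cells $\omega$ of $\mathcal L$ that are 2-cells of $\mathsf{Mnd}(\mathcal L)$ both $(v,\xi)\to(v',\xi')$ and $(v,\zeta)\to(v',\zeta')$. $\mathsf{Wdl}^{(n)}(\mathcal L)$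 ($n\ge0$): a 0-cell consists of monads $(A,s_0),\dots,(A,s_n)$ in $\mathcal L$ on one object and weak distributive laws $\lambda_{i,j}:s_js_i\to s_is_j$ ($0\le i<j\le n$) satisfying the Yang–Baxter relation $\lambda_{i,j}s_k.s_j\lambda_{i,k}.\lambda_{j,k}s_i=s_i\lambda_{j,k}.\lambda_{i,k}s_j.s_k\lambda_{i,j}$ for $i<j<k$. A 1-cell to $\{\lambda'_{i,j}:s'_js'_i\to s'_is'_j\}$ (on $A'$) is $v:A\to A'$ with 2-cells $\xi_i:s'_iv\to vs_i$ such that each $(v,\xi_i)$ is a 1-cell of $\mathsf{Mnd}(\mathcal L)$ and each $(v,\xi_i,\xi_j)$, $i<j$, is a 1-cell $\lambda_{i,j}\to\lambda'_{i,j}$ of $\mathsf{Wdl}(\mathcal L)$; 2-cells are $\omega:v\to v'$ which are 2-cells $(v,\xi_i)\to(v',\xi'_i)$ of $\mathsf{Mnd}(\mathcal L)$ for all $i$; compositions come from $\mathcal L$. So $\mathsf{Wdl}^{(0)}(\mathcal L)=\mathsf{Mnd}(\mathcal L)$, $\mathsf{Wdl}^{(1)}(\mathcal L)=\mathsf{Wdl}(\mathcal L)$. $\bar\lambda_{ij}$ denotes the idempotent of $\lambda_{i,j}$. *)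

theory Defs
  imports Main
begin

text \<open>A 2-category presented by its cells: 0-cells of type 'o, 1-cells of type 'a,
  2-cells of type 'c, together with carrier sets and the structure maps.
  comp1 u w is the composite uw (w applied first); vcomp a b is a.b (b first);
  hcomp a b is the horizontal composite ab.\<close>

record ('o,'a,'c) tcat =
  Ob :: "'o set"
  Ar :: "'a set"
  Cl :: "'c set"
  src1 :: "'a \<Rightarrow> 'o"
  trg1 :: "'a \<Rightarrow> 'o"
  dom2 :: "'c \<Rightarrow> 'a"
  cod2 :: "'c \<Rightarrow> 'a"
  id1 :: "'o \<Rightarrow> 'a"
  comp1 :: "'a \<Rightarrow> 'a \<Rightarrow> 'a"
  id2 :: "'a \<Rightarrow> 'c"
  vcomp :: "'c \<Rightarrow> 'c \<Rightarrow> 'c"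
  hcomp :: "'c \<Rightarrow> 'c \<Rightarrow> 'c"

definition two_category :: "('o,'a,'c) tcat \<Rightarrow> bool" where
  "two_category K \<longleftrightarrow>
    (\<forall>v\<in>Ar K. src1 K v \<in> Ob K \<and> trg1 K v \<in> Ob K) \<and>
    (\<forall>A\<in>Ob K. id1 K A \<in> Ar K \<and> src1 K (id1 K A) = A \<and> trg1 K (id1 K A) = A) \<and>
    (\<forall>u\<in>Ar K. \<forall>w\<in>Ar K. trg1 K w = src1 K u \<longrightarrow>
        comp1 K u w \<in> Ar K \<and> src1 K (comp1 K u w) = src1 K w \<and> trg1 K (comp1 K u w) = trg1 K u) \<and>
    (\<forall>u\<in>Ar K. \<forall>v\<in>Ar K. \<forall>w\<in>Ar K. trg1 K w = src1 K v \<longrightarrow> trg1 K v = src1 K u \<longrightarrow>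
        comp1 K (comp1 K u v) w = comp1 K u (comp1 K v w)) \<and>
    (\<forall>u\<in>Ar K. comp1 K (id1 K (trg1 K u)) u = u \<and> comp1 K u (id1 K (src1 K u)) = u) \<and>
    (\<forall>\<alpha>\<in>Cl K. dom2 K \<alpha> \<in> Ar K \<and> cod2 K \<alpha> \<in> Ar K \<and>
        src1 K (dom2 K \<alpha>) = src1 K (cod2 K \<alpha>) \<and> trg1 K (dom2 K \<alpha>) = trg1 K (cod2 K \<alpha>)) \<and>
    (\<forall>v\<in>Ar K. id2 K v \<in> Cl K \<and> dom2 K (id2 K v) = v \<and> cod2 K (id2 K v) = v) \<and>
    (\<forall>\<alpha>\<in>Cl K. \<forall>\<beta>\<in>Cl K. dom2 K \<alpha> = cod2 K \<beta> \<longrightarrow>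
        vcomp K \<alpha> \<beta> \<in> Cl K \<and> dom2 K (vcomp K \<alpha> \<beta>) = dom2 K \<beta> \<and> cod2 K (vcomp K \<alpha> \<beta>) = cod2 K \<alpha>) \<and>
    (\<forall>\<alpha>\<in>Cl K. \<forall>\<beta>\<in>Cl K. \<forall>\<gamma>\<in>Cl K. dom2 K \<alpha> = cod2 K \<beta> \<longrightarrow> dom2 K \<beta> = cod2 K \<gamma> \<longrightarrow>
        vcomp K (vcomp K \<alpha> \<beta>) \<gamma> = vcomp K \<alpha> (vcomp K \<beta> \<gamma>)) \<and>
    (\<forall>\<alpha>\<in>Cl K. vcomp K (id2 K (cod2 K \<alpha>)) \<alpha> = \<alpha> \<and> vcomp K \<alpha> (id2 K (dom2 K \<alpha>)) = \<alpha>) \<and>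
    (\<forall>\<alpha>\<in>Cl K. \<forall>\<beta>\<in>Cl K. trg1 K (dom2 K \<beta>) = src1 K (dom2 K \<alpha>) \<longrightarrow>
        hcomp K \<alpha> \<beta> \<in> Cl K \<and> dom2 K (hcomp K \<alpha> \<beta>) = comp1 K (dom2 K \<alpha>) (dom2 K \<beta>) \<and>
        cod2 K (hcomp K \<alpha> \<beta>) = comp1 K (cod2 K \<alpha>) (cod2 K \<beta>)) \<and>
    (\<forall>\<alpha>\<in>Cl K. \<forall>\<beta>\<in>Cl K. \<forall>\<gamma>\<in>Cl K. trg1 K (dom2 K \<gamma>) = src1 K (dom2 K \<beta>) \<longrightarrow>
        trg1 K (dom2 K \<beta>) = src1 K (dom2 K \<alpha>) \<longrightarrow>
        hcomp K (hcomp K \<alpha> \<beta>) \<gamma> = hcomp K \<alpha> (hcomp K \<beta> \<gamma>)) \<and>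
    (\<forall>\<alpha>\<in>Cl K. hcomp K (id2 K (id1 K (trg1 K (dom2 K \<alpha>)))) \<alpha> = \<alpha> \<and>
        hcomp K \<alpha> (id2 K (id1 K (src1 K (dom2 K \<alpha>)))) = \<alpha>) \<and>
    (\<forall>u\<in>Ar K. \<forall>w\<in>Ar K. trg1 K w = src1 K u \<longrightarrow> hcomp K (id2 K u) (id2 K w) = id2 K (comp1 K u w)) \<and>
    (\<forall>\<alpha>\<in>Cl K. \<forall>\<beta>\<in>Cl K. \<forall>\<gamma>\<in>Cl K. \<forall>\<delta>\<in>Cl K.
        dom2 K \<alpha> = cod2 K \<beta> \<longrightarrow> dom2 K \<gamma> = cod2 K \<delta> \<longrightarrow> trg1 K (dom2 K \<gamma>) = src1 K (dom2 K \<alpha>) \<longrightarrow>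
        hcomp K (vcomp K \<alpha> \<beta>) (vcomp K \<gamma> \<delta>) = vcomp K (hcomp K \<alpha> \<gamma>) (hcomp K \<beta> \<delta>))"

text \<open>1-cells are pairs (v, vbar); a 2-cell (v,vbar) to (v',vbar') is represented as the
  triple (source 1-cell, underlying 2-cell of K, target 1-cell).\<close>

definition lic_Ar :: "('o,'a,'c) tcat \<Rightarrow> ('a \<times> 'c) set" where
  "lic_Ar K = {(v,e). v \<in> Ar K \<and> e \<in> Cl K \<and> dom2 K e = v \<and> cod2 K e = v \<and> vcomp K e e = e}"

definition lic :: "('o,'a,'c) tcat \<Rightarrow> ('o, 'a \<times> 'c, ('a \<times> 'c) \<times> 'c \<times> ('a \<times> 'c)) tcat" where
  "lic K = \<lparr> Ob = Ob K, Ar = lic_Ar K,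
     Cl = {(a,w,b). a \<in> lic_Ar K \<and> b \<in> lic_Ar K \<and> w \<in> Cl K \<and> dom2 K w = fst a \<and> cod2 K w = fst b
             \<and> vcomp K (snd b) w = w \<and> vcomp K w (snd a) = w},
     src1 = (\<lambda>x. src1 K (fst x)), trg1 = (\<lambda>x. trg1 K (fst x)),
     dom2 = (\<lambda>x. fst x), cod2 = (\<lambda>x. snd (snd x)),
     id1 = (\<lambda>A. (id1 K A, id2 K (id1 K A))),
     comp1 = (\<lambda>u w. (comp1 K (fst u) (fst w), hcomp K (snd u) (snd w))),
     id2 = (\<lambda>v. (v, snd v, v)),
     vcomp = (\<lambda>x y. (fst y, vcomp K (fst (snd x)) (fst (snd y)), snd (snd x))),
     hcomp = (\<lambda>x y. ((comp1 K (fst (fst x)) (fst (fst y)), hcomp K (snd (fst x)) (snd (fst y))),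
                     hcomp K (fst (snd x)) (fst (snd y)),
                     (comp1 K (fst (snd (snd x))) (fst (snd (snd y))),
                      hcomp K (snd (snd (snd x))) (snd (snd (snd y)))))) \<rparr>"

definition und :: "('a \<times> 'c) \<times> 'c \<times> ('a \<times> 'c) \<Rightarrow> 'c" where
  "und x = fst (snd x)"

definition rt :: "'a \<times> 'c \<Rightarrow> ('a \<times> 'c) \<times> 'c \<times> ('a \<times> 'c) \<Rightarrow> 'a \<times> 'c \<Rightarrow> ('a \<times> 'c) \<times> 'c \<times> ('a \<times> 'c)" where
  "rt a x b = (a, und x, b)"

definition hom1 :: "('o,'a,'c) tcat \<Rightarrow> 'o \<Rightarrow> 'o \<Rightarrow> 'a set" where
  "hom1 L A B = {v \<in> Ar L. src1 L v = A \<and> trg1 L v = B}"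

definition hom2 :: "('o,'a,'c) tcat \<Rightarrow> 'a \<Rightarrow> 'a \<Rightarrow> 'c set" where
  "hom2 L u v = {\<alpha> \<in> Cl L. dom2 L \<alpha> = u \<and> cod2 L \<alpha> = v}"

definition wl :: "('o,'a,'c) tcat \<Rightarrow> 'a \<Rightarrow> 'c \<Rightarrow> 'c" where
  "wl L v \<alpha> = hcomp L (id2 L v) \<alpha>"

definition wr :: "('o,'a,'c) tcat \<Rightarrow> 'c \<Rightarrow> 'a \<Rightarrow> 'c" where
  "wr L \<alpha> v = hcomp L \<alpha> (id2 L v)"

text \<open>A monad is a triple (t, mu, eta).\<close>
type_synonym ('a,'c) mnd = "'a \<times> 'c \<times> 'c"

definition is_monad :: "('o,'a,'c) tcat \<Rightarrow> 'o \<Rightarrow> ('a,'c) mnd \<Rightarrow> bool" where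
  "is_monad L A m \<longleftrightarrow> (let t = fst m; \<mu> = fst (snd m); \<eta> = snd (snd m) in
     A \<in> Ob L \<and> t \<in> hom1 L A A \<and> \<mu> \<in> hom2 L (comp1 L t t) t \<and> \<eta> \<in> hom2 L (id1 L A) t \<and>
     vcomp L \<mu> (wl L t \<mu>) = vcomp L \<mu> (wr L \<mu> t) \<and>
     vcomp L \<mu> (wl L t \<eta>) = id2 L t \<and> vcomp L \<mu> (wr L \<eta> t) = id2 L t)"

definition mnd1 :: "('o,'a,'c) tcat \<Rightarrow> 'o \<Rightarrow> ('a,'c) mnd \<Rightarrow> 'o \<Rightarrow> ('a,'c) mnd \<Rightarrow> 'a \<Rightarrow> 'c \<Rightarrow> bool" where
  "mnd1 L A m A' m' v \<psi> \<longleftrightarrow> (let t = fst m; \<mu> = fst (snd m); \<eta> = snd (snd m);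
        t' = fst m'; \<mu>' = fst (snd m'); \<eta>' = snd (snd m') in
     v \<in> hom1 L A A' \<and> \<psi> \<in> hom2 L (comp1 L t' v) (comp1 L v t) \<and>
     vcomp L \<psi> (wr L \<mu>' v) = vcomp L (wl L v \<mu>) (vcomp L (wr L \<psi> t) (wl L t' \<psi>)) \<and>
     vcomp L \<psi> (wr L \<eta>' v) = wl L v \<eta>)"

definition mnd2 :: "('o,'a,'c) tcat \<Rightarrow> ('a,'c) mnd \<Rightarrow> ('a,'c) mnd \<Rightarrow> 'a \<Rightarrow> 'c \<Rightarrow> 'a \<Rightarrow> 'c \<Rightarrow> 'c \<Rightarrow> bool" where
  "mnd2 L m m' v \<psi> v2 \<psi>2 \<omega> \<longleftrightarrow>
     \<omega> \<in> hom2 L v v2 \<and> vcomp L \<psi>2 (wl L (fst m') \<omega>) = vcomp L (wr L \<omega> (fst m)) \<psi>"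

definition wdl :: "('o,'a,'c) tcat \<Rightarrow> 'o \<Rightarrow> ('a,'c) mnd \<Rightarrow> ('a,'c) mnd \<Rightarrow> 'c \<Rightarrow> bool" where
  "wdl L A mt ms lm \<longleftrightarrow> (let T = fst mt; \<mu>t = fst (snd mt); \<eta>t = snd (snd mt);
        S = fst ms; \<mu>s = fst (snd ms); \<eta>s = snd (snd ms) in
     is_monad L A mt \<and> is_monad L A ms \<and> lm \<in> hom2 L (comp1 L T S) (comp1 L S T) \<and>
     vcomp L lm (wr L \<mu>t S) = vcomp L (wl L S \<mu>t) (vcomp L (wr L lm T) (wl L T lm)) \<and>
     vcomp L lm (wl L T \<mu>s) = vcomp L (wr L \<mu>s T) (vcomp L (wl L S lm) (wr L lm S)) \<and>
     vcomp L lm (wr L \<eta>t S) =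
       vcomp L (wr L \<mu>s T) (vcomp L (wl L S lm) (vcomp L (wl L (comp1 L S T) \<eta>s) (wl L S \<eta>t))) \<and>
     vcomp L lm (wl L T \<eta>s) =
       vcomp L (wl L S \<mu>t) (vcomp L (wr L lm T) (vcomp L (wr L \<eta>t (comp1 L S T)) (wr L \<eta>s T))))"

definition lambar :: "('o,'a,'c) tcat \<Rightarrow> ('a,'c) mnd \<Rightarrow> ('a,'c) mnd \<Rightarrow> 'c \<Rightarrow> 'c" where
  "lambar L mt ms lm = vcomp L (wr L (fst (snd ms)) (fst mt))
      (vcomp L (wl L (fst ms) lm) (wl L (comp1 L (fst ms) (fst mt)) (snd (snd ms))))"

definition wdl1 :: "('o,'a,'c) tcat \<Rightarrow> 'o \<Rightarrow> ('a,'c) mnd \<Rightarrow> ('a,'c) mnd \<Rightarrow> 'c \<Rightarrow>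
     'o \<Rightarrow> ('a,'c) mnd \<Rightarrow> ('a,'c) mnd \<Rightarrow> 'c \<Rightarrow> 'a \<Rightarrow> 'c \<Rightarrow> 'c \<Rightarrow> bool" where
  "wdl1 L A mt ms lm A' mt' ms' lm' v \<xi> \<zeta> \<longleftrightarrow>
     mnd1 L A mt A' mt' v \<xi> \<and> mnd1 L A ms A' ms' v \<zeta> \<and>
     vcomp L (wl L v lm) (vcomp L (wr L \<xi> (fst ms)) (wl L (fst mt') \<zeta>)) =
     vcomp L (wl L v (lambar L mt ms lm))
       (vcomp L (wr L \<zeta> (fst mt)) (vcomp L (wl L (fst ms') \<xi>) (wr L lm' v)))"

text \<open>0-cell: (A, s, lam) with monads s 0, ..., s n and laws lam i j : s j s i to s i s j.\<close>
type_synonym ('o,'a,'c) wdln0 = "'o \<times> (nat \<Rightarrow> ('a,'c) mnd) \<times> (nat \<Rightarrow> nat \<Rightarrow> 'c)"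
text \<open>1-cell: (v, xi) with xi i : s'_i v to v s_i.\<close>
type_synonym ('a,'c) wdln1 = "'a \<times> (nat \<Rightarrow> 'c)"

definition wdln0 :: "('o,'a,'c) tcat \<Rightarrow> nat \<Rightarrow> ('o,'a,'c) wdln0 \<Rightarrow> bool" where
  "wdln0 L n X \<longleftrightarrow> (let A = fst X; s = fst (snd X); lam = snd (snd X) in
     (\<forall>i\<le>n. is_monad L A (s i)) \<and>
     (\<forall>i j. i < j \<and> j \<le> n \<longrightarrow> wdl L A (s j) (s i) (lam i j)) \<and>
     (\<forall>i j k. i < j \<and> j < k \<and> k \<le> n \<longrightarrow>
        vcomp L (wr L (lam i j) (fst (s k))) (vcomp L (wl L (fst (s j)) (lam i k)) (wr L (lam j k) (fst (s i)))) =
        vcomp L (wl L (fst (s i)) (lam j k)) (vcomp L (wr L (lam i k) (fst (s j))) (wl L (fst (s k)) (lam i j)))))"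

definition wdln1 :: "('o,'a,'c) tcat \<Rightarrow> nat \<Rightarrow> ('o,'a,'c) wdln0 \<Rightarrow> ('o,'a,'c) wdln0 \<Rightarrow> ('a,'c) wdln1 \<Rightarrow> bool" where
  "wdln1 L n X X' f \<longleftrightarrow> (let A = fst X; s = fst (snd X); lam = snd (snd X);
        A' = fst X'; s' = fst (snd X'); lam' = snd (snd X'); v = fst f; \<xi> = snd f in
     v \<in> hom1 L A A' \<and>
     (\<forall>i\<le>n. mnd1 L A (s i) A' (s' i) v (\<xi> i)) \<and>
     (\<forall>i j. i < j \<and> j \<le> n \<longrightarrow>
        wdl1 L A (s j) (s i) (lam i j) A' (s' j) (s' i) (lam' i j) v (\<xi> j) (\<xi> i)))"

definition wdln2 :: "('o,'a,'c) tcat \<Rightarrow> nat \<Rightarrow> ('o,'a,'c) wdln0 \<Rightarrow> ('o,'a,'c) wdln0 \<Rightarrow>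
     ('a,'c) wdln1 \<Rightarrow> ('a,'c) wdln1 \<Rightarrow> 'c \<Rightarrow> bool" where
  "wdln2 L n X X' f g \<omega> \<longleftrightarrow>
     \<omega> \<in> hom2 L (fst f) (fst g) \<and>
     (\<forall>i\<le>n. mnd2 L (fst (snd X) i) (fst (snd X') i) (fst f) (snd f i) (fst g) (snd g i) \<omega>)"

definition wdln_comp :: "('o,'a,'c) tcat \<Rightarrow> ('a,'c) wdln1 \<Rightarrow> ('a,'c) wdln1 \<Rightarrow> ('a,'c) wdln1" where
  "wdln_comp L g f = (comp1 L (fst g) (fst f),
     (\<lambda>i. vcomp L (wl L (fst g) (snd f i)) (wr L (snd g i) (fst f))))"

definition wdln_id :: "('o,'a,'c) tcat \<Rightarrow> ('o,'a,'c) wdln0 \<Rightarrow> ('a,'c) wdln1" where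
  "wdln_id L X = (id1 L (fst X), (\<lambda>i. id2 L (fst (fst (snd X) i))))"

definition wwp :: "('o,'a,'c) tcat \<Rightarrow> ('a \<times> 'c, ('a \<times> 'c) \<times> 'c \<times> ('a \<times> 'c)) mnd \<Rightarrow>
     ('a \<times> 'c, ('a \<times> 'c) \<times> 'c \<times> ('a \<times> 'c)) mnd \<Rightarrow> ('a \<times> 'c) \<times> 'c \<times> ('a \<times> 'c) \<Rightarrow>
     ('a \<times> 'c, ('a \<times> 'c) \<times> 'c \<times> ('a \<times> 'c)) mnd" where
  "wwp K mt ms lm = (let L = lic K; T = fst mt; S = fst ms;
       ST = (fst (comp1 L S T), und (lambar L mt ms lm)) in
     (ST,
      rt (comp1 L ST ST) (vcomp L (hcomp L (fst (snd ms)) (fst (snd mt))) (wl L S (wr L lm T))) ST,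
      rt (id1 L (src1 L T)) (vcomp L lm (hcomp L (snd (snd mt)) (snd (snd ms)))) ST))"

definition Ck0 :: "('o,'a,'c) tcat \<Rightarrow> nat \<Rightarrow>
     ('o, 'a \<times> 'c, ('a \<times> 'c) \<times> 'c \<times> ('a \<times> 'c)) wdln0 \<Rightarrow> ('o, 'a \<times> 'c, ('a \<times> 'c) \<times> 'c \<times> ('a \<times> 'c)) wdln0" where
  "Ck0 K k X = (let L = lic K; A = fst X; s = fst (snd X); lam = snd (snd X);
       S = (\<lambda>i. fst (s i));
       M = wwp K (s k) (s (k-1)) (lam (k-1) k); Mt = fst M;
       lb = lambar L (s k) (s (k-1)) (lam (k-1) k);
       oi = (\<lambda>i. if i < k-1 then i else i+1) in
     (A,
      (\<lambda>i. if i = k-1 then M else s (oi i)),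
      (\<lambda>i j. if j = k-1 then
               rt (comp1 L Mt (S i))
                  (vcomp L (wr L (lam i (k-1)) (S k)) (vcomp L (wl L (S (k-1)) (lam i k)) (wr L lb (S i))))
                  (comp1 L (S i) Mt)
             else if i = k-1 then
               rt (comp1 L (S (j+1)) Mt)
                  (vcomp L (wl L (S (k-1)) (lam k (j+1)))
                     (vcomp L (wr L (lam (k-1) (j+1)) (S k)) (wl L (S (j+1)) lb)))
                  (comp1 L Mt (S (j+1)))
             else lam (oi i) (oi j))))"

definition Ck1 :: "('o,'a,'c) tcat \<Rightarrow> nat \<Rightarrow>
     ('o, 'a \<times> 'c, ('a \<times> 'c) \<times> 'c \<times> ('a \<times> 'c)) wdln0 \<Rightarrow> ('o, 'a \<times> 'c, ('a \<times> 'c) \<times> 'c \<times> ('a \<times> 'c)) wdln0 \<Rightarrow>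
     ('a \<times> 'c, ('a \<times> 'c) \<times> 'c \<times> ('a \<times> 'c)) wdln1 \<Rightarrow> ('a \<times> 'c, ('a \<times> 'c) \<times> 'c \<times> ('a \<times> 'c)) wdln1" where
  "Ck1 K k X X' f = (let L = lic K; s = fst (snd X); lam = snd (snd X); s' = fst (snd X');
       v = fst f; \<xi> = snd f;
       Mt = fst (fst (snd (Ck0 K k X)) (k-1));
       Mt' = fst (fst (snd (Ck0 K k X')) (k-1));
       lb = lambar L (s k) (s (k-1)) (lam (k-1) k) in
     (v, (\<lambda>i. if i < k-1 then \<xi> i
              else if i = k-1 then
                rt (comp1 L Mt' v)
                   (vcomp L (wl L v lb) (vcomp L (wr L (\<xi> (k-1)) (fst (s k))) (wl L (fst (s' (k-1))) (\<xi> k))))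
                   (comp1 L v Mt)
              else \<xi> (i+1))))"

end

theory Submission
  imports Defs
begin

text \<open>
  The idempotent \<open>\<lambda>bar\<close> of a weak distributive law \<open>\<lambda>: ts \<rightarrow> st\<close> commutes with left multiplication by
  \<open>s\<close> and right multiplication by \<open>t\<close>, fixes \<open>\<lambda>\<close>, and is absorbed by \<open>\<mu>t.s\<lambda>\<close> and \<open>s\<mu>.\<lambda>t\<close>. In the local
  idempotent closure it splits as \<open>\<lambda>bar = i.p\<close>, \<open>p.i = 1\<close>, through the 1-cell \<open>M = (st, \<lambda>bar)\<close>, and
  all the structure that \<open>C_k\<close> puts on \<open>M\<close> is the corresponding ordinary composite for \<open>st\<close> conjugated
  by \<open>i\<close> and \<open>p\<close>. Every axiom for \<open>M\<close> thus becomes an equation between pasting diagrams in an arbitrary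
  2-category; the Yang-Baxter relations and the absorption properties remove the inner copies of
  \<open>i.p = \<lambda>bar\<close>, and what remains is the computation known for strict distributive laws.
\<close>

text \<open>For a strict law \<open>\<lambda>.\<eta>s = s\<eta>\<close>; the weak unit axioms let a
  unit cross only at the price of an idempotent. This makes two places differ from the strict
  computation. In the unit axioms of the composite laws (\<open>th_er\<close>, \<open>th_eM\<close>
  and their mirror images) idempotents are expanded so that the units hidden in them can be
  regrouped. In the condition on 1-cells the idempotent of a composite law occurs; the lemmas
  \<open>K_p\<close>, \<open>K_pL\<close> and those after them compare it with the idempotents of
  the two laws it is made of.

  In the closure, \<open>i\<close>, \<open>p\<close>, \<open>\<lambda>bar\<close> and the identity
  of \<open>M\<close> all have the same underlying 2-cell. Treating \<open>i\<close> and
  \<open>p\<close> as abstract generators keeps these roles apart, and no diagram calculation looks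
  inside the closure.

  Some derivations need dozens of interchanges and substitutions, with a partially defined
  composition. Derivations are therefore data: soundness of an instruction is proved once, and
  simplification replays each list of instructions on literal words.\<close>

section \<open>Diagrams in a 2-category\<close>

text \<open>
  A 2-cell is presented by its domain, a word of 1-cells, and a list of whiskered generators. A
  generator \<open>(x, \<alpha>, y)\<close> carries its domain and codomain as words, and a step \<open>(p, x, \<alpha>, y)\<close> applies it
  to the letters from position \<open>p\<close> on.
\<close>

type_synonym ('a,'c) cell = "'a list \<times> 'c \<times> 'a list"
type_synonym ('a,'c) diag = "(nat \<times> ('a,'c) cell) list"
type_synonym ('o,'a,'c) rule = "'o \<times> 'a list \<times> ('a,'c) diag \<times> ('a,'c) diag"

text \<open>Words are read like composites, the last letter acting first: \<open>A\<close> is the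
  source, \<open>ob L A w\<close> the target. The empty word, which is the domain of every unit,
  does not determine its 0-cell; hence the parameter \<open>A\<close>.\<close>

fun ob :: "('o,'a,'c) tcat \<Rightarrow> 'o \<Rightarrow> 'a list \<Rightarrow> 'o" where
  "ob L A [] = A"
| "ob L A (x # xs) = trg1 L x"

text \<open>The singleton clause avoids a trailing identity 1-cell, so that a literal word reduces
  to the composite that the axioms mention. \<open>cw_Cons\<close> recovers the uniform
  recursion.\<close>

fun cw :: "('o,'a,'c) tcat \<Rightarrow> 'o \<Rightarrow> 'a list \<Rightarrow> 'a" where
  "cw L A [] = id1 L A"
| "cw L A [x] = x"
| "cw L A (x # y # ys) = comp1 L x (cw L A (y # ys))"

fun pth :: "('o,'a,'c) tcat \<Rightarrow> 'o \<Rightarrow> 'a list \<Rightarrow> bool" where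
  "pth L A [] \<longleftrightarrow> A \<in> Ob L"
| "pth L A (x # xs) \<longleftrightarrow> x \<in> Ar L \<and> src1 L x = ob L A xs \<and> pth L A xs"

fun lw :: "('o,'a,'c) tcat \<Rightarrow> 'a list \<Rightarrow> 'c \<Rightarrow> 'c" where
  "lw L [] \<alpha> = \<alpha>"
| "lw L (x # xs) \<alpha> = wl L x (lw L xs \<alpha>)"

fun rw :: "('o,'a,'c) tcat \<Rightarrow> 'c \<Rightarrow> 'a list \<Rightarrow> 'c" where
  "rw L \<alpha> [] = \<alpha>"
| "rw L \<alpha> (x # xs) = rw L (wr L \<alpha> x) xs"

definition arr :: "('o,'a,'c) tcat \<Rightarrow> 'o \<Rightarrow> 'a list \<Rightarrow> 'c \<Rightarrow> 'a list \<Rightarrow> bool" where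
  "arr L A x \<alpha> y \<longleftrightarrow> pth L A x \<and> pth L A y \<and> ob L A x = ob L A y \<and>
     \<alpha> \<in> hom2 L (cw L A x) (cw L A y)"

text \<open>For an empty \<open>x\<close> the equation on \<open>take\<close> is vacuous, and only
  the bound keeps the position inside the word.\<close>

fun fits :: "('o,'a,'c) tcat \<Rightarrow> 'o \<Rightarrow> 'a list \<Rightarrow> nat \<times> ('a,'c) cell \<Rightarrow> bool" where
  "fits L A w (p, x, \<alpha>, y) \<longleftrightarrow> p + length x \<le> length w \<and> take (length x) (drop p w) = x \<and>
     arr L (ob L A (drop (p + length x) w)) x \<alpha> y"

fun act :: "'a list \<Rightarrow> nat \<times> ('a,'c) cell \<Rightarrow> 'a list" where
  "act w (p, x, \<alpha>, y) = take p w @ y @ drop (p + length x) w"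

fun whisk :: "('o,'a,'c) tcat \<Rightarrow> 'a list \<Rightarrow> nat \<times> ('a,'c) cell \<Rightarrow> 'c" where
  "whisk L w (p, x, \<alpha>, y) = lw L (take p w) (rw L \<alpha> (drop (p + length x) w))"

text \<open>As in a composite written with \<open>.\<close>, the head of a diagram is applied last.\<close>

fun tgt :: "'a list \<Rightarrow> ('a,'c) diag \<Rightarrow> 'a list" where
  "tgt w [] = w"
| "tgt w (d # D) = act (tgt w D) d"

fun valid :: "('o,'a,'c) tcat \<Rightarrow> 'o \<Rightarrow> 'a list \<Rightarrow> ('a,'c) diag \<Rightarrow> bool" where
  "valid L A w [] \<longleftrightarrow> pth L A w"
| "valid L A w (d # D) \<longleftrightarrow> valid L A w D \<and> fits L A (tgt w D) d"

text \<open>The singleton clause leaves no identity 2-cell behind, and \<open>lw\<close>,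
  \<open>rw\<close> whisker letter by letter. A literal diagram thus simplifies to the nested
  \<open>vcomp\<close>, \<open>wl\<close>, \<open>wr\<close> terms of the definitions, so that
  axioms become \<open>sound\<close> equations by mere simplification.\<close>

fun ev :: "('o,'a,'c) tcat \<Rightarrow> 'o \<Rightarrow> 'a list \<Rightarrow> ('a,'c) diag \<Rightarrow> 'c" where
  "ev L A w [] = id2 L (cw L A w)"
| "ev L A w [d] = whisk L w d"
| "ev L A w (d # e # D) = vcomp L (whisk L (tgt w (e # D)) d) (ev L A w (e # D))"

text \<open>Validity of both sides and equality of targets are included so that a derivation has to
  be checked for validity only at its first diagram.\<close>

fun sound :: "('o,'a,'c) tcat \<Rightarrow> ('o,'a,'c) rule \<Rightarrow> bool" where
  "sound L (A, w, D, E) \<longleftrightarrow>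
     valid L A w D \<and> valid L A w E \<and> tgt w D = tgt w E \<and> ev L A w D = ev L A w E"

definition shift :: "nat \<Rightarrow> ('a,'c) diag \<Rightarrow> ('a,'c) diag" where
  "shift p D = map (\<lambda>(q, g). (p + q, g)) D"

text \<open>
  A derivation is a list of instructions: \<open>Xch i\<close> interchanges the neighbouring steps with list indices
  \<open>i\<close> and \<open>i + 1\<close>; \<open>App n i x\<close> and \<open>Rev n i x\<close> use equation number \<open>n\<close> from left to right, respectively
  from right to left, at list index \<open>i\<close> and horizontal offset \<open>x\<close>.
\<close>

datatype instr = Xch nat | App nat nat nat | Rev nat nat nat

text \<open>In the word between the two steps, the upper one reads \<open>length x\<close> letters
  from \<open>p\<close> and the lower one has written \<open>length y'\<close> letters from
  \<open>q\<close>. When these ranges are disjoint, the step on the right is renumbered by the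
  change of length on its left; each guard makes the truncated subtraction exact.\<close>

fun xch :: "('a,'c) diag \<Rightarrow> ('a,'c) diag option" where
  "xch ((p, x, \<alpha>, y) # (q, x', \<beta>, y') # D) =
     (if p + length x \<le> q then Some ((q + length y - length x, x', \<beta>, y') # (p, x, \<alpha>, y) # D)
      else if q + length y' \<le> p then Some ((q, x', \<beta>, y') # (p + length x' - length y', x, \<alpha>, y) # D)
      else None)"
| "xch _ = None"

text \<open>The word \<open>v\<close> is compared as well as the steps: it may contain letters that
  no step of \<open>l\<close> touches, and for an empty \<open>l\<close> nothing else fixes the
  place.\<close>

fun rewr :: "('o,'a,'c) tcat \<Rightarrow> 'o \<Rightarrow> 'a list \<Rightarrow> ('o,'a,'c) rule \<Rightarrow> nat \<Rightarrow> ('a,'c) diag \<Rightarrow> ('a,'c) diag option" where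
  "rewr L A w (B, v, l, r) p D =
     (let E = drop (length l) D; u = tgt w E in
      if take (length l) D = shift p l \<and> p + length v \<le> length u \<and>
         take (length v) (drop p u) = v \<and> ob L A (drop (p + length v) u) = B
      then Some (shift p r @ E) else None)"

fun at :: "nat \<Rightarrow> ('d list \<Rightarrow> 'd list option) \<Rightarrow> 'd list \<Rightarrow> 'd list option" where
  "at 0 f D = f D"
| "at (Suc n) f [] = None"
| "at (Suc n) f (d # D) = map_option ((#) d) (at n f D)"

fun flip :: "('o,'a,'c) rule \<Rightarrow> ('o,'a,'c) rule" where
  "flip (B, v, l, r) = (B, v, r, l)"

fun exec :: "('o,'a,'c) tcat \<Rightarrow> 'o \<Rightarrow> 'a list \<Rightarrow> ('o,'a,'c) rule list \<Rightarrow> instr \<Rightarrow> ('a,'c) diag \<Rightarrow> ('a,'c) diag option" where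
  "exec L A w Rs (Xch i) D = at i xch D"
| "exec L A w Rs (App n i p) D = (if n < length Rs then at i (rewr L A w (Rs ! n) p) D else None)"
| "exec L A w Rs (Rev n i p) D = (if n < length Rs then at i (rewr L A w (flip (Rs ! n)) p) D else None)"

fun run :: "('o,'a,'c) tcat \<Rightarrow> 'o \<Rightarrow> 'a list \<Rightarrow> ('o,'a,'c) rule list \<Rightarrow> instr list \<Rightarrow> ('a,'c) diag \<Rightarrow> ('a,'c) diag option" where
  "run L A w Rs [] D = Some D"
| "run L A w Rs (c # cs) D = Option.bind (exec L A w Rs c D) (run L A w Rs cs)"

section \<open>The axioms of a 2-category as usable rules\<close>

locale two_cat =
  fixes L :: "('o,'a,'c) tcat"
  assumes two_category: "two_category L"
begin

lemma
  shows src1_Ob: "v \<in> Ar L \<Longrightarrow> src1 L v \<in> Ob L"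
    and trg1_Ob: "v \<in> Ar L \<Longrightarrow> trg1 L v \<in> Ob L"
    and id1_Ar: "A \<in> Ob L \<Longrightarrow> id1 L A \<in> Ar L"
    and src1_id1: "A \<in> Ob L \<Longrightarrow> src1 L (id1 L A) = A"
    and trg1_id1: "A \<in> Ob L \<Longrightarrow> trg1 L (id1 L A) = A"
  using two_category by (simp_all add: two_category_def)

lemma
  assumes "u \<in> Ar L" "w \<in> Ar L" "trg1 L w = src1 L u"
  shows comp1_Ar: "comp1 L u w \<in> Ar L"
    and src1_comp1: "src1 L (comp1 L u w) = src1 L w"
    and trg1_comp1: "trg1 L (comp1 L u w) = trg1 L u"
    and hcomp_id2: "hcomp L (id2 L u) (id2 L w) = id2 L (comp1 L u w)"
  using two_category assms by (simp_all add: two_category_def)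

lemma
  assumes "u \<in> Ar L"
  shows comp1_id1_left: "trg1 L u = A \<Longrightarrow> comp1 L (id1 L A) u = u"
    and comp1_id1_right: "src1 L u = A \<Longrightarrow> comp1 L u (id1 L A) = u"
    and id2_Cl: "id2 L u \<in> Cl L"
    and dom2_id2: "dom2 L (id2 L u) = u"
    and cod2_id2: "cod2 L (id2 L u) = u"
  using two_category assms by (auto simp: two_category_def)

lemma comp1_assoc:
  assumes "u \<in> Ar L" "v \<in> Ar L" "w \<in> Ar L" "trg1 L w = src1 L v" "trg1 L v = src1 L u"
  shows "comp1 L (comp1 L u v) w = comp1 L u (comp1 L v w)"
  using two_category assms by (simp add: two_category_def)

lemma
  assumes "\<alpha> \<in> Cl L"
  shows dom2_Ar: "dom2 L \<alpha> \<in> Ar L"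
    and cod2_Ar: "cod2 L \<alpha> \<in> Ar L"
    and src1_cod2: "src1 L (cod2 L \<alpha>) = src1 L (dom2 L \<alpha>)"
    and trg1_cod2: "trg1 L (cod2 L \<alpha>) = trg1 L (dom2 L \<alpha>)"
    and vcomp_id2_left: "cod2 L \<alpha> = u \<Longrightarrow> vcomp L (id2 L u) \<alpha> = \<alpha>"
    and vcomp_id2_right: "dom2 L \<alpha> = u \<Longrightarrow> vcomp L \<alpha> (id2 L u) = \<alpha>"
    and hcomp_id1_left: "trg1 L (dom2 L \<alpha>) = A \<Longrightarrow> hcomp L (id2 L (id1 L A)) \<alpha> = \<alpha>"
    and hcomp_id1_right: "src1 L (dom2 L \<alpha>) = A \<Longrightarrow> hcomp L \<alpha> (id2 L (id1 L A)) = \<alpha>"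
  using two_category assms by (auto simp: two_category_def)

lemma
  assumes "\<alpha> \<in> Cl L" "\<beta> \<in> Cl L" "dom2 L \<alpha> = cod2 L \<beta>"
  shows vcomp_Cl: "vcomp L \<alpha> \<beta> \<in> Cl L"
    and dom2_vcomp: "dom2 L (vcomp L \<alpha> \<beta>) = dom2 L \<beta>"
    and cod2_vcomp: "cod2 L (vcomp L \<alpha> \<beta>) = cod2 L \<alpha>"
  using two_category assms by (simp_all add: two_category_def)

lemma
  assumes "\<alpha> \<in> Cl L" "\<beta> \<in> Cl L" "trg1 L (dom2 L \<beta>) = src1 L (dom2 L \<alpha>)"
  shows hcomp_Cl: "hcomp L \<alpha> \<beta> \<in> Cl L"
    and dom2_hcomp: "dom2 L (hcomp L \<alpha> \<beta>) = comp1 L (dom2 L \<alpha>) (dom2 L \<beta>)"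
    and cod2_hcomp: "cod2 L (hcomp L \<alpha> \<beta>) = comp1 L (cod2 L \<alpha>) (cod2 L \<beta>)"
  using two_category assms by (simp_all add: two_category_def)

lemma vcomp_assoc:
  assumes "\<alpha> \<in> Cl L" "\<beta> \<in> Cl L" "\<gamma> \<in> Cl L" "dom2 L \<alpha> = cod2 L \<beta>" "dom2 L \<beta> = cod2 L \<gamma>"
  shows "vcomp L (vcomp L \<alpha> \<beta>) \<gamma> = vcomp L \<alpha> (vcomp L \<beta> \<gamma>)"
  using two_category assms by (simp add: two_category_def)

lemma hcomp_assoc:
  assumes "\<alpha> \<in> Cl L" "\<beta> \<in> Cl L" "\<gamma> \<in> Cl L"
    "trg1 L (dom2 L \<gamma>) = src1 L (dom2 L \<beta>)" "trg1 L (dom2 L \<beta>) = src1 L (dom2 L \<alpha>)"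
  shows "hcomp L (hcomp L \<alpha> \<beta>) \<gamma> = hcomp L \<alpha> (hcomp L \<beta> \<gamma>)"
  using two_category assms by (simp add: two_category_def)

lemma interchange:
  assumes "\<alpha> \<in> Cl L" "\<beta> \<in> Cl L" "\<gamma> \<in> Cl L" "\<delta> \<in> Cl L"
    "dom2 L \<alpha> = cod2 L \<beta>" "dom2 L \<gamma> = cod2 L \<delta>" "trg1 L (dom2 L \<gamma>) = src1 L (dom2 L \<alpha>)"
  shows "hcomp L (vcomp L \<alpha> \<beta>) (vcomp L \<gamma> \<delta>) = vcomp L (hcomp L \<alpha> \<gamma>) (hcomp L \<beta> \<delta>)"
proof -
  have "\<forall>\<alpha>\<in>Cl L. \<forall>\<beta>\<in>Cl L. \<forall>\<gamma>\<in>Cl L. \<forall>\<delta>\<in>Cl L.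
        dom2 L \<alpha> = cod2 L \<beta> \<longrightarrow> dom2 L \<gamma> = cod2 L \<delta> \<longrightarrow> trg1 L (dom2 L \<gamma>) = src1 L (dom2 L \<alpha>) \<longrightarrow>
        hcomp L (vcomp L \<alpha> \<beta>) (vcomp L \<gamma> \<delta>) = vcomp L (hcomp L \<alpha> \<gamma>) (hcomp L \<beta> \<delta>)"
    using two_category by (simp add: two_category_def)
  with assms show ?thesis by blast
qed

lemmas tc_simps = src1_Ob trg1_Ob id1_Ar src1_id1 trg1_id1 comp1_Ar src1_comp1 trg1_comp1
  comp1_id1_left comp1_id1_right id2_Cl dom2_id2 cod2_id2 dom2_Ar cod2_Ar
  vcomp_id2_left vcomp_id2_right hcomp_id1_left hcomp_id1_right
  vcomp_Cl dom2_vcomp cod2_vcomp hcomp_Cl dom2_hcomp cod2_hcomp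

section \<open>Words of 1-cells and whiskering\<close>

lemma ob_append: "ob L A (u @ w) = ob L (ob L A w) u"
  by (cases u) simp_all

lemma pth_ob: "pth L A w \<Longrightarrow> ob L A w \<in> Ob L"
  by (cases w) (auto simp: tc_simps)

lemma pth_append: "pth L A (u @ w) \<longleftrightarrow> pth L A w \<and> pth L (ob L A w) u"
  by (induction u) (auto simp: ob_append pth_ob)

lemma cw_Cons: "pth L A (x # w) \<Longrightarrow> cw L A (x # w) = comp1 L x (cw L A w)"
  by (cases w) (auto simp: tc_simps)

lemma cw_hom: "pth L A w \<Longrightarrow> cw L A w \<in> Ar L \<and> src1 L (cw L A w) = A \<and> trg1 L (cw L A w) = ob L A w"
proof (induction w)
  case (Cons x w)
  then show ?case by (subst (1 2 3) cw_Cons) (auto simp: tc_simps)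
qed (simp add: tc_simps)

lemma
  assumes "pth L A w"
  shows cw_Ar: "cw L A w \<in> Ar L"
    and src1_cw: "src1 L (cw L A w) = A"
    and trg1_cw: "trg1 L (cw L A w) = ob L A w"
  using cw_hom[OF assms] by auto

lemma cw_append: "pth L A (u @ w) \<Longrightarrow> cw L A (u @ w) = comp1 L (cw L (ob L A w) u) (cw L A w)"
proof (induction u)
  case Nil
  then show ?case by (simp add: tc_simps cw_Ar trg1_cw)
next
  case (Cons x u)
  have p: "pth L A (u @ w)" "pth L (ob L A w) (x # u)" "pth L A (x # (u @ w))" "pth L A w"
    using Cons.prems by (simp_all add: pth_append ob_append)
  have "cw L A ((x # u) @ w) = comp1 L x (cw L A (u @ w))"
    using cw_Cons[OF p(3)] by simp
  also have "\<dots> = comp1 L x (comp1 L (cw L (ob L A w) u) (cw L A w))"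
    using Cons.IH[OF p(1)] by simp
  also have "\<dots> = comp1 L (comp1 L x (cw L (ob L A w) u)) (cw L A w)"
    using p by (simp add: comp1_assoc cw_Ar src1_cw trg1_cw pth_append)
  finally show ?case using cw_Cons[OF p(2)] by simp
qed

lemma arrD:
  assumes "arr L A x \<alpha> y"
  shows "pth L A x" "pth L A y" "ob L A y = ob L A x" "\<alpha> \<in> Cl L" "dom2 L \<alpha> = cw L A x" "cod2 L \<alpha> = cw L A y"
  using assms by (auto simp: arr_def hom2_def)

lemma arrI:
  assumes "pth L A x" "pth L A y" "ob L A y = ob L A x" "\<alpha> \<in> Cl L" "dom2 L \<alpha> = cw L A x" "cod2 L \<alpha> = cw L A y"
  shows "arr L A x \<alpha> y"
  using assms by (auto simp: arr_def hom2_def)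

lemmas cw_simps = cw_Ar src1_cw trg1_cw

lemma arr_id2: "pth L A w \<Longrightarrow> arr L A w (id2 L (cw L A w)) w"
  by (rule arrI) (simp_all add: tc_simps cw_simps)

lemma arr_vcomp: "arr L A x \<alpha> y \<Longrightarrow> arr L A y \<beta> z \<Longrightarrow> arr L A x (vcomp L \<beta> \<alpha>) z"
  by (rule arrI) (simp_all add: tc_simps arrD[of A x \<alpha> y] arrD[of A y \<beta> z])

lemma arr_hcomp:
  assumes "arr L B x \<alpha> y" "arr L A x' \<beta> y'" "ob L A x' = B"
  shows "arr L A (x @ x') (hcomp L \<alpha> \<beta>) (y @ y')"
  using arrD[OF assms(1)] arrD[OF assms(2)] assms(3)
  by (intro arrI) (auto simp: tc_simps pth_append ob_append cw_append cw_simps)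

text \<open>Trades iterated whiskering for one horizontal composite with an identity, to which
  associativity and interchange apply directly. \<open>rw_hcomp\<close> is the same on the other
  side.\<close>

lemma lw_hcomp:
  assumes "arr L B x \<alpha> y" "pth L (ob L B x) u"
  shows "lw L u \<alpha> = hcomp L (id2 L (cw L (ob L B x) u)) \<alpha>"
  using assms(2)
proof (induction u)
  case Nil
  then show ?case using arrD[OF assms(1)] by (simp add: tc_simps cw_simps)
next
  case (Cons z u)
  note a = arrD[OF assms(1)]
  have "lw L (z # u) \<alpha> = hcomp L (id2 L z) (hcomp L (id2 L (cw L (ob L B x) u)) \<alpha>)"
    using Cons by (simp add: wl_def)
  also have "\<dots> = hcomp L (hcomp L (id2 L z) (id2 L (cw L (ob L B x) u))) \<alpha>"
    using Cons.prems a by (simp add: hcomp_assoc tc_simps cw_simps)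
  also have "hcomp L (id2 L z) (id2 L (cw L (ob L B x) u)) = id2 L (cw L (ob L B x) (z # u))"
    using Cons.prems by (subst cw_Cons) (simp_all add: hcomp_id2 cw_simps)
  finally show ?case .
qed

lemma arr_lw: "arr L B x \<alpha> y \<Longrightarrow> pth L (ob L B x) u \<Longrightarrow> arr L B (u @ x) (lw L u \<alpha>) (u @ y)"
  by (subst lw_hcomp) (auto intro: arr_hcomp arr_id2)

lemma rw_hcomp:
  assumes "arr L B x \<alpha> y" "pth L A w" "ob L A w = B"
  shows "rw L \<alpha> w = hcomp L \<alpha> (id2 L (cw L A w))"
  using assms
proof (induction w arbitrary: B x \<alpha> y)
  case Nil
  then show ?case using arrD[OF Nil(1)] by (simp add: tc_simps cw_simps)
next
  case (Cons z w)
  note a = arrD[OF Cons(2)]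
  have z: "z \<in> Ar L" "src1 L z = ob L A w" "pth L A w" "trg1 L z = B"
    using Cons.prems by auto
  have "arr L (ob L A w) [z] (id2 L z) [z]"
    using z pth_ob[OF z(3)] by (intro arrI) (simp_all add: tc_simps)
  then have "arr L (ob L A w) (x @ [z]) (wr L \<alpha> z) (y @ [z])"
    unfolding wr_def using z by (intro arr_hcomp[OF Cons(2)]) simp_all
  from Cons.IH[OF this z(3) refl]
  have "rw L \<alpha> (z # w) = hcomp L (hcomp L \<alpha> (id2 L z)) (id2 L (cw L A w))"
    by (simp add: wr_def)
  also have "\<dots> = hcomp L \<alpha> (hcomp L (id2 L z) (id2 L (cw L A w)))"
    using z a by (simp add: hcomp_assoc tc_simps cw_simps)
  also have "hcomp L (id2 L z) (id2 L (cw L A w)) = id2 L (cw L A (z # w))"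
    using z by (subst cw_Cons) (simp_all add: hcomp_id2 cw_simps)
  finally show ?case .
qed

lemma arr_rw: "arr L B x \<alpha> y \<Longrightarrow> pth L A w \<Longrightarrow> ob L A w = B \<Longrightarrow> arr L A (x @ w) (rw L \<alpha> w) (y @ w)"
  by (subst rw_hcomp) (auto intro: arr_hcomp arr_id2)

lemma lw_append: "lw L (u @ u') \<alpha> = lw L u (lw L u' \<alpha>)"
  by (induction u) simp_all

lemma rw_append: "rw L \<alpha> (w @ w') = rw L (rw L \<alpha> w) w'"
  by (induction w arbitrary: \<alpha>) simp_all

lemma lw_rw:
  assumes "arr L B x \<alpha> y" "pth L (ob L B x) u" "pth L A w" "ob L A w = B"
  shows "lw L u (rw L \<alpha> w) = rw L (lw L u \<alpha>) w"
proof -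
  note a = arrD[OF assms(1)]
  have o: "ob L A (x @ w) = ob L B x" using assms by (simp add: ob_append)
  show ?thesis
    using assms(2-4) a o
    by (simp add: rw_hcomp[OF assms(1,3,4)] rw_hcomp[OF arr_lw[OF assms(1,2), unfolded lw_hcomp[OF assms(1,2)]] assms(3,4)]
        lw_hcomp[OF assms(1,2)] lw_hcomp[OF arr_hcomp[OF assms(1) arr_id2[OF assms(3)] assms(4)], of u]
        hcomp_assoc tc_simps cw_simps)
qed

lemma lw_id2: "pth L B x \<Longrightarrow> pth L (ob L B x) u \<Longrightarrow> lw L u (id2 L (cw L B x)) = id2 L (cw L B (u @ x))"
  using lw_hcomp[OF arr_id2, of B x u]
  by (simp add: cw_append pth_append hcomp_id2 cw_simps)

lemma rw_id2: "pth L B x \<Longrightarrow> pth L A w \<Longrightarrow> ob L A w = B \<Longrightarrow> rw L (id2 L (cw L B x)) w = id2 L (cw L A (x @ w))"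
  using rw_hcomp[OF arr_id2, of B x A w]
  by (simp add: cw_append pth_append hcomp_id2 cw_simps)

lemma lw_vcomp:
  assumes "arr L B x \<alpha> y" "arr L B y \<beta> z" "pth L (ob L B x) u"
  shows "lw L u (vcomp L \<beta> \<alpha>) = vcomp L (lw L u \<beta>) (lw L u \<alpha>)"
proof -
  note a = arrD[OF assms(1)] and b = arrD[OF assms(2)]
  let ?i = "id2 L (cw L (ob L B x) u)"
  have "hcomp L (vcomp L ?i ?i) (vcomp L \<beta> \<alpha>) = vcomp L (hcomp L ?i \<beta>) (hcomp L ?i \<alpha>)"
    using assms(3) a b by (intro interchange) (simp_all add: tc_simps cw_simps)
  moreover have "vcomp L ?i ?i = ?i"
    using assms(3) by (simp add: tc_simps cw_simps)
  ultimately show ?thesis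
    using lw_hcomp[OF assms(1,3)] lw_hcomp[OF assms(2), of u] lw_hcomp[OF arr_vcomp[OF assms(1,2)] assms(3)]
      assms(3) a by simp
qed

lemma rw_vcomp:
  assumes "arr L B x \<alpha> y" "arr L B y \<beta> z" "pth L A w" "ob L A w = B"
  shows "rw L (vcomp L \<beta> \<alpha>) w = vcomp L (rw L \<beta> w) (rw L \<alpha> w)"
proof -
  note a = arrD[OF assms(1)] and b = arrD[OF assms(2)]
  let ?i = "id2 L (cw L A w)"
  have "hcomp L (vcomp L \<beta> \<alpha>) (vcomp L ?i ?i) = vcomp L (hcomp L \<beta> ?i) (hcomp L \<alpha> ?i)"
    using assms(3,4) a b by (intro interchange) (simp_all add: tc_simps cw_simps)
  moreover have "vcomp L ?i ?i = ?i"
    using assms(3) by (simp add: tc_simps cw_simps)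
  ultimately show ?thesis
    using rw_hcomp[OF assms(1,3,4)] rw_hcomp[OF assms(2-4)] rw_hcomp[OF arr_vcomp[OF assms(1,2)] assms(3,4)]
    by simp
qed

text \<open>Interchange with identities inserted at opposite corners. Comparing the two results
  gives the exchange of independent steps; each of them also presents a horizontal composite as a
  diagram.\<close>

lemma hcomp_split:
  assumes "arr L B x \<alpha> y" "arr L A x' \<beta> y'" "ob L A x' = B"
  shows "hcomp L \<alpha> \<beta> = vcomp L (rw L \<alpha> y') (lw L x \<beta>)"
    and "hcomp L \<alpha> \<beta> = vcomp L (lw L y \<beta>) (rw L \<alpha> x')"
proof -
  note a = arrD[OF assms(1)] and b = arrD[OF assms(2)]
  have 1: "hcomp L (vcomp L \<alpha> (id2 L (cw L B x))) (vcomp L (id2 L (cw L A y')) \<beta>) =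
      vcomp L (hcomp L \<alpha> (id2 L (cw L A y'))) (hcomp L (id2 L (cw L B x)) \<beta>)"
    using assms(3) a b by (intro interchange) (simp_all add: tc_simps cw_simps)
  have 2: "hcomp L (vcomp L (id2 L (cw L B y)) \<alpha>) (vcomp L \<beta> (id2 L (cw L A x'))) =
      vcomp L (hcomp L (id2 L (cw L B y)) \<beta>) (hcomp L \<alpha> (id2 L (cw L A x')))"
    using assms(3) a b by (intro interchange) (simp_all add: tc_simps cw_simps)
  have l: "lw L u \<beta> = hcomp L (id2 L (cw L B u)) \<beta>" if "pth L B u" for u
    using lw_hcomp[OF assms(2)] assms(3) that by simp
  have r: "rw L \<alpha> u = hcomp L \<alpha> (id2 L (cw L A u))" if "pth L A u" "ob L A u = B" for u
    using rw_hcomp[OF assms(1)] that by simp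
  show "hcomp L \<alpha> \<beta> = vcomp L (rw L \<alpha> y') (lw L x \<beta>)"
    using 1 a b assms(3) by (simp add: l r tc_simps)
  show "hcomp L \<alpha> \<beta> = vcomp L (lw L y \<beta>) (rw L \<alpha> x')"
    using 2 a b assms(3) by (simp add: l r tc_simps)
qed

section \<open>Evaluation of diagrams, also inside a context\<close>

lemma fitsE:
  assumes "fits L A w (p, x, \<alpha>, y)"
  obtains u v where "w = u @ x @ v" "length u = p" "arr L (ob L A v) x \<alpha> y"
proof
  show "w = take p w @ x @ drop (p + length x) w"
    using assms by (metis append_take_drop_id drop_drop add.commute fits.simps)
qed (use assms in auto)

lemma arr_whisk:
  assumes "pth L A w" "fits L A w d"
  shows "arr L A w (whisk L w d) (act w d)"
proof (cases d)
  case (fields p x \<alpha> y)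
  from assms(2)[unfolded fields] obtain u v
    where w: "w = u @ x @ v" "length u = p" "arr L (ob L A v) x \<alpha> y" by (rule fitsE)
  have "pth L A v" "pth L (ob L A (x @ v)) u"
    using assms(1) by (simp_all add: w pth_append ob_append)
  from arr_lw[OF arr_rw[OF w(3) this(1) refl] this(2)] show ?thesis
    using w by (simp add: fields)
qed

lemma arr_ev: "valid L A w D \<Longrightarrow> arr L A w (ev L A w D) (tgt w D)"
  and ev_Cons: "valid L A w (d # D) \<Longrightarrow> ev L A w (d # D) = vcomp L (whisk L (tgt w D) d) (ev L A w D)"
proof -
  have e: "ev L A w (d # D) = vcomp L (whisk L (tgt w D) d) (ev L A w D)"
    if "valid L A w (d # D)" for d D
  proof (cases D)
    case Nil
    with that have "arr L A w (whisk L w d) (act w d)" by (simp add: arr_whisk)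
    from arrD[OF this] show ?thesis by (simp add: Nil tc_simps)
  qed simp
  then show "valid L A w (d # D) \<Longrightarrow> ev L A w (d # D) = vcomp L (whisk L (tgt w D) d) (ev L A w D)" .
  show "valid L A w D \<Longrightarrow> arr L A w (ev L A w D) (tgt w D)"
  proof (induction D)
    case (Cons d D)
    then have "arr L A w (ev L A w D) (tgt w D)" "pth L A (tgt w D)" "fits L A (tgt w D) d"
      by (auto dest: arrD(2))
    with Cons.prems show ?case
      by (simp only: e tgt.simps) (blast intro: arr_vcomp arr_whisk)
  qed (simp add: arr_id2)
qed

lemma arr_evI: "\<alpha> = ev L A w D \<Longrightarrow> valid L A w D \<Longrightarrow> tgt w D = y \<Longrightarrow> arr L A w \<alpha> y"
  using arr_ev by blast

lemma valid_pth: "valid L A w D \<Longrightarrow> pth L A w"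
  and valid_pth_tgt: "valid L A w D \<Longrightarrow> pth L A (tgt w D)"
  using arrD(1,2)[OF arr_ev] by blast+

lemma tgt_append: "tgt w (D @ E) = tgt (tgt w E) D"
  by (induction D) simp_all

lemma valid_append: "valid L A w (D @ E) \<longleftrightarrow> valid L A w E \<and> valid L A (tgt w E) D"
  by (induction D) (auto simp: tgt_append valid_pth_tgt)

lemma ev_append:
  "valid L A w (D @ E) \<Longrightarrow> ev L A w (D @ E) = vcomp L (ev L A (tgt w E) D) (ev L A w E)"
proof (induction D)
  case Nil
  from arrD[OF arr_ev[OF Nil[simplified]]] show ?case by (simp add: tc_simps)
next
  case (Cons d D)
  have v: "valid L A w E" "valid L A (tgt w E) D" "valid L A (tgt w E) (d # D)" "valid L A w (D @ E)"
    "fits L A (tgt (tgt w E) D) d"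
    using Cons.prems by (auto simp: valid_append tgt_append)
  note a = arrD[OF arr_ev[OF v(1)]] arrD[OF arr_ev[OF v(2)]] arrD[OF arr_whisk[OF valid_pth_tgt[OF v(2)] v(5)]]
  have "ev L A w ((d # D) @ E) = vcomp L (whisk L (tgt (tgt w E) D) d) (vcomp L (ev L A (tgt w E) D) (ev L A w E))"
    using ev_Cons[of A w d "D @ E"] Cons v by (simp add: tgt_append)
  also have "\<dots> = vcomp L (vcomp L (whisk L (tgt (tgt w E) D) d) (ev L A (tgt w E) D)) (ev L A w E)"
    using a by (simp add: vcomp_assoc)
  finally show ?case using ev_Cons[OF v(3)] by simp
qed

text \<open>Whiskering preserves vertical composition, so a diagram placed between \<open>u\<close>
  and \<open>w\<close> evaluates to its whiskered value. This is what makes an equation usable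
  inside a longer word.\<close>

lemma shift_context:
  assumes "valid L B v D" "pth L A w" "ob L A w = B" "pth L (ob L B v) u"
  shows "valid L A (u @ v @ w) (shift (length u) D) \<and>
    tgt (u @ v @ w) (shift (length u) D) = u @ tgt v D @ w \<and>
    ev L A (u @ v @ w) (shift (length u) D) = lw L u (rw L (ev L B v D) w)"
  using assms(1,4)
proof (induction D)
  case Nil
  then show ?case using assms(2,3)
    by (auto simp: shift_def pth_append ob_append rw_id2 lw_id2)
next
  case (Cons d D)
  obtain p x \<alpha> y where d: "d = (p, x, \<alpha>, y)" by (cases d)
  have v: "valid L B v D" "fits L B (tgt v D) (p, x, \<alpha>, y)" using Cons.prems d by auto
  note IH = Cons.IH[OF v(1) Cons.prems(2)]
  have o: "ob L B (tgt v D) = ob L B v" "pth L B (tgt v D)"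
    using arrD[OF arr_ev[OF v(1)]] by auto
  from v(2) obtain u' v' where w: "tgt v D = u' @ x @ v'" "length u' = p" "arr L (ob L B v') x \<alpha> y"
    by (rule fitsE)
  have s: "shift (length u) (d # D) = (length u + p, x, \<alpha>, y) # shift (length u) D"
    by (simp add: shift_def d)
  let ?W = "u @ v @ w"
  have pp: "pth L B v'" "pth L (ob L B (x @ v')) u'" "pth L A (v' @ w)" "ob L A (v' @ w) = ob L B v'"
    using o assms(2,3) by (simp_all add: w pth_append ob_append)
  have val: "valid L A ?W (shift (length u) (d # D))"
    using IH unfolding s by (simp add: w ob_append assms(3))
  have t: "tgt ?W (shift (length u) (d # D)) = u @ tgt v (d # D) @ w"
    using IH unfolding s by (simp add: w d)
  let ?d = "whisk L (tgt v D) d"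
  have wd: "arr L B (tgt v D) ?d (act (tgt v D) d)"
    using arr_whisk o v d by blast
  have r: "rw L \<alpha> (v' @ w) = rw L (rw L \<alpha> v') w"
    by (rule rw_append)
  have l: "lw L u' (rw L (rw L \<alpha> v') w) = rw L (lw L u' (rw L \<alpha> v')) w"
    using arr_rw[OF w(3) pp(1) refl] pp(2) assms(2,3) by (rule lw_rw)
  have "whisk L (u @ tgt v D @ w) (length u + p, x, \<alpha>, y) = lw L u (rw L ?d w)"
    by (simp add: w d lw_append r l)
  then have "ev L A ?W (shift (length u) (d # D)) = vcomp L (lw L u (rw L ?d w)) (lw L u (rw L (ev L B v D) w))"
    using ev_Cons[OF val[unfolded s]] IH unfolding s by simp
  also have "\<dots> = lw L u (vcomp L (rw L ?d w) (rw L (ev L B v D) w))"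
    using Cons.prems(2) assms(2,3) o
    by (intro lw_vcomp[symmetric, OF arr_rw[OF arr_ev[OF v(1)]] arr_rw[OF wd]]) (auto simp: ob_append assms(3))
  also have "\<dots> = lw L u (rw L (ev L B v (d # D)) w)"
    using rw_vcomp[OF arr_ev[OF v(1)] wd assms(2,3)] ev_Cons[OF Cons.prems(1)] by simp
  finally show ?case using val t by blast
qed

section \<open>Soundness of derivations\<close>

lemma sound_cong:
  assumes "sound L (A, tgt w post, D, E)" "valid L A w (pre @ D @ post)"
  shows "sound L (A, w, pre @ D @ post, pre @ E @ post)"
  using assms by (simp add: valid_append tgt_append ev_append)

lemma sound_flip: "sound L r \<Longrightarrow> sound L (flip r)"
  by (cases r) simp

lemma sound_trans: "sound L (A, w, D, E) \<Longrightarrow> sound L (A, w, E, F) \<Longrightarrow> sound L (A, w, D, F)"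
  by simp

lemma sound_rewr:
  assumes "sound L r" "valid L A w D" "rewr L A w r p D = Some D'"
  shows "sound L (A, w, D, D')"
proof -
  obtain B v l k where r: "r = (B, v, l, k)" by (cases r)
  let ?E = "drop (length l) D"
  let ?t = "tgt w ?E"
  have c: "take (length l) D = shift p l" "p + length v \<le> length ?t" "take (length v) (drop p ?t) = v"
     "ob L A (drop (p + length v) ?t) = B" "D' = shift p k @ ?E"
    using assms(3) by (auto simp: r Let_def split: if_splits)
  have D: "D = shift p l @ ?E" using c(1) append_take_drop_id[of "length l" D] by simp
  have vE: "valid L A w ?E" using assms(2) valid_append D by metis
  define u z where "u = take p ?t" and "z = drop (p + length v) ?t"
  have t: "?t = u @ v @ z" "length u = p"
    using c(2,3) unfolding u_def z_def by (metis append_take_drop_id drop_drop add.commute, simp)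
  have "pth L A ?t" using vE by (rule valid_pth_tgt)
  then have pp: "pth L A z" "ob L A z = B" "pth L (ob L B v) u"
    using c(4) by (auto simp: t pth_append ob_append simp flip: z_def)
  have sl: "valid L B v l" "valid L B v k" "tgt v l = tgt v k" "ev L B v l = ev L B v k"
    using assms(1) by (auto simp: r)
  have "sound L (A, ?t, shift p l, shift p k)"
    using shift_context[OF sl(1) pp] shift_context[OF sl(2) pp] sl(3,4) t by simp
  from sound_cong[OF this, of "[]"] assms(2) D c(5) show ?thesis by simp
qed

lemma exchange:
  assumes "arr L (ob L B (v @ x')) x \<alpha> y" "arr L B x' \<beta> y'" "pth L (ob L B x') v"
  shows "sound L (B, x @ v @ x',
    [(0, x, \<alpha>, y), (length x + length v, x', \<beta>, y')],
    [(length y + length v, x', \<beta>, y'), (0, x, \<alpha>, y)])"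
proof -
  note a = arrD[OF assms(1)] and b = arrD[OF assms(2)]
  have b': "arr L B (v @ x') (lw L v \<beta>) (v @ y')"
    using assms(2,3) by (rule arr_lw)
  have "vcomp L (rw L \<alpha> (v @ y')) (lw L x (lw L v \<beta>)) = vcomp L (lw L y (lw L v \<beta>)) (rw L \<alpha> (v @ x'))"
    using hcomp_split[OF assms(1) b' refl] by simp
  then show ?thesis
    using a b assms by (simp add: pth_append ob_append lw_append)
qed

lemma sound_exchange:
  assumes "valid L A w ((p, x, \<alpha>, y) # (q, x', \<beta>, y') # D)" "p + length x \<le> q"
  shows "sound L (A, w, (p, x, \<alpha>, y) # (q, x', \<beta>, y') # D,
      (q + length y - length x, x', \<beta>, y') # (p, x, \<alpha>, y) # D)"
proof -
  define W where "W = tgt w D"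
  have v: "valid L A w D" "fits L A W (q, x', \<beta>, y')" "fits L A (act W (q, x', \<beta>, y')) (p, x, \<alpha>, y)"
    using assms(1) by (auto simp: W_def)
  have pW: "pth L A W" using valid_pth_tgt[OF v(1)] W_def by simp
  from v(2) obtain z t where W: "W = z @ x' @ t" "length z = q" and b: "arr L (ob L A t) x' \<beta> y'"
    by (rule fitsE)
  let ?V = "z @ y' @ t"
  have V: "act W (q, x', \<beta>, y') = ?V" using W by simp
  define u m where "u = take p z" and "m = drop (p + length x) z"
  have "take (length x) (drop p z) = x" and ax: "arr L (ob L A (m @ y' @ t)) x \<alpha> y"
    using v(3) assms(2) W(2) unfolding V by (simp_all add: m_def)
  then have z: "z = u @ x @ m" "length u = p"
    unfolding u_def m_def using assms(2) W(2) by (metis append_take_drop_id drop_drop add.commute, simp)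
  have q: "q = p + (length x + length m)" using z W(2) by simp
  let ?B = "ob L A t"
  have o: "ob L ?B y' = ob L ?B x'" using arrD[OF b] by simp
  have pp: "pth L A t" "pth L (ob L ?B x') m" "pth L (ob L ?B (x @ m @ x')) u"
    using pW by (simp_all add: W z pth_append ob_append)
  have ax': "arr L (ob L ?B (m @ x')) x \<alpha> y"
    using ax by (simp add: ob_append o)
  have e: "sound L (?B, x @ m @ x', [(0, x, \<alpha>, y), (length x + length m, x', \<beta>, y')],
    [(length y + length m, x', \<beta>, y'), (0, x, \<alpha>, y)])"
    using ax' b pp(2) by (rule exchange)
  have "rewr L A w (?B, x @ m @ x', [(0, x, \<alpha>, y), (length x + length m, x', \<beta>, y')],
    [(length y + length m, x', \<beta>, y'), (0, x, \<alpha>, y)]) p ((p, x, \<alpha>, y) # (q, x', \<beta>, y') # D) =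
     Some ((q + length y - length x, x', \<beta>, y') # (p, x, \<alpha>, y) # D)"
    by (simp add: Let_def shift_def q W z flip: W_def)
  from sound_rewr[OF e assms(1) this] show ?thesis .
qed

lemma sound_exchange':
  assumes "valid L A w ((p, x, \<alpha>, y) # (q, x', \<beta>, y') # D)" "q + length y' \<le> p"
  shows "sound L (A, w, (p, x, \<alpha>, y) # (q, x', \<beta>, y') # D,
      (q, x', \<beta>, y') # (p + length x' - length y', x, \<alpha>, y) # D)"
proof -
  define W where "W = tgt w D"
  have v: "valid L A w D" "fits L A W (q, x', \<beta>, y')" "fits L A (act W (q, x', \<beta>, y')) (p, x, \<alpha>, y)"
    using assms(1) by (auto simp: W_def)
  have pW: "pth L A W" using valid_pth_tgt[OF v(1)] W_def by simp
  from v(2) obtain z t where W: "W = z @ x' @ t" "length z = q" and b: "arr L (ob L A t) x' \<beta> y'"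
    by (rule fitsE)
  let ?V = "z @ y' @ t" and ?k = "p - (q + length y')"
  have V: "act W (q, x', \<beta>, y') = ?V" using W by simp
  define m n where "m = take ?k t" and "n = drop (?k + length x) t"
  have d: "drop (p + i) ?V = drop (?k + i) t" for i
    using assms(2) W(2) by (simp add: algebra_simps)
  have "take (length x) (drop ?k t) = x" and ax: "arr L (ob L A n) x \<alpha> y"
    using v(3)[unfolded V fits.simps d d[of 0, unfolded add_0_right]] unfolding n_def by blast+
  moreover have "?k + length x \<le> length t"
    using v(3) assms(2) W(2) unfolding V by (simp, linarith)
  ultimately have t: "t = m @ x @ n" "length m = ?k"
    unfolding m_def n_def by (metis append_take_drop_id drop_drop add.commute, simp)
  have p: "p = q + (length y' + length m)" using t(2) assms(2) by simp
  let ?B = "ob L A n"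
  have pp: "pth L A n" "pth L (ob L ?B x) m" "pth L (ob L ?B (x' @ m @ x)) z"
    using pW by (simp_all add: W t pth_append ob_append)
  have b': "arr L (ob L ?B (m @ x)) x' \<beta> y'"
    using b by (simp add: t ob_append)
  have e: "sound L (?B, x' @ m @ x, [(length y' + length m, x, \<alpha>, y), (0, x', \<beta>, y')],
      [(0, x', \<beta>, y'), (length x' + length m, x, \<alpha>, y)])"
    using sound_flip[OF exchange[OF b' ax pp(2)]] by simp
  have "rewr L A w (?B, x' @ m @ x, [(length y' + length m, x, \<alpha>, y), (0, x', \<beta>, y')],
      [(0, x', \<beta>, y'), (length x' + length m, x, \<alpha>, y)]) q ((p, x, \<alpha>, y) # (q, x', \<beta>, y') # D) =
     Some ((q, x', \<beta>, y') # (p + length x' - length y', x, \<alpha>, y) # D)"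
    using W(2) by (simp add: Let_def shift_def p W t(1) flip: W_def)
  from sound_rewr[OF e assms(1) this] show ?thesis .
qed

lemma sound_xch:
  assumes "valid L A w D" "xch D = Some D'"
  shows "sound L (A, w, D, D')"
proof -
  from assms(2) obtain p x \<alpha> y q x' \<beta> y' E
    where D: "D = (p, x, \<alpha>, y) # (q, x', \<beta>, y') # E" by (cases D rule: xch.cases) auto
  show ?thesis
    using assms sound_exchange[of A w p x \<alpha> y q x' \<beta> y' E] sound_exchange'[of A w p x \<alpha> y q x' \<beta> y' E]
    unfolding D xch.simps by (auto simp del: sound.simps split: if_splits)
qed

text \<open>The steps in front of the rewritten tail remain valid with the same value because the
  tail keeps its target word.\<close>

lemma sound_at:
  assumes "\<And>w D D'. valid L A w D \<Longrightarrow> f w D = Some D' \<Longrightarrow> sound L (A, w, D, D')"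
  shows "valid L A w D \<Longrightarrow> at i (f w) D = Some D' \<Longrightarrow> sound L (A, w, D, D')"
proof (induction i arbitrary: D D')
  case 0
  then show ?case using assms by simp
next
  case (Suc i)
  then obtain d E E' where D: "D = d # E" "at i (f w) E = Some E'" "D' = d # E'"
    by (cases D) auto
  from Suc.IH[OF _ D(2)] Suc.prems have "sound L (A, w, E, E')" by (simp add: D)
  moreover have "valid L A w (d # E')" using calculation Suc.prems D by simp
  ultimately show ?case using Suc.prems by (simp add: D ev_Cons del: ev.simps)
qed

lemma sound_exec:
  assumes "list_all (sound L) Rs" "valid L A w D" "exec L A w Rs c D = Some D'"
  shows "sound L (A, w, D, D')"
proof (cases c)
  case (Xch i)
  show ?thesis
    using assms(2,3) Xch by (intro sound_at[where f="\<lambda>_. xch", OF sound_xch]) simp_all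
next
  case (App n i p)
  then have r: "sound L (Rs ! n)" and e: "at i (rewr L A w (Rs ! n) p) D = Some D'"
    using assms(1,3) by (simp_all add: list_all_length split: if_splits)
  show ?thesis
    by (rule sound_at[where f="\<lambda>w. rewr L A w (Rs ! n) p", OF sound_rewr[OF r] assms(2) e])
next
  case (Rev n i p)
  then have r: "sound L (flip (Rs ! n))" and e: "at i (rewr L A w (flip (Rs ! n)) p) D = Some D'"
    using assms(1,3) by (simp_all add: list_all_length sound_flip split: if_splits)
  show ?thesis
    by (rule sound_at[where f="\<lambda>w. rewr L A w (flip (Rs ! n)) p", OF sound_rewr[OF r] assms(2) e])
qed

text \<open>The engine of all derivations below: \<open>cs\<close> is a literal list, and equations
  are numbered from 0 in the order of the \<open>rule_Cons\<close> chain. Simplification checks the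
  first diagram and evaluates \<open>run\<close>.\<close>

lemma run_sound:
  assumes "list_all (sound L) Rs"
  shows "valid L A w D \<Longrightarrow> run L A w Rs cs D = Some D' \<Longrightarrow> sound L (A, w, D, D')"
proof (induction cs arbitrary: D)
  case (Cons c cs)
  then obtain E where "exec L A w Rs c D = Some E" "run L A w Rs cs E = Some D'"
    by (auto simp: bind_eq_Some_conv)
  with Cons show ?case
    using sound_exec[OF assms] sound_trans by (metis sound.simps)
qed simp

text \<open>Allows a defined 2-cell to serve as a single generator that an instruction can unfold or
  fold.\<close>

lemma sound_evI:
  assumes "\<alpha> = ev L A w D" "valid L A w D" "tgt w D = y"
  shows "sound L (A, w, [(0, w, \<alpha>, y)], D)"
  using assms arr_evI[OF assms] valid_pth by auto

lemma rule_Nil: "list_all (sound L) []"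
  by simp

lemma rule_Cons: "sound L r \<Longrightarrow> list_all (sound L) rs \<Longrightarrow> list_all (sound L) (r # rs)"
  by simp

text \<open>The definitions whisker by composite 1-cells, diagrams only by letters; this lemma and
  \<open>wr_comp1\<close> mediate.\<close>

lemma wl_comp1:
  assumes "u \<in> Ar L" "v \<in> Ar L" "\<alpha> \<in> Cl L" "src1 L u = trg1 L v" "src1 L v = trg1 L (dom2 L \<alpha>)"
  shows "wl L (comp1 L u v) \<alpha> = wl L u (wl L v \<alpha>)"
  using assms by (simp add: wl_def tc_simps hcomp_assoc flip: hcomp_id2)

lemma wr_comp1:
  assumes "u \<in> Ar L" "v \<in> Ar L" "\<alpha> \<in> Cl L" "src1 L u = trg1 L v" "src1 L (dom2 L \<alpha>) = trg1 L u"
  shows "wr L \<alpha> (comp1 L u v) = wr L (wr L \<alpha> u) v"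
  using assms by (simp add: wr_def tc_simps hcomp_assoc flip: hcomp_id2)

end

text \<open>\<open>at\<close> recurses on \<open>Suc\<close>, whereas the positions in a derivation
  are numerals.\<close>

lemma at_numeral: "at (numeral n) f (d # D) = map_option ((#) d) (at (pred_numeral n) f D)"
  by (simp add: numeral_eq_Suc)

lemmas run_simps = at_numeral Let_def shift_def

section \<open>Generators: multiplication, unit, law, idempotent, the two halves of a splitting,
  component of a 1-cell\<close>

abbreviation mc :: "('a,'c) mnd \<Rightarrow> ('a,'c) cell" where
  "mc T \<equiv> ([fst T, fst T], fst (snd T), [fst T])"

abbreviation ec :: "('a,'c) mnd \<Rightarrow> ('a,'c) cell" where
  "ec T \<equiv> ([], snd (snd T), [fst T])"

abbreviation lc :: "('a,'c) mnd \<Rightarrow> ('a,'c) mnd \<Rightarrow> 'c \<Rightarrow> ('a,'c) cell" where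
  "lc T S l \<equiv> ([fst T, fst S], l, [fst S, fst T])"

abbreviation kc :: "('a,'c) mnd \<Rightarrow> ('a,'c) mnd \<Rightarrow> 'c \<Rightarrow> ('a,'c) cell" where
  "kc S T k \<equiv> ([fst S, fst T], k, [fst S, fst T])"

abbreviation ic :: "('a,'c) mnd \<Rightarrow> ('a,'c) mnd \<Rightarrow> ('a,'c) mnd \<Rightarrow> 'c \<Rightarrow> ('a,'c) cell" where
  "ic M S T i \<equiv> ([fst M], i, [fst S, fst T])"

abbreviation pc :: "('a,'c) mnd \<Rightarrow> ('a,'c) mnd \<Rightarrow> ('a,'c) mnd \<Rightarrow> 'c \<Rightarrow> ('a,'c) cell" where
  "pc M S T p \<equiv> ([fst S, fst T], p, [fst M])"

abbreviation xc :: "('a,'c) mnd \<Rightarrow> 'a \<Rightarrow> ('a,'c) mnd \<Rightarrow> 'c \<Rightarrow> ('a,'c) cell" where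
  "xc T' v T x \<equiv> ([fst T', v], x, [v, fst T])"

section \<open>Weak distributive laws with a split idempotent\<close>

text \<open>The parameters follow the order of the composite \<open>st\<close>; the law goes from
  \<open>ts\<close> to \<open>st\<close>, hence the swap in \<open>wdl\<close>.\<close>

locale wdl_pair = two_cat L for L :: "('o,'a,'c) tcat" +
  fixes A :: 'o and S T :: "('a,'c) mnd" and l :: 'c
  assumes wdl: "wdl L A T S l"
begin

abbreviation k :: 'c where
  "k \<equiv> lambar L T S l"

lemma types [simp]:
  "A \<in> Ob L" "fst S \<in> Ar L" "src1 L (fst S) = A" "trg1 L (fst S) = A"
  "fst T \<in> Ar L" "src1 L (fst T) = A" "trg1 L (fst T) = A"
  using wdl by (auto simp: wdl_def is_monad_def hom1_def Let_def)

lemma arrs [simp]: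
  "arr L A [fst S, fst S] (fst (snd S)) [fst S]" "arr L A [] (snd (snd S)) [fst S]"
  "arr L A [fst T, fst T] (fst (snd T)) [fst T]" "arr L A [] (snd (snd T)) [fst T]"
  "arr L A [fst T, fst S] l [fst S, fst T]"
  using wdl by (auto simp: wdl_def is_monad_def hom2_def Let_def arr_def)

lemmas cells = arrs[unfolded arr_def hom2_def, simplified]

lemma k_ev: "k = ev L A [fst S, fst T] [(0, mc S), (1, lc T S l), (2, ec S)]"
  using cells by (simp add: lambar_def wl_comp1 tc_simps)

lemma arr_k [simp]: "arr L A [fst S, fst T] k [fst S, fst T]"
  by (rule arr_evI[OF k_ev]) simp_all

lemma k_def: "sound L (A, [fst S, fst T], [(0, kc S T k)], [(0, mc S), (1, lc T S l), (2, ec S)])"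
  by (rule sound_evI[OF k_ev]; simp)

lemma assoc_s: "sound L (A, [fst S, fst S, fst S], [(0, mc S), (1, mc S)], [(0, mc S), (0, mc S)])"
  and unitr_s: "sound L (A, [fst S], [(0, mc S), (1, ec S)], [])"
  and unitl_s: "sound L (A, [fst S], [(0, mc S), (0, ec S)], [])"
  and assoc_t: "sound L (A, [fst T, fst T, fst T], [(0, mc T), (1, mc T)], [(0, mc T), (0, mc T)])"
  and unitr_t: "sound L (A, [fst T], [(0, mc T), (1, ec T)], [])"
  using wdl by (auto simp: wdl_def is_monad_def Let_def)

lemma l_mt: "sound L (A, [fst T, fst T, fst S],
      [(0, lc T S l), (0, mc T)], [(1, mc T), (0, lc T S l), (1, lc T S l)])"
  and l_ms: "sound L (A, [fst T, fst S, fst S],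
      [(0, lc T S l), (1, mc S)], [(0, mc S), (1, lc T S l), (0, lc T S l)])"
  and l_et: "sound L (A, [fst S],
      [(0, lc T S l), (0, ec T)], [(0, mc S), (1, lc T S l), (2, ec S), (1, ec T)])"
  and l_es: "sound L (A, [fst T],
      [(0, lc T S l), (1, ec S)], [(1, mc T), (0, lc T S l), (0, ec T), (0, ec S)])"
  using wdl cells by (auto simp: wdl_def Let_def wl_comp1 wr_comp1 tc_simps)

text \<open>Replace \<open>\<lambda>.t\<eta>\<close> inside the definition by its axiom and read the
  axiom for \<open>\<lambda>.\<eta>s\<close> backwards in the result.\<close>

lemma k_def2:
  "sound L (A, [fst S, fst T],
      [(0, kc S T k)],
      [(1, mc T), (0, lc T S l), (0, ec T)])"
  by (rule run_sound[OF rule_Cons[OF k_def rule_Cons[OF l_es rule_Cons[OF l_et rule_Nil]]],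
      where cs="[App 0 0 0, App 1 1 1, Xch 0, Xch 3, Rev 2 1 0]"])
    (simp_all add: run_simps)

text \<open>In \<open>k_def\<close> the last step is the multiplication of \<open>S\<close>, so
  associativity of \<open>S\<close> is enough. \<open>k_mt\<close> is the mirror image, using
  \<open>k_def2\<close>.\<close>

lemma k_ms:
  "sound L (A, [fst S, fst S, fst T],
      [(0, kc S T k), (0, mc S)],
      [(0, mc S), (1, kc S T k)])"
  by (rule run_sound[OF rule_Cons[OF k_def rule_Cons[OF assoc_s rule_Nil]],
      where cs="[App 0 0 0, Xch 2, Xch 1, Rev 1 0 0, Rev 0 1 1]"])
    (simp_all add: run_simps)

lemma k_mt:
  "sound L (A, [fst S, fst T, fst T],
      [(0, kc S T k), (1, mc T)],
      [(1, mc T), (0, kc S T k)])"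
  by (rule run_sound[OF rule_Cons[OF k_def2 rule_Cons[OF assoc_t rule_Nil]],
      where cs="[App 0 0 0, Xch 2, Xch 1, App 1 0 1, Rev 0 1 0]"])
    (simp_all add: run_simps)

text \<open>The two copies of \<open>l\<close> merge by \<open>l_ms\<close> read backwards, and then
  the unit of \<open>S\<close> cancels.\<close>

lemma k_l:
  "sound L (A, [fst T, fst S],
      [(0, kc S T k), (0, lc T S l)],
      [(0, lc T S l)])"
  by (rule run_sound[OF rule_Cons[OF k_def rule_Cons[OF l_ms rule_Cons[OF unitr_s rule_Nil]]],
      where cs="[App 0 0 0, Xch 2, Rev 1 0 0, App 2 1 1]"])
    (simp_all add: run_simps)

text \<open>The second \<open>k\<close> passes the multiplication in the definition of the first and
  is absorbed by its \<open>l\<close>.\<close>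

lemma k_k:
  "sound L (A, [fst S, fst T],
      [(0, kc S T k), (0, kc S T k)],
      [(0, kc S T k)])"
  by (rule run_sound[OF rule_Cons[OF k_def rule_Cons[OF k_ms rule_Cons[OF k_l rule_Nil]]],
      where cs="[App 0 1 0, App 1 0 0, App 2 1 1, Rev 0 0 0]"])
    (simp_all add: run_simps)

lemma l_et_k:
  "sound L (A, [fst S],
      [(0, lc T S l), (0, ec T)],
      [(0, kc S T k), (1, ec T)])"
  by (rule run_sound[OF rule_Cons[OF l_et rule_Cons[OF k_def rule_Nil]],
      where cs="[App 0 0 0, Rev 1 0 0]"])
    (simp_all add: run_simps)

lemma l_es_k:
  "sound L (A, [fst T],
      [(0, lc T S l), (1, ec S)],
      [(0, kc S T k), (0, ec S)])"
  by (rule run_sound[OF rule_Cons[OF l_es rule_Cons[OF k_def2 rule_Nil]],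
      where cs="[App 0 0 0, Rev 1 0 0]"])
    (simp_all add: run_simps)

text \<open>Written as in \<open>k_def2\<close>, the idempotent can be moved through
  \<open>l\<close> and the product to the outside, since \<open>l\<close> respects both
  multiplications. There \<open>k_ms\<close> and \<open>k_l\<close> absorb it.\<close>

lemma lk_s:
  "sound L (A, [fst S, fst T, fst S],
      [(0, mc S), (1, lc T S l), (0, kc S T k)],
      [(0, mc S), (1, lc T S l)])"
  by (rule run_sound[OF rule_Cons[OF k_def2 rule_Cons[OF l_mt rule_Cons[OF l_ms rule_Cons[OF k_ms
      rule_Cons[OF k_l rule_Nil]]]]],
      where cs="[App 0 2 0, App 1 1 1, Xch 0, Xch 3, Rev 2 1 0, Xch 3, Xch 2, Rev 0 0 0, App 3 0 0, App 4 1 1]"])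
    (simp_all add: run_simps)

lemma lk_t:
  "sound L (A, [fst T, fst S, fst T],
      [(1, mc T), (0, lc T S l), (1, kc S T k)],
      [(1, mc T), (0, lc T S l)])"
  by (rule run_sound[OF rule_Cons[OF k_def rule_Cons[OF l_ms rule_Cons[OF l_mt rule_Cons[OF k_mt
      rule_Cons[OF k_l rule_Nil]]]]],
      where cs="[App 0 2 1, App 1 1 0, Xch 3, Xch 4, Xch 0, Rev 2 1 1, Xch 2, Rev 0 0 0, App 3 0 0, App 4 1 0]"])
    (simp_all add: run_simps)

text \<open>In the local idempotent closure this is exactly the condition for the product to be a
  2-cell between the 1-cells with idempotent \<open>k\<close>.\<close>

lemma kmkk:
  "sound L (A, [fst S, fst T, fst S, fst T],
      [(0, kc S T k), (1, mc T), (0, mc S), (1, lc T S l), (2, kc S T k), (0, kc S T k)],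
      [(1, mc T), (0, mc S), (1, lc T S l)])"
  by (rule run_sound[OF rule_Cons[OF k_ms rule_Cons[OF k_mt rule_Cons[OF k_l rule_Cons[OF lk_s
      rule_Cons[OF lk_t rule_Nil]]]]],
      where cs="[Xch 1, App 0 0 0, App 1 1 1, Xch 0, App 2 2 1, Xch 3, App 3 1 0, Xch 0, App 4 1 1, Xch 0]"])
    (simp_all add: run_simps)

lemma k_eta:
  "sound L (A, [],
      [(0, kc S T k), (0, lc T S l), (0, ec T), (0, ec S)],
      [(0, lc T S l), (0, ec T), (0, ec S)])"
  by (rule run_sound[OF rule_Cons[OF k_l rule_Nil],
      where cs="[App 0 0 0]"])
    (simp_all add: run_simps)

abbreviation mST :: 'c where
  "mST \<equiv> vcomp L (hcomp L (fst (snd S)) (fst (snd T))) (wl L (fst S) (wr L l (fst T)))"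

abbreviation eST :: 'c where
  "eST \<equiv> vcomp L l (hcomp L (snd (snd T)) (snd (snd S)))"

lemma mST_ev: "mST = ev L A [fst S, fst T, fst S, fst T] [(1, mc T), (0, mc S), (1, lc T S l)]"
proof -
  have "hcomp L (fst (snd S)) (fst (snd T)) = ev L A [fst S, fst S, fst T, fst T] [(1, mc T), (0, mc S)]"
    using hcomp_split(2)[of A "[fst S, fst S]" "fst (snd S)" "[fst S]" A "[fst T, fst T]" "fst (snd T)" "[fst T]"]
    by simp
  with ev_append[of A "[fst S, fst T, fst S, fst T]" "[(1, mc T), (0, mc S)]" "[(1, lc T S l)]"]
  show ?thesis by simp
qed

lemma eST_ev: "eST = ev L A [] [(0, lc T S l), (0, ec T), (0, ec S)]"
  using hcomp_split(1)[of A "[]" "snd (snd T)" "[fst T]" A "[]" "snd (snd S)" "[fst S]"] by simp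

lemma mST_absorb: "vcomp L k (vcomp L mST (hcomp L k k)) = mST"
proof -
  have "hcomp L k k = ev L A [fst S, fst T, fst S, fst T] [(2, kc S T k), (0, kc S T k)]"
    using hcomp_split(2)[of A "[fst S, fst T]" k "[fst S, fst T]" A "[fst S, fst T]" k "[fst S, fst T]"] by simp
  moreover have "ev L A [fst S, fst T, fst S, fst T]
      ([(0, kc S T k)] @ [(1, mc T), (0, mc S), (1, lc T S l)] @ [(2, kc S T k), (0, kc S T k)]) =
      vcomp L k (vcomp L mST (ev L A [fst S, fst T, fst S, fst T] [(2, kc S T k), (0, kc S T k)]))"
    unfolding mST_ev by (subst ev_append, simp, subst ev_append) simp_all
  ultimately show ?thesis
    using kmkk mST_ev by simp
qed

lemma eST_absorb: "vcomp L k eST = eST"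
  using k_eta unfolding eST_ev by simp

end

section \<open>The induced monad on a splitting of the idempotent\<close>

locale wdl_split = wdl_pair L A S T l
  for L :: "('o,'a,'c) tcat" and A S T l +
  fixes M :: "('a,'c) mnd" and i p :: 'c
  assumes M_hom: "fst M \<in> hom1 L A A"
    and i_hom: "i \<in> hom2 L (fst M) (comp1 L (fst S) (fst T))"
    and p_hom: "p \<in> hom2 L (comp1 L (fst S) (fst T)) (fst M)"
    and vcomp_p_i: "vcomp L p i = id2 L (fst M)"
    and vcomp_i_p: "vcomp L i p = k"
    and mu_M: "fst (snd M) = vcomp L p (vcomp L mST (hcomp L i i))"
    and eta_M: "snd (snd M) = vcomp L p eST"
begin

lemma types_M [simp]: "fst M \<in> Ar L" "src1 L (fst M) = A" "trg1 L (fst M) = A"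
  using M_hom by (auto simp: hom1_def)

lemma arrs_ip [simp]: "arr L A [fst M] i [fst S, fst T]" "arr L A [fst S, fst T] p [fst M]"
  using i_hom p_hom by (auto simp: arr_def)

lemma p_i: "sound L (A, [fst M], [(0, pc M S T p), (0, ic M S T i)], [])"
  and i_p: "sound L (A, [fst S, fst T], [(0, ic M S T i), (0, pc M S T p)], [(0, kc S T k)])"
  using vcomp_p_i vcomp_i_p by simp_all

lemma mu_M_ev: "fst (snd M) = ev L A [fst M, fst M]
    [(0, pc M S T p), (1, mc T), (0, mc S), (1, lc T S l), (2, ic M S T i), (0, ic M S T i)]"
proof -
  have "hcomp L i i = ev L A [fst M, fst M] [(2, ic M S T i), (0, ic M S T i)]"
    using hcomp_split(2)[of A "[fst M]" i "[fst S, fst T]" A "[fst M]" i "[fst S, fst T]"] by simp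
  moreover have "ev L A [fst M, fst M]
      ([(0, pc M S T p)] @ [(1, mc T), (0, mc S), (1, lc T S l)] @ [(2, ic M S T i), (0, ic M S T i)]) =
      vcomp L p (vcomp L mST (ev L A [fst M, fst M] [(2, ic M S T i), (0, ic M S T i)]))"
    unfolding mST_ev by (subst ev_append, simp, subst ev_append) simp_all
  ultimately show ?thesis
    by (simp add: mu_M)
qed

lemma eta_M_ev: "snd (snd M) = ev L A [] [(0, pc M S T p), (0, lc T S l), (0, ec T), (0, ec S)]"
  unfolding eta_M eST_ev by simp

lemma arrs_M [simp]:
  "arr L A [fst M, fst M] (fst (snd M)) [fst M]" "arr L A [] (snd (snd M)) [fst M]"
  by (rule arr_evI[OF mu_M_ev] arr_evI[OF eta_M_ev]; simp)+

lemma mM_def: "sound L (A, [fst M, fst M], [(0, mc M)],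
      [(0, pc M S T p), (1, mc T), (0, mc S), (1, lc T S l), (2, ic M S T i), (0, ic M S T i)])"
  and eM_def: "sound L (A, [], [(0, ec M)], [(0, pc M S T p), (0, lc T S l), (0, ec T), (0, ec S)])"
  by (rule sound_evI[OF mu_M_ev] sound_evI[OF eta_M_ev]; simp)+

lemma k_i:
  "sound L (A, [fst M],
      [(0, kc S T k), (0, ic M S T i)],
      [(0, ic M S T i)])"
  by (rule run_sound[OF rule_Cons[OF i_p rule_Cons[OF p_i rule_Nil]],
      where cs="[Rev 0 0 0, App 1 1 0]"])
    (simp_all add: run_simps)

lemma p_k:
  "sound L (A, [fst S, fst T],
      [(0, pc M S T p), (0, kc S T k)],
      [(0, pc M S T p)])"
  by (rule run_sound[OF rule_Cons[OF i_p rule_Cons[OF p_i rule_Nil]],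
      where cs="[Rev 0 1 0, App 1 0 0]"])
    (simp_all add: run_simps)

lemma i_mM:
  "sound L (A, [fst M, fst M],
      [(0, ic M S T i), (0, mc M)],
      [(1, mc T), (0, mc S), (1, lc T S l), (2, ic M S T i), (0, ic M S T i)])"
  by (rule run_sound[OF rule_Cons[OF mM_def rule_Cons[OF i_p rule_Cons[OF k_ms rule_Cons[OF k_mt
      rule_Cons[OF k_l rule_Nil]]]]],
      where cs="[App 0 1 0, App 1 0 0, Xch 1, App 2 0 0, App 3 1 1, Xch 0, App 4 2 1]"])
    (simp_all add: run_simps)

lemma i_eM:
  "sound L (A, [],
      [(0, ic M S T i), (0, ec M)],
      [(0, lc T S l), (0, ec T), (0, ec S)])"
  by (rule run_sound[OF rule_Cons[OF eM_def rule_Cons[OF i_p rule_Cons[OF k_l rule_Nil]]],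
      where cs="[App 0 1 0, App 1 0 0, App 2 0 0]"])
    (simp_all add: run_simps)

text \<open>The unit of the induced monad is the idempotent applied to two plain units.
  \<open>unitr_M\<close> needs them inserted in this order, \<open>unitl_M\<close> in that of
  \<open>eM_k2\<close>.\<close>

lemma eM_k:
  "sound L (A, [],
      [(0, lc T S l), (0, ec T), (0, ec S)],
      [(0, kc S T k), (1, ec T), (0, ec S)])"
  by (rule run_sound[OF rule_Cons[OF l_et_k rule_Nil],
      where cs="[App 0 0 0]"])
    (simp_all add: run_simps)

lemma eM_k2:
  "sound L (A, [],
      [(0, lc T S l), (0, ec T), (0, ec S)],
      [(0, kc S T k), (0, ec S), (0, ec T)])"
  by (rule run_sound[OF rule_Cons[OF l_es_k rule_Nil],
      where cs="[Xch 1, App 0 0 0]"])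
    (simp_all add: run_simps)

text \<open>Since \<open>i_mM\<close> removes the inner \<open>i.p\<close> without leaving an
  idempotent behind, the rest is the strict computation: \<open>l\<close> is distributed over both
  multiplications, which are then reassociated.\<close>

lemma assoc_M:
  "sound L (A, [fst M, fst M, fst M],
      [(0, mc M), (1, mc M)],
      [(0, mc M), (0, mc M)])"
  by (rule run_sound[OF rule_Cons[OF mM_def rule_Cons[OF i_mM rule_Cons[OF l_ms rule_Cons[OF assoc_s
      rule_Cons[OF assoc_t rule_Cons[OF l_mt rule_Nil]]]]]],
      where cs="[App 0 0 0, Xch 5, App 1 4 2, Xch 3, Xch 2, App 2 4 1, Xch 6, Xch 7, App 3 3 0, Xch 4, Xch 5,
      Xch 6, App 4 1 1, Xch 2, Rev 5 3 1, Xch 4, Rev 1 5 0, Rev 0 0 0]"])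
    (simp_all add: run_simps)

text \<open>\<open>eM_k\<close> turns the law in the unit into an idempotent, \<open>lk_t\<close>
  absorbs it, and the unit of \<open>T\<close> cancels. What remains is the defining formula of
  \<open>k\<close> between \<open>p\<close> and \<open>i\<close>.\<close>

lemma unitr_M:
  "sound L (A, [fst M],
      [(0, mc M), (1, ec M)],
      [])"
  by (rule run_sound[OF rule_Cons[OF mM_def rule_Cons[OF i_eM rule_Cons[OF eM_k rule_Cons[OF lk_t
      rule_Cons[OF unitr_t rule_Cons[OF k_def rule_Cons[OF k_i rule_Cons[OF p_i
      rule_Nil]]]]]]]],
      where cs="[App 0 0 0, Xch 5, App 1 4 2, App 2 4 2, Xch 1, App 3 2 1, Xch 3, Xch 1, Xch 2, App 4 1 1,
      Rev 5 1 0, App 6 1 0, App 7 0 0]"])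
    (simp_all add: run_simps)

lemma unitl_M:
  "sound L (A, [fst M],
      [(0, mc M), (0, ec M)],
      [])"
  by (rule run_sound[OF rule_Cons[OF mM_def rule_Cons[OF i_eM rule_Cons[OF eM_k2 rule_Cons[OF lk_s
      rule_Cons[OF unitl_s rule_Cons[OF k_def2 rule_Cons[OF k_i rule_Cons[OF p_i
      rule_Nil]]]]]]]],
      where cs="[App 0 0 0, App 1 5 0, App 2 5 0, Xch 6, Xch 4, App 3 2 0, Xch 5, Xch 4, Xch 3, App 4 2 0,
      Xch 3, Rev 5 1 0, App 6 1 0, App 7 0 0]"])
    (simp_all add: run_simps)

lemma is_monad_M: "is_monad L A M"
  using assoc_M unitr_M unitl_M arrs_M[unfolded arr_def] M_hom by (simp add: is_monad_def Let_def)

end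

text \<open>Here \<open>R\<close> plays the role of a monad \<open>s_j\<close> with \<open>j > k\<close>; in \<open>wdl_lt\<close> below it is an \<open>s_i\<close> with \<open>i < k - 1\<close>.\<close>

locale wdl_rt = wdl_pair L A S T l + sr: wdl_pair L A S R a + tr: wdl_pair L A T R b
  for L :: "('o,'a,'c) tcat" and A S T l R a b +
  assumes yang_baxter: "vcomp L (wr L l (fst R)) (vcomp L (wl L (fst T) a) (wr L b (fst S))) =
    vcomp L (wl L (fst S) b) (vcomp L (wr L a (fst T)) (wl L (fst R) l))"
begin

lemma yb: "sound L (A, [fst R, fst T, fst S],
      [(0, lc T S l), (1, lc R S a), (0, lc R T b)], [(1, lc R T b), (0, lc R S a), (1, lc T S l)])"
  using yang_baxter by simp

text \<open>Expand the inner \<open>k\<close>: its multiplication passes \<open>a\<close>, and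
  Yang-Baxter brings \<open>l\<close> to the end. The outer \<open>k\<close> crosses the
  multiplication and is absorbed by that \<open>l\<close>; the steps are then undone.\<close>

lemma k_ba:
  "sound L (A, [fst R, fst S, fst T],
      [(0, kc S T k), (1, lc R T b), (0, lc R S a), (1, kc S T k)],
      [(1, lc R T b), (0, lc R S a), (1, kc S T k)])"
  by (rule run_sound[OF rule_Cons[OF k_def rule_Cons[OF sr.l_ms rule_Cons[OF yb rule_Cons[OF k_ms
      rule_Cons[OF k_l rule_Nil]]]]],
      where cs="[App 0 3 1, App 1 2 0, Xch 4, Xch 5, Xch 1, Rev 2 2 1, Xch 4, App 3 0 0, App 4 1 1, Xch 3,
      App 2 1 1, Xch 0, Xch 4, Xch 3, Rev 1 1 0, Rev 0 2 1]"])
    (simp_all add: run_simps)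

lemma kbakk:
  "sound L (A, [fst R, fst S, fst T],
      [(0, kc S T k), (1, lc R T b), (0, lc R S a), (1, kc S T k), (1, kc S T k)],
      [(1, lc R T b), (0, lc R S a), (1, kc S T k)])"
  by (rule run_sound[OF rule_Cons[OF k_ba rule_Cons[OF k_k rule_Nil]],
      where cs="[App 0 0 0, App 1 2 1]"])
    (simp_all add: run_simps)

text \<open>Preparation for \<open>th_eM\<close>: the idempotent of \<open>b\<close> is traded for a
  unit and a multiplication of \<open>R\<close> on the outside of the Yang-Baxter composite.\<close>

lemma lab_kb:
  "sound L (A, [fst T, fst R, fst S],
      [(0, lc T S l), (1, lc R S a), (0, kc T R tr.k)],
      [(2, mc R), (1, lc R T b), (0, lc R S a), (0, ec R), (0, lc T S l), (1, lc R S a)])"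
  by (rule run_sound[OF rule_Cons[OF tr.k_def2 rule_Cons[OF sr.l_mt rule_Cons[OF yb rule_Nil]]],
      where cs="[App 0 2 0, App 1 1 1, Xch 0, Xch 3, App 2 1 0, Xch 4, Xch 3]"])
    (simp_all add: run_simps)

lemma th_er_aux:
  "sound L (A, [fst S, fst T],
      [(1, lc R T b), (0, lc R S a), (0, ec R), (0, kc S T k)],
      [(0, mc S), (1, lc T S l), (2, lc R S a), (1, lc R T b), (1, ec R), (2, ec S)])"
  by (rule run_sound[OF rule_Cons[OF sr.l_et_k rule_Cons[OF k_def rule_Cons[OF sr.k_ms rule_Cons[OF yb
      rule_Nil]]]],
      where cs="[App 0 1 0, App 1 3 0, Xch 2, App 2 1 0, Rev 0 2 1, Xch 3, Xch 4, Xch 0, Rev 3 1 1, Xch 4]"])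
    (simp_all add: run_simps)

text \<open>The composite law before it is conjugated by the splitting. Its absorption property has
  to be available first, because it is what identifies the retyped 2-cell of the closure with a
  conjugate; hence the separate locale.\<close>

abbreviation theta :: 'c where
  "theta \<equiv> vcomp L (wl L (fst S) b) (vcomp L (wr L a (fst T)) (wl L (fst R) k))"

lemma theta_absorb: "vcomp L (wr L k (fst R)) (vcomp L theta (wl L (fst R) k)) = theta"
proof -
  have "theta = ev L A [fst R, fst S, fst T] [(1, lc R T b), (0, lc R S a), (1, kc S T k)]"
    by simp
  moreover have "ev L A [fst R, fst S, fst T]
      ([(0, kc S T k)] @ [(1, lc R T b), (0, lc R S a), (1, kc S T k)] @ [(1, kc S T k)]) =
      vcomp L (wr L k (fst R)) (vcomp L theta (wl L (fst R) k))"
    by (subst ev_append, simp, subst ev_append) simp_all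
  ultimately show ?thesis
    using kbakk by simp
qed

end

section \<open>The composite law with \<open>R\<close> on the right of \<open>M\<close>\<close>

locale wdl_right = wdl_rt L A S T l R a b + wdl_split L A S T l M i p
  for L :: "('o,'a,'c) tcat" and A S T l R a b M i p +
  fixes th :: 'c
  assumes th: "th = vcomp L (wr L p (fst R)) (vcomp L theta (wl L (fst R) i))"
begin

lemma th_ev: "th = ev L A [fst R, fst M]
    [(0, pc M S T p), (1, lc R T b), (0, lc R S a), (1, kc S T k), (1, ic M S T i)]"
proof -
  have "ev L A [fst R, fst M]
      ([(0, pc M S T p)] @ [(1, lc R T b), (0, lc R S a), (1, kc S T k)] @ [(1, ic M S T i)]) = th"
    unfolding th by (subst ev_append, simp, subst ev_append) simp_all
  then show ?thesis by simp
qed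

lemma arr_th [simp]: "arr L A [fst R, fst M] th [fst M, fst R]"
  by (rule arr_evI[OF th_ev]) simp_all

lemma th_eq: "sound L (A, [fst R, fst M], [(0, lc R M th)],
      [(0, pc M S T p), (1, lc R T b), (0, lc R S a), (1, kc S T k), (1, ic M S T i)])"
  by (rule sound_evI[OF th_ev]; simp)

lemma th_def:
  "sound L (A, [fst R, fst M],
      [(0, lc R M th)],
      [(0, pc M S T p), (1, lc R T b), (0, lc R S a), (1, ic M S T i)])"
  by (rule run_sound[OF rule_Cons[OF th_eq rule_Cons[OF k_i rule_Nil]],
      where cs="[App 0 0 0, App 1 3 1]"])
    (simp_all add: run_simps)

text \<open>Conjugation leaves \<open>i.p\<close>, hence \<open>k\<close>, on the outside. Producing
  another \<open>k\<close> from \<open>i\<close> at the input makes \<open>k_ba\<close> applicable,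
  which removes the outer one.\<close>

lemma i_th:
  "sound L (A, [fst R, fst M],
      [(0, ic M S T i), (0, lc R M th)],
      [(1, lc R T b), (0, lc R S a), (1, ic M S T i)])"
  by (rule run_sound[OF rule_Cons[OF th_def rule_Cons[OF i_p rule_Cons[OF k_i rule_Cons[OF k_ba
      rule_Nil]]]],
      where cs="[App 0 1 0, App 1 0 0, Rev 2 3 1, App 3 0 0, App 2 2 1]"])
    (simp_all add: run_simps)

lemma th_mr:
  "sound L (A, [fst R, fst R, fst M],
      [(0, lc R M th), (0, mc R)],
      [(1, mc R), (0, lc R M th), (1, lc R M th)])"
  by (rule run_sound[OF rule_Cons[OF th_def rule_Cons[OF sr.l_mt rule_Cons[OF tr.l_mt rule_Cons[OF i_th
      rule_Nil]]]],
      where cs="[App 0 0 0, Xch 3, App 1 2 0, App 2 1 1, Xch 3, Xch 0, Rev 3 4 1, Rev 0 1 0]"])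
    (simp_all add: run_simps)

lemma th_mM:
  "sound L (A, [fst R, fst M, fst M],
      [(0, lc R M th), (1, mc M)],
      [(0, mc M), (1, lc R M th), (0, lc R M th)])"
  by (rule run_sound[OF rule_Cons[OF th_def rule_Cons[OF i_mM rule_Cons[OF tr.l_ms rule_Cons[OF sr.l_ms
      rule_Cons[OF yb rule_Cons[OF i_th rule_Cons[OF mM_def rule_Nil]]]]]]],
      where cs="[App 0 0 0, App 1 3 1, Xch 2, App 2 1 1, App 3 4 0, Xch 6, Xch 7, Xch 3, Rev 4 4 1, Xch 6,
      Rev 5 7 0, Xch 2, Xch 3, Rev 5 4 2, Xch 5, Rev 6 0 0]"])
    (simp_all add: run_simps)

text \<open>The unit of \<open>R\<close> has to travel rightwards across \<open>S\<close> and
  \<open>T\<close>. Expanding \<open>k\<close> supplies a unit of \<open>S\<close>, and expanding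
  the idempotent of \<open>b\<close>, which arises when \<open>T\<close> is crossed, supplies a unit
  of \<open>T\<close>. Joined by \<open>l\<close> through Yang-Baxter, they form the unit of
  \<open>M\<close> required on the right.\<close>

lemma th_er:
  "sound L (A, [fst M],
      [(0, lc R M th), (0, ec R)],
      [(0, mc M), (1, lc R M th), (2, ec M), (1, ec R)])"
  by (rule run_sound[OF rule_Cons[OF th_def rule_Cons[OF k_i rule_Cons[OF th_er_aux
      rule_Cons[OF tr.l_et_k rule_Cons[OF tr.k_def rule_Cons[OF l_mt rule_Cons[OF yb
      rule_Cons[OF i_eM rule_Cons[OF i_th rule_Cons[OF mM_def rule_Nil]]]]]]]]]],
      where cs="[App 0 0 0, Rev 1 3 1, Xch 4, Xch 3, App 2 1 0, Xch 5, Xch 4, App 3 5 1, App 4 5 1, Xch 4,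
      Xch 5, Xch 6, Xch 3, App 5 2 1, Xch 1, App 6 4 2, Xch 8, Xch 7, Xch 6, Xch 3, Xch 2, Rev 7 7 2,
      Xch 6, Xch 2, Xch 3, Rev 8 4 2, Xch 7, Xch 6, Xch 5, Rev 9 0 0, Xch 2]"])
    (simp_all add: run_simps)

text \<open>Moving the unit of \<open>T\<close> across \<open>R\<close> costs the idempotent of
  \<open>b\<close>, which \<open>lab_kb\<close> converts into a unit and a multiplication of
  \<open>R\<close>. Moving the unit of \<open>S\<close> costs that of \<open>a\<close>, which
  \<open>lk_t\<close> absorbs.\<close>

lemma th_eM:
  "sound L (A, [fst R],
      [(0, lc R M th), (1, ec M)],
      [(1, mc R), (0, lc R M th), (0, ec R), (0, ec M)])"
  by (rule run_sound[OF rule_Cons[OF th_def rule_Cons[OF i_eM rule_Cons[OF yb rule_Cons[OF tr.l_es_k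
      rule_Cons[OF lab_kb rule_Cons[OF sr.l_es_k rule_Cons[OF sr.lk_t rule_Nil]]]]]]],
      where cs="[App 0 0 0, App 1 3 1, Rev 2 1 0, App 3 3 0, Xch 4, App 4 1 0, Xch 4, Xch 5, Xch 6, Xch 7,
      Xch 0, Rev 2 2 0, Xch 4, Xch 5, App 5 4 2, Xch 5, Xch 6, Xch 0, Xch 1, App 6 2 1, Xch 1, Xch 0,
      App 2 2 0, Xch 6, Xch 5, Xch 4, Rev 1 5 0, Xch 4, Rev 0 1 0]"])
    (simp_all add: run_simps)

text \<open>The first three steps on the left are the idempotent of \<open>th\<close>. This lemma
  and the next four tell how it interacts, after \<open>p\<close>, with \<open>a\<close>,
  \<open>b\<close> and their idempotents, which is what the condition on 1-cells asks for.\<close>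

lemma K_p:
  "sound L (A, [fst S, fst T, fst R],
      [(0, mc M), (1, lc R M th), (2, ec M), (0, pc M S T p)],
      [(0, pc M S T p), (0, mc S), (1, lc T S l), (2, lc R S a), (1, kc T R tr.k), (3, ec S)])"
  by (rule run_sound[OF rule_Cons[OF mM_def rule_Cons[OF i_th rule_Cons[OF i_eM rule_Cons[OF i_p
      rule_Cons[OF yb rule_Cons[OF lk_s rule_Cons[OF l_mt rule_Cons[OF tr.k_def
      rule_Nil]]]]]]]],
      where cs="[App 0 0 0, Xch 5, Xch 6, App 1 4 2, Xch 3, Xch 2, App 2 6 3, App 3 9 0, Xch 2, Xch 3,
      Rev 4 4 2, Xch 8, Xch 7, Xch 6, Xch 5, Xch 4, App 5 2 0, Xch 1, Rev 6 2 1, Xch 3, Rev 7 4 1]"])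
    (simp_all add: run_simps)

lemma K_p_kb:
  "sound L (A, [fst S, fst T, fst R],
      [(0, mc M), (1, lc R M th), (2, ec M), (0, pc M S T p), (1, kc T R tr.k)],
      [(0, mc M), (1, lc R M th), (2, ec M), (0, pc M S T p)])"
  by (rule run_sound[OF rule_Cons[OF K_p rule_Cons[OF tr.k_k rule_Nil]],
      where cs="[App 0 0 0, Xch 4, App 1 5 1, Xch 4, Rev 0 0 0]"])
    (simp_all add: run_simps)

lemma K_p_b:
  "sound L (A, [fst S, fst R, fst T],
      [(0, mc M), (1, lc R M th), (2, ec M), (0, pc M S T p), (1, lc R T b)],
      [(0, pc M S T p), (1, lc R T b), (0, mc S), (1, lc R S a), (2, lc T S l), (3, ec S)])"
  by (rule run_sound[OF rule_Cons[OF K_p rule_Cons[OF tr.k_l rule_Cons[OF yb rule_Nil]]],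
      where cs="[App 0 0 0, Xch 4, App 1 5 1, Xch 4, App 2 2 1, Xch 1]"])
    (simp_all add: run_simps)

lemma K_p_b_ka:
  "sound L (A, [fst S, fst R, fst T],
      [(0, mc M), (1, lc R M th), (2, ec M), (0, pc M S T p), (1, lc R T b), (0, kc S R sr.k)],
      [(0, mc M), (1, lc R M th), (2, ec M), (0, pc M S T p), (1, lc R T b)])"
  by (rule run_sound[OF rule_Cons[OF K_p_b rule_Cons[OF sr.lk_s rule_Nil]],
      where cs="[App 0 0 0, Xch 5, Xch 4, App 1 2 0, Rev 0 0 0]"])
    (simp_all add: run_simps)

text \<open>Used backwards in \<open>xM_th\<close>, this creates the idempotent of \<open>th\<close>
  in front of the composite law.\<close>

lemma K_p_b_a:
  "sound L (A, [fst R, fst S, fst T],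
      [(0, mc M), (1, lc R M th), (2, ec M), (0, pc M S T p), (1, lc R T b), (0, lc R S a)],
      [(0, pc M S T p), (1, lc R T b), (0, lc R S a), (1, kc S T k)])"
  by (rule run_sound[OF rule_Cons[OF K_p_b rule_Cons[OF sr.l_ms rule_Cons[OF k_def rule_Nil]]],
      where cs="[App 0 0 0, Xch 5, Xch 4, Rev 1 2 0, Rev 2 3 1]"])
    (simp_all add: run_simps)

lemma wdl_th: "wdl L A R M th"
  using th_mr th_mM th_er th_eM is_monad_M sr.wdl arrs_M[unfolded arr_def hom2_def] arr_th[unfolded arr_def]
    sr.cells
  by (simp add: wdl_def Let_def wl_comp1 wr_comp1 tc_simps)

end

section \<open>The mirror image: a monad on the left of \<open>M\<close>\<close>

locale wdl_lt = wdl_pair L A S T l + rs: wdl_pair L A R S a + rt: wdl_pair L A R T b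
  for L :: "('o,'a,'c) tcat" and A S T l R a b +
  assumes yang_baxter: "vcomp L (wr L a (fst T)) (vcomp L (wl L (fst S) b) (wr L l (fst R))) =
    vcomp L (wl L (fst R) l) (vcomp L (wr L b (fst S)) (wl L (fst T) a))"
begin

lemma ybl: "sound L (A, [fst T, fst S, fst R],
      [(0, lc S R a), (1, lc T R b), (0, lc T S l)], [(1, lc T S l), (0, lc T R b), (1, lc S R a)])"
  using yang_baxter by simp

text \<open>As for \<open>k_ba\<close>, with the multiplication of \<open>T\<close> in place of that
  of \<open>S\<close>. The mirror images are computed anew; horizontal reversal would turn the
  formula defining \<open>lambar\<close> into that of \<open>k_def2\<close>.\<close>

lemma k_ab:
  "sound L (A, [fst S, fst T, fst R],
      [(1, kc S T k), (0, lc S R a), (1, lc T R b), (0, kc S T k)],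
      [(0, lc S R a), (1, lc T R b), (0, kc S T k)])"
  by (rule run_sound[OF rule_Cons[OF k_def2 rule_Cons[OF rt.l_mt rule_Cons[OF ybl rule_Cons[OF k_mt
      rule_Cons[OF k_l rule_Nil]]]]],
      where cs="[App 0 3 0, App 1 2 1, Xch 1, Xch 4, App 2 2 0, App 3 0 1, App 4 1 1, Rev 2 1 0, Xch 3, Xch 0,
      Rev 1 1 1, Rev 0 2 0]"])
    (simp_all add: run_simps)

lemma kabkk:
  "sound L (A, [fst S, fst T, fst R],
      [(1, kc S T k), (0, lc S R a), (1, lc T R b), (0, kc S T k), (0, kc S T k)],
      [(0, lc S R a), (1, lc T R b), (0, kc S T k)])"
  by (rule run_sound[OF rule_Cons[OF k_ab rule_Cons[OF k_k rule_Nil]],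
      where cs="[App 0 0 0, App 1 2 0]"])
    (simp_all add: run_simps)

lemma lab_ka:
  "sound L (A, [fst T, fst R, fst S],
      [(1, lc T S l), (0, lc T R b), (1, kc R S rs.k)],
      [(0, mc R), (1, lc S R a), (2, lc T R b), (3, ec R), (1, lc T S l), (0, lc T R b)])"
  by (rule run_sound[OF rule_Cons[OF rs.k_def rule_Cons[OF rt.l_ms rule_Cons[OF ybl rule_Nil]]],
      where cs="[App 0 2 1, App 1 1 0, Xch 3, Xch 4, Xch 0, Rev 2 1 1, Xch 3]"])
    (simp_all add: run_simps)

lemma ph_er_aux:
  "sound L (A, [fst S, fst T],
      [(0, lc S R a), (1, lc T R b), (2, ec R), (0, kc S T k)],
      [(2, mc T), (1, lc T S l), (0, lc T R b), (1, lc S R a), (2, ec R), (0, ec T)])"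
  by (rule run_sound[OF rule_Cons[OF rt.l_es_k rule_Cons[OF k_def2 rule_Cons[OF rt.k_mt
      rule_Cons[OF ybl rule_Nil]]]],
      where cs="[App 0 1 1, App 1 3 0, Xch 2, App 2 1 1, Xch 0, Rev 0 2 1, Xch 3, App 3 1 0]"])
    (simp_all add: run_simps)

abbreviation phi :: 'c where
  "phi \<equiv> vcomp L (wr L a (fst T)) (vcomp L (wl L (fst S) b) (wr L k (fst R)))"

lemma phi_absorb: "vcomp L (wl L (fst R) k) (vcomp L phi (wr L k (fst R))) = phi"
proof -
  have "phi = ev L A [fst S, fst T, fst R] [(0, lc S R a), (1, lc T R b), (0, kc S T k)]"
    by simp
  moreover have "ev L A [fst S, fst T, fst R]
      ([(1, kc S T k)] @ [(0, lc S R a), (1, lc T R b), (0, kc S T k)] @ [(0, kc S T k)]) =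
      vcomp L (wl L (fst R) k) (vcomp L phi (wr L k (fst R)))"
    by (subst ev_append, simp, subst ev_append) simp_all
  ultimately show ?thesis
    using kabkk by simp
qed

end

locale wdl_left = wdl_lt L A S T l R a b + wdl_split L A S T l M i p
  for L :: "('o,'a,'c) tcat" and A S T l R a b M i p +
  fixes ph :: 'c
  assumes ph: "ph = vcomp L (wl L (fst R) p) (vcomp L phi (wr L i (fst R)))"
begin

lemma ph_ev: "ph = ev L A [fst M, fst R]
    [(1, pc M S T p), (0, lc S R a), (1, lc T R b), (0, kc S T k), (0, ic M S T i)]"
proof -
  have "ev L A [fst M, fst R]
      ([(1, pc M S T p)] @ [(0, lc S R a), (1, lc T R b), (0, kc S T k)] @ [(0, ic M S T i)]) = ph"
    unfolding ph by (subst ev_append, simp, subst ev_append) simp_all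
  then show ?thesis by simp
qed

lemma arr_ph [simp]: "arr L A [fst M, fst R] ph [fst R, fst M]"
  by (rule arr_evI[OF ph_ev]) simp_all

lemma ph_eq: "sound L (A, [fst M, fst R], [(0, lc M R ph)],
      [(1, pc M S T p), (0, lc S R a), (1, lc T R b), (0, kc S T k), (0, ic M S T i)])"
  by (rule sound_evI[OF ph_ev]; simp)

lemma ph_def:
  "sound L (A, [fst M, fst R],
      [(0, lc M R ph)],
      [(1, pc M S T p), (0, lc S R a), (1, lc T R b), (0, ic M S T i)])"
  by (rule run_sound[OF rule_Cons[OF ph_eq rule_Cons[OF k_i rule_Nil]],
      where cs="[App 0 0 0, App 1 3 0]"])
    (simp_all add: run_simps)

lemma i_ph:
  "sound L (A, [fst M, fst R],
      [(1, ic M S T i), (0, lc M R ph)],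
      [(0, lc S R a), (1, lc T R b), (0, ic M S T i)])"
  by (rule run_sound[OF rule_Cons[OF ph_def rule_Cons[OF i_p rule_Cons[OF k_i rule_Cons[OF k_ab
      rule_Nil]]]],
      where cs="[App 0 1 0, App 1 0 1, Rev 2 3 0, App 3 0 0, App 2 2 0]"])
    (simp_all add: run_simps)

lemma ph_mr:
  "sound L (A, [fst M, fst R, fst R],
      [(0, lc M R ph), (1, mc R)],
      [(0, mc R), (1, lc M R ph), (0, lc M R ph)])"
  by (rule run_sound[OF rule_Cons[OF ph_def rule_Cons[OF rt.l_ms rule_Cons[OF rs.l_ms rule_Cons[OF i_ph
      rule_Nil]]]],
      where cs="[App 0 0 0, Xch 3, App 1 2 1, App 2 1 0, Xch 3, Rev 3 4 0, Xch 0, Rev 0 1 1]"])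
    (simp_all add: run_simps)

lemma ph_mM:
  "sound L (A, [fst M, fst M, fst R],
      [(0, lc M R ph), (0, mc M)],
      [(1, mc M), (0, lc M R ph), (1, lc M R ph)])"
  by (rule run_sound[OF rule_Cons[OF ph_def rule_Cons[OF i_mM rule_Cons[OF rs.l_mt rule_Cons[OF rt.l_mt
      rule_Cons[OF ybl rule_Cons[OF i_ph rule_Cons[OF mM_def rule_Nil]]]]]]],
      where cs="[App 0 0 0, App 1 3 0, Xch 3, Xch 2, App 2 1 0, App 3 4 2, Xch 3, Xch 2, Xch 1, Xch 6,
      App 4 4 1, Xch 8, Xch 7, Xch 6, Xch 3, Rev 5 4 0, Rev 5 6 1, Xch 5, Xch 4, Rev 6 0 1]"])
    (simp_all add: run_simps)

lemma ph_er:
  "sound L (A, [fst M],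
      [(0, lc M R ph), (1, ec R)],
      [(1, mc M), (0, lc M R ph), (0, ec M), (0, ec R)])"
  by (rule run_sound[OF rule_Cons[OF ph_def rule_Cons[OF k_i rule_Cons[OF ph_er_aux
      rule_Cons[OF rs.l_es_k rule_Cons[OF rs.k_def2 rule_Cons[OF l_ms
      rule_Cons[OF ybl rule_Cons[OF i_eM rule_Cons[OF i_ph rule_Cons[OF mM_def
      rule_Nil]]]]]]]]]],
      where cs="[App 0 0 0, Xch 3, Rev 1 4 0, App 2 1 0, Xch 6, App 3 4 1, Xch 5, Xch 6, App 4 4 1, Xch 6,
      Xch 7, Xch 5, Xch 6, Xch 3, Xch 4, App 5 2 1, Xch 4, Xch 7, Rev 6 5 0, Xch 9, Xch 8, Xch 7,
      Rev 7 8 0, Xch 7, Rev 8 5 0, Rev 9 0 1, Xch 2]"])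
    (simp_all add: run_simps)

lemma ph_eM:
  "sound L (A, [fst R],
      [(0, lc M R ph), (0, ec M)],
      [(0, mc R), (1, lc M R ph), (2, ec R), (1, ec M)])"
  by (rule run_sound[OF rule_Cons[OF ph_def rule_Cons[OF i_eM rule_Cons[OF ybl rule_Cons[OF rs.l_et_k
      rule_Cons[OF lab_ka rule_Cons[OF rt.l_et_k rule_Cons[OF rt.lk_s rule_Nil]]]]]]],
      where cs="[App 0 0 0, App 1 3 0, App 2 1 0, Xch 3, App 3 4 0, Xch 3, Xch 4, App 4 1 0, Xch 6, Xch 4,
      Xch 5, App 2 2 1, Xch 1, App 5 7 0, Xch 6, Xch 7, Xch 5, Xch 6, Xch 4, Xch 5, App 6 2 0, Xch 4,
      Xch 1, Rev 2 2 1, Xch 6, Xch 5, Xch 4, Rev 1 5 1, Xch 4, Xch 0, Rev 0 1 1]"])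
    (simp_all add: run_simps)

text \<open>The argument of \<open>k_def2\<close>, now for \<open>ph\<close>. The definition of its
  idempotent multiplies in \<open>R\<close>, whereas the comparison with the laws for
  \<open>S\<close> and \<open>T\<close> needs the multiplication of \<open>M\<close>.\<close>

lemma K_alt:
  "sound L (A, [fst R, fst M],
      [(0, mc R), (1, lc M R ph), (2, ec R)],
      [(1, mc M), (0, lc M R ph), (0, ec M)])"
  by (rule run_sound[OF rule_Cons[OF ph_er rule_Cons[OF ph_eM rule_Nil]],
      where cs="[App 0 1 1, Xch 3, Xch 0, Rev 1 1 0]"])
    (simp_all add: run_simps)

lemma K_pL:
  "sound L (A, [fst R, fst S, fst T],
      [(0, mc R), (1, lc M R ph), (2, ec R), (1, pc M S T p)],
      [(1, pc M S T p), (2, mc T), (1, lc T S l), (0, lc T R b), (1, kc R S rs.k), (0, ec T)])"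
  by (rule run_sound[OF rule_Cons[OF K_alt rule_Cons[OF mM_def rule_Cons[OF i_ph rule_Cons[OF i_eM
      rule_Cons[OF i_p rule_Cons[OF ybl rule_Cons[OF lk_t rule_Cons[OF l_ms
      rule_Cons[OF rs.k_def2 rule_Nil]]]]]]]]],
      where cs="[App 0 0 0, Xch 2, Xch 1, App 1 0 1, Xch 5, App 2 6 0, App 3 8 0, App 4 4 3, App 5 5 0, Xch 7,
      Xch 1, App 6 2 2, Xch 1, Rev 7 2 1, Xch 3, Xch 4, Rev 8 5 0, Xch 4]"])
    (simp_all add: run_simps)

lemma KL_ka:
  "sound L (A, [fst R, fst S, fst T],
      [(0, mc R), (1, lc M R ph), (2, ec R), (1, pc M S T p), (0, kc R S rs.k)],
      [(0, mc R), (1, lc M R ph), (2, ec R), (1, pc M S T p)])"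
  by (rule run_sound[OF rule_Cons[OF K_pL rule_Cons[OF rs.k_k rule_Nil]],
      where cs="[App 0 0 0, Xch 5, App 1 4 1, Rev 0 0 0]"])
    (simp_all add: run_simps)

lemma KL_a:
  "sound L (A, [fst S, fst R, fst T],
      [(0, mc R), (1, lc M R ph), (2, ec R), (1, pc M S T p), (0, lc S R a)],
      [(1, pc M S T p), (0, lc S R a), (2, mc T), (1, lc T R b), (0, lc T S l), (0, ec T)])"
  by (rule run_sound[OF rule_Cons[OF K_pL rule_Cons[OF rs.k_l rule_Cons[OF ybl rule_Nil]]],
      where cs="[App 0 0 0, Xch 4, App 1 5 0, Xch 4, Rev 2 2 0, Xch 1]"])
    (simp_all add: run_simps)

lemma KL_a_kb:
  "sound L (A, [fst S, fst R, fst T],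
      [(0, mc R), (1, lc M R ph), (2, ec R), (1, pc M S T p), (0, lc S R a), (1, kc R T rt.k)],
      [(0, mc R), (1, lc M R ph), (2, ec R), (1, pc M S T p), (0, lc S R a)])"
  by (rule run_sound[OF rule_Cons[OF KL_a rule_Cons[OF rt.lk_t rule_Nil]],
      where cs="[App 0 0 0, Xch 5, Xch 4, App 1 2 1, Rev 0 0 0]"])
    (simp_all add: run_simps)

lemma KL_a_b:
  "sound L (A, [fst S, fst T, fst R],
      [(0, mc R), (1, lc M R ph), (2, ec R), (1, pc M S T p), (0, lc S R a), (1, lc T R b)],
      [(1, pc M S T p), (0, lc S R a), (1, lc T R b), (0, kc S T k)])"
  by (rule run_sound[OF rule_Cons[OF KL_a rule_Cons[OF rt.l_mt rule_Cons[OF k_def2 rule_Nil]]],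
      where cs="[App 0 0 0, Xch 5, Xch 4, Rev 1 2 1, Rev 2 3 0]"])
    (simp_all add: run_simps)

lemma wdl_ph: "wdl L A M R ph"
  using ph_mr ph_mM ph_er ph_eM is_monad_M rs.wdl arrs_M[unfolded arr_def hom2_def] arr_ph[unfolded arr_def]
    rs.cells
  by (simp add: wdl_def Let_def wl_comp1 wr_comp1 tc_simps)

end

section \<open>Yang-Baxter relations with \<open>M\<close> as first, middle and last monad\<close>

locale yang_baxter_RR = two_cat L + R: wdl_right L A S T l R a b M i p th + Q: wdl_right L A S T l Q a2 b2 M i p th2
    + RQ: wdl_pair L A R Q g
  for L :: "('o,'a,'c) tcat" and A S T l R a b M i p th Q a2 b2 th2 g +
  assumes srq: "vcomp L (wr L a (fst Q)) (vcomp L (wl L (fst R) a2) (wr L g (fst S))) =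
      vcomp L (wl L (fst S) g) (vcomp L (wr L a2 (fst R)) (wl L (fst Q) a))"
    and trq: "vcomp L (wr L b (fst Q)) (vcomp L (wl L (fst R) b2) (wr L g (fst T))) =
      vcomp L (wl L (fst T) g) (vcomp L (wr L b2 (fst R)) (wl L (fst Q) b))"
begin

lemma yb_s: "sound L (A, [fst Q, fst R, fst S],
      [(0, lc R S a), (1, lc Q S a2), (0, lc Q R g)], [(1, lc Q R g), (0, lc Q S a2), (1, lc R S a)])"
  and yb_t: "sound L (A, [fst Q, fst R, fst T],
      [(0, lc R T b), (1, lc Q T b2), (0, lc Q R g)], [(1, lc Q R g), (0, lc Q T b2), (1, lc R T b)])"
  using srq trq by simp_all

text \<open>Unfolding one law leaves an \<open>i\<close> that \<open>i_th\<close> carries through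
  the other, so no idempotent appears. The relations for \<open>S\<close> and for \<open>T\<close>
  apply in turn, and the laws fold up again. The two further cases work alike.\<close>

lemma yb_M:
  "sound L (A, [fst Q, fst R, fst M],
      [(0, lc R M th), (1, lc Q M th2), (0, lc Q R g)],
      [(1, lc Q R g), (0, lc Q M th2), (1, lc R M th)])"
  by (rule run_sound[OF rule_Cons[OF R.th_def rule_Cons[OF Q.i_th rule_Cons[OF yb_s rule_Cons[OF yb_t
      rule_Cons[OF R.i_th rule_Cons[OF Q.th_def rule_Nil]]]]]],
      where cs="[App 0 0 0, App 1 3 1, Xch 2, Xch 5, App 2 3 0, App 3 1 1, Xch 0, Xch 3, Rev 4 4 1, Rev 5 1 0]"])
    (simp_all add: run_simps)

lemma yang_baxter_M: "vcomp L (wr L th (fst Q)) (vcomp L (wl L (fst R) th2) (wr L g (fst M))) =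
      vcomp L (wl L (fst M) g) (vcomp L (wr L th2 (fst R)) (wl L (fst Q) th))"
  using yb_M by simp

end

locale yang_baxter_LR = two_cat L + R: wdl_left L A S T l R a b M i p ph + Q: wdl_right L A S T l Q a2 b2 M i p th2
    + RQ: wdl_pair L A R Q g
  for L :: "('o,'a,'c) tcat" and A S T l R a b M i p ph Q a2 b2 th2 g +
  assumes rsq: "vcomp L (wr L a (fst Q)) (vcomp L (wl L (fst S) g) (wr L a2 (fst R))) =
      vcomp L (wl L (fst R) a2) (vcomp L (wr L g (fst S)) (wl L (fst Q) a))"
    and rtq: "vcomp L (wr L b (fst Q)) (vcomp L (wl L (fst T) g) (wr L b2 (fst R))) =
      vcomp L (wl L (fst R) b2) (vcomp L (wr L g (fst T)) (wl L (fst Q) b))"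
begin

lemma yb_s: "sound L (A, [fst Q, fst S, fst R],
      [(0, lc S R a), (1, lc Q R g), (0, lc Q S a2)], [(1, lc Q S a2), (0, lc Q R g), (1, lc S R a)])"
  and yb_t: "sound L (A, [fst Q, fst T, fst R],
      [(0, lc T R b), (1, lc Q R g), (0, lc Q T b2)], [(1, lc Q T b2), (0, lc Q R g), (1, lc T R b)])"
  using rsq rtq by simp_all

lemma yb_M:
  "sound L (A, [fst Q, fst M, fst R],
      [(0, lc M R ph), (1, lc Q R g), (0, lc Q M th2)],
      [(1, lc Q M th2), (0, lc Q R g), (1, lc M R ph)])"
  by (rule run_sound[OF rule_Cons[OF R.ph_def rule_Cons[OF Q.i_th rule_Cons[OF yb_t rule_Cons[OF yb_s
      rule_Cons[OF R.i_ph rule_Cons[OF Q.th_def rule_Nil]]]]]],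
      where cs="[App 0 0 0, Xch 3, App 1 4 0, App 2 2 1, Xch 4, Xch 1, App 3 2 0, Rev 4 4 1, Xch 3, Rev 5 0 1]"])
    (simp_all add: run_simps)

lemma yang_baxter_M: "vcomp L (wr L ph (fst Q)) (vcomp L (wl L (fst M) g) (wr L th2 (fst R))) =
      vcomp L (wl L (fst R) th2) (vcomp L (wr L g (fst M)) (wl L (fst Q) ph))"
  using yb_M by simp

end

locale yang_baxter_LL = two_cat L + R: wdl_left L A S T l R a b M i p ph + Q: wdl_left L A S T l Q a2 b2 M i p ph2
    + RQ: wdl_pair L A R Q g
  for L :: "('o,'a,'c) tcat" and A S T l R a b M i p ph Q a2 b2 ph2 g +
  assumes rqs: "vcomp L (wr L g (fst S)) (vcomp L (wl L (fst Q) a) (wr L a2 (fst R))) =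
      vcomp L (wl L (fst R) a2) (vcomp L (wr L a (fst Q)) (wl L (fst S) g))"
    and rqt: "vcomp L (wr L g (fst T)) (vcomp L (wl L (fst Q) b) (wr L b2 (fst R))) =
      vcomp L (wl L (fst R) b2) (vcomp L (wr L b (fst Q)) (wl L (fst T) g))"
begin

lemma yb_s: "sound L (A, [fst S, fst Q, fst R],
      [(0, lc Q R g), (1, lc S R a), (0, lc S Q a2)], [(1, lc S Q a2), (0, lc S R a), (1, lc Q R g)])"
  and yb_t: "sound L (A, [fst T, fst Q, fst R],
      [(0, lc Q R g), (1, lc T R b), (0, lc T Q b2)], [(1, lc T Q b2), (0, lc T R b), (1, lc Q R g)])"
  using rqs rqt by simp_all

lemma yb_M:
  "sound L (A, [fst M, fst Q, fst R],
      [(0, lc Q R g), (1, lc M R ph), (0, lc M Q ph2)],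
      [(1, lc M Q ph2), (0, lc M R ph), (1, lc Q R g)])"
  by (rule run_sound[OF rule_Cons[OF R.ph_def rule_Cons[OF Q.i_ph rule_Cons[OF yb_s rule_Cons[OF yb_t
      rule_Cons[OF R.i_ph rule_Cons[OF Q.ph_def rule_Nil]]]]]],
      where cs="[App 0 1 1, Xch 0, App 1 4 0, Xch 3, App 2 1 0, App 3 3 1, Xch 2, Xch 5, Rev 4 3 0, Rev 5 0 1]"])
    (simp_all add: run_simps)

lemma yang_baxter_M: "vcomp L (wr L g (fst M)) (vcomp L (wl L (fst Q) ph) (wr L ph2 (fst R))) =
      vcomp L (wl L (fst R) ph2) (vcomp L (wr L ph (fst Q)) (wl L (fst M) g))"
  using yb_M by simp

end

section \<open>1-cells and the composite monad\<close>

locale wdl_1cell0 = wdl_pair L A S T l + P: wdl_pair L A' S' T' l'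
  for L :: "('o,'a,'c) tcat" and A S T l A' S' T' l' +
  fixes v :: 'a and xs xt :: 'c
  assumes wdl1: "wdl1 L A T S l A' T' S' l' v xt xs"
begin

lemma types_v [simp]: "v \<in> Ar L" "src1 L v = A" "trg1 L v = A'"
  using wdl1 by (auto simp: wdl1_def mnd1_def Let_def hom1_def)

lemma arrs_x [simp]: "arr L A [fst S', v] xs [v, fst S]" "arr L A [fst T', v] xt [v, fst T]"
  using wdl1 by (auto simp: wdl1_def mnd1_def Let_def arr_def)

lemma xs_m: "sound L (A, [fst S', fst S', v],
      [(0, xc S' v S xs), (0, mc S')], [(1, mc S), (0, xc S' v S xs), (1, xc S' v S xs)])"
  and xs_e: "sound L (A, [v], [(0, xc S' v S xs), (0, ec S')], [(1, ec S)])"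
  and xt_m: "sound L (A, [fst T', fst T', v],
      [(0, xc T' v T xt), (0, mc T')], [(1, mc T), (0, xc T' v T xt), (1, xc T' v T xt)])"
  and xt_e: "sound L (A, [v], [(0, xc T' v T xt), (0, ec T')], [(1, ec T)])"
  and xts: "sound L (A, [fst T', fst S', v],
      [(1, lc T S l), (0, xc T' v T xt), (1, xc S' v S xs)],
      [(1, kc S T k), (0, xc S' v S xs), (1, xc T' v T xt), (0, lc T' S' l')])"
  using wdl1 by (auto simp: wdl1_def mnd1_def Let_def)

text \<open>The idempotent of the target law is expanded; its multiplication and unit pass the
  components of the 1-cell, and \<open>xts\<close> carries its law across. \<open>k_def\<close> then
  reassembles the pieces into the idempotent of the source law.\<close>

lemma k_xsxt_k:
  "sound L (A, [fst S', fst T', v],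
      [(1, kc S T k), (0, xc S' v S xs), (1, xc T' v T xt), (0, kc S' T' P.k)],
      [(1, kc S T k), (0, xc S' v S xs), (1, xc T' v T xt)])"
  by (rule run_sound[OF rule_Cons[OF P.k_def rule_Cons[OF xs_m rule_Cons[OF k_ms rule_Cons[OF xts
      rule_Cons[OF xs_e rule_Cons[OF k_def rule_Nil]]]]]],
      where cs="[App 0 3 0, Xch 2, App 1 1 0, App 2 0 1, Xch 1, Rev 3 2 1, Xch 1, App 4 4 2, Xch 3, Xch 2,
      Rev 5 0 1]"])
    (simp_all add: run_simps)

lemma kxkk:
  "sound L (A, [fst S', fst T', v],
      [(1, kc S T k), (1, kc S T k), (0, xc S' v S xs), (1, xc T' v T xt), (0, kc S' T' P.k)],
      [(1, kc S T k), (0, xc S' v S xs), (1, xc T' v T xt)])"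
  by (rule run_sound[OF rule_Cons[OF k_k rule_Cons[OF k_xsxt_k rule_Nil]],
      where cs="[App 0 0 1, App 1 0 0]"])
    (simp_all add: run_simps)

abbreviation xi :: 'c where
  "xi \<equiv> vcomp L (wl L v k) (vcomp L (wr L xs (fst T)) (wl L (fst S') xt))"

lemma xi_absorb: "vcomp L (wl L v k) (vcomp L xi (wr L P.k v)) = xi"
proof -
  have "xi = ev L A [fst S', fst T', v] [(1, kc S T k), (0, xc S' v S xs), (1, xc T' v T xt)]"
    by simp
  moreover have "ev L A [fst S', fst T', v]
      ([(1, kc S T k)] @ [(1, kc S T k), (0, xc S' v S xs), (1, xc T' v T xt)] @ [(0, kc S' T' P.k)]) =
      vcomp L (wl L v k) (vcomp L xi (wr L P.k v))"
    by (subst ev_append, simp, subst ev_append) simp_all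
  ultimately show ?thesis
    using kxkk by simp
qed

end

locale wdl_1cell = wdl_1cell0 L A S T l A' S' T' l' v xs xt + wdl_split L A S T l M i p
    + P: wdl_split L A' S' T' l' M' i' p'
  for L :: "('o,'a,'c) tcat" and A S T l M i p A' S' T' l' M' i' p' v xs xt +
  fixes xM :: 'c
  assumes xM: "xM = vcomp L (wl L v p) (vcomp L xi (wr L i' v))"
begin

lemma xM_ev: "xM = ev L A [fst M', v]
    [(1, pc M S T p), (1, kc S T k), (0, xc S' v S xs), (1, xc T' v T xt), (0, ic M' S' T' i')]"
proof -
  have "ev L A [fst M', v] ([(1, pc M S T p)] @
      [(1, kc S T k), (0, xc S' v S xs), (1, xc T' v T xt)] @ [(0, ic M' S' T' i')]) = xM"
    unfolding xM by (subst ev_append, simp, subst ev_append) simp_all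
  then show ?thesis by simp
qed

lemma arr_xM [simp]: "arr L A [fst M', v] xM [v, fst M]"
  by (rule arr_evI[OF xM_ev]) simp_all

lemma xM_eq: "sound L (A, [fst M', v], [(0, xc M' v M xM)],
      [(1, pc M S T p), (1, kc S T k), (0, xc S' v S xs), (1, xc T' v T xt), (0, ic M' S' T' i')])"
  by (rule sound_evI[OF xM_ev]; simp)

lemma xM_def:
  "sound L (A, [fst M', v],
      [(0, xc M' v M xM)],
      [(1, pc M S T p), (0, xc S' v S xs), (1, xc T' v T xt), (0, ic M' S' T' i')])"
  by (rule run_sound[OF rule_Cons[OF xM_eq rule_Cons[OF p_k rule_Nil]],
      where cs="[App 0 0 0, App 1 0 1]"])
    (simp_all add: run_simps)

lemma i_xM:
  "sound L (A, [fst M', v],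
      [(1, ic M S T i), (0, xc M' v M xM)],
      [(1, kc S T k), (0, xc S' v S xs), (1, xc T' v T xt), (0, ic M' S' T' i')])"
  by (rule run_sound[OF rule_Cons[OF xM_def rule_Cons[OF i_p rule_Nil]],
      where cs="[App 0 1 0, App 1 0 1]"])
    (simp_all add: run_simps)

lemma xM_p:
  "sound L (A, [fst S', fst T', v],
      [(0, xc M' v M xM), (0, pc M' S' T' p')],
      [(1, pc M S T p), (0, xc S' v S xs), (1, xc T' v T xt)])"
  by (rule run_sound[OF rule_Cons[OF xM_def rule_Cons[OF P.i_p rule_Cons[OF p_k rule_Cons[OF k_xsxt_k
      rule_Nil]]]],
      where cs="[App 0 0 0, App 1 3 0, Rev 2 0 1, App 3 1 0, App 2 0 1]"])
    (simp_all add: run_simps)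

text \<open>\<open>xts\<close> has an idempotent on one side only. It is first created from
  \<open>p\<close> and moved inwards by \<open>k_ms\<close> and \<open>k_mt\<close>; afterwards
  \<open>lk_t\<close> and \<open>lk_s\<close>, read backwards, supply the two idempotents needed to
  fold both copies of \<open>xM\<close> by \<open>i_xM\<close>.\<close>

lemma xM_m:
  "sound L (A, [fst M', fst M', v],
      [(0, xc M' v M xM), (0, mc M')],
      [(1, mc M), (0, xc M' v M xM), (1, xc M' v M xM)])"
  by (rule run_sound[OF rule_Cons[OF xM_def rule_Cons[OF P.i_mM rule_Cons[OF xs_m rule_Cons[OF xt_m
      rule_Cons[OF p_k rule_Cons[OF k_ms rule_Cons[OF k_mt rule_Cons[OF xts
      rule_Cons[OF lk_t rule_Cons[OF lk_s rule_Cons[OF i_xM rule_Cons[OF mM_def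
      rule_Nil]]]]]]]]]]]],
      where cs="[App 0 0 0, App 1 3 0, Xch 3, Xch 2, App 2 1 0, App 3 4 2, Xch 3, Xch 2, Xch 1, Rev 4 0 1,
      Xch 2, App 5 1 1, App 6 2 2, Xch 1, Xch 7, Xch 3, Rev 7 4 1, Xch 3, Xch 1, Rev 8 2 2, Xch 1,
      Rev 9 2 1, Xch 4, Xch 10, Xch 9, Xch 8, Rev 10 5 0, Xch 4, Xch 5, Rev 10 6 1, Xch 5, Xch 4,
      Rev 11 0 1]"])
    (simp_all add: run_simps)

lemma xM_e:
  "sound L (A, [v],
      [(0, xc M' v M xM), (0, ec M')],
      [(1, ec M)])"
  by (rule run_sound[OF rule_Cons[OF xM_def rule_Cons[OF P.i_eM rule_Cons[OF p_k rule_Cons[OF xts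
      rule_Cons[OF xs_e rule_Cons[OF xt_e rule_Cons[OF eM_def rule_Nil]]]]]]],
      where cs="[App 0 0 0, App 1 3 0, Rev 2 0 1, Rev 3 1 0, Xch 3, App 4 4 0, Xch 3, Xch 2, App 5 3 0, Xch 2,
      Rev 6 0 1]"])
    (simp_all add: run_simps)

lemma mnd1_xM: "mnd1 L A M A' M' v xM"
  using xM_m xM_e arr_xM[unfolded arr_def] by (simp add: mnd1_def Let_def hom1_def)

end

locale wdl_1cell_right = wdl_1cell L A S T l M i p A' S' T' l' M' i' p' v xs xt xM
    + wdl_right L A S T l R a b M i p th + P: wdl_right L A' S' T' l' R' a' b' M' i' p' th'
  for L :: "('o,'a,'c) tcat" and A S T l M i p A' S' T' l' M' i' p' v xs xt xM R a b th R' a' b' th' +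
  fixes xr :: 'c
  assumes wdl1_rs: "wdl1 L A R S a A' R' S' a' v xr xs"
    and wdl1_rt: "wdl1 L A R T b A' R' T' b' v xr xt"
begin

lemma arr_xr [simp]: "arr L A [fst R', v] xr [v, fst R]"
  using wdl1_rs by (auto simp: wdl1_def mnd1_def Let_def arr_def)

lemma xrs: "sound L (A, [fst R', fst S', v],
      [(1, lc R S a), (0, xc R' v R xr), (1, xc S' v S xs)],
      [(1, kc S R sr.k), (0, xc S' v S xs), (1, xc R' v R xr), (0, lc R' S' a')])"
  and xrt: "sound L (A, [fst R', fst T', v],
      [(1, lc R T b), (0, xc R' v R xr), (1, xc T' v T xt)],
      [(1, kc T R tr.k), (0, xc T' v T xt), (1, xc R' v R xr), (0, lc R' T' b')])"
  using wdl1_rs wdl1_rt by (simp_all add: wdl1_def)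

text \<open>\<open>K_p_b_a\<close> creates the idempotent of \<open>th\<close>. The conditions for
  \<open>R\<close> with \<open>S\<close> and for \<open>R\<close> with \<open>T\<close> then each
  leave the idempotent of one given law, and \<open>K_p_b_ka\<close> and \<open>K_p_kb\<close>
  absorb these into it.\<close>

lemma xM_th:
  "sound L (A, [fst R', fst M', v],
      [(1, lc R M th), (0, xc R' v R xr), (1, xc M' v M xM)],
      [(1, mc M), (2, lc R M th), (3, ec M), (0, xc M' v M xM), (1, xc R' v R xr), (0, lc R' M' th')])"
  by (rule run_sound[OF rule_Cons[OF th_def rule_Cons[OF i_xM rule_Cons[OF K_p_b_a rule_Cons[OF xrs
      rule_Cons[OF K_p_b_ka rule_Cons[OF xrt rule_Cons[OF K_p_kb rule_Cons[OF xM_p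
      rule_Cons[OF P.th_def rule_Nil]]]]]]]]],
      where cs="[App 0 0 1, Xch 3, App 1 4 1, Xch 3, Rev 2 0 1, App 3 5 0, Xch 8, App 4 0 1, Xch 4, App 5 5 1,
      Xch 4, App 6 0 1, Rev 7 3 0, Xch 4, Rev 8 5 0]"])
    (simp_all add: run_simps)

lemma wdl1_xM: "wdl1 L A R M th A' R' M' th' v xr xM"
proof -
  interpret RM: wdl_pair L A M R th
    by unfold_locales (rule wdl_th)
  \<comment> \<open>The condition on 1-cells contains \<open>lambar\<close> as one whiskered 2-cell;
    spelled out as three steps it matches \<open>xM_th\<close>.\<close>
  have "wl L v RM.k = ev L A [v, fst M, fst R] [(1, mc M), (2, lc R M th), (3, ec M)]"
    using shift_context[of A "[fst M, fst R]" "[(0, mc M), (1, lc R M th), (2, ec M)]" A "[]" "[v]"]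
    unfolding RM.k_ev by (simp add: shift_def)
  moreover have "ev L A [fst R', fst M', v] ([(1, mc M), (2, lc R M th), (3, ec M)] @
        [(0, xc M' v M xM), (1, xc R' v R xr), (0, lc R' M' th')]) =
      vcomp L (ev L A [v, fst M, fst R] [(1, mc M), (2, lc R M th), (3, ec M)])
        (ev L A [fst R', fst M', v] [(0, xc M' v M xM), (1, xc R' v R xr), (0, lc R' M' th')])"
    by (subst ev_append) simp_all
  ultimately show ?thesis
    using xM_th mnd1_xM wdl1_rs by (simp add: wdl1_def)
qed

end

locale wdl_1cell_left = wdl_1cell L A S T l M i p A' S' T' l' M' i' p' v xs xt xM
    + wdl_left L A S T l R a b M i p ph + P: wdl_left L A' S' T' l' R' a' b' M' i' p' ph'
  for L :: "('o,'a,'c) tcat" and A S T l M i p A' S' T' l' M' i' p' v xs xt xM R a b ph R' a' b' ph' +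
  fixes xr :: 'c
  assumes wdl1_sr: "wdl1 L A S R a A' S' R' a' v xs xr"
    and wdl1_tr: "wdl1 L A T R b A' T' R' b' v xt xr"
begin

lemma arr_xr [simp]: "arr L A [fst R', v] xr [v, fst R]"
  using wdl1_sr by (auto simp: wdl1_def mnd1_def Let_def arr_def)

lemma xsr: "sound L (A, [fst S', fst R', v],
      [(1, lc S R a), (0, xc S' v S xs), (1, xc R' v R xr)],
      [(1, kc R S rs.k), (0, xc R' v R xr), (1, xc S' v S xs), (0, lc S' R' a')])"
  and xtr: "sound L (A, [fst T', fst R', v],
      [(1, lc T R b), (0, xc T' v T xt), (1, xc R' v R xr)],
      [(1, kc R T rt.k), (0, xc R' v R xr), (1, xc T' v T xt), (0, lc T' R' b')])"
  using wdl1_sr wdl1_tr by (simp_all add: wdl1_def)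

lemma xM_ph:
  "sound L (A, [fst M', fst R', v],
      [(1, lc M R ph), (0, xc M' v M xM), (1, xc R' v R xr)],
      [(1, mc R), (2, lc M R ph), (3, ec R), (0, xc R' v R xr), (1, xc M' v M xM), (0, lc M' R' ph')])"
  by (rule run_sound[OF rule_Cons[OF ph_def rule_Cons[OF i_xM rule_Cons[OF KL_a_b rule_Cons[OF xtr
      rule_Cons[OF KL_a_kb rule_Cons[OF xsr rule_Cons[OF KL_ka rule_Cons[OF xM_p
      rule_Cons[OF P.ph_def rule_Nil]]]]]]]]],
      where cs="[App 0 0 1, App 1 3 0, Xch 6, Rev 2 0 1, Xch 5, App 3 6 1, Xch 5, App 4 0 1, App 5 4 0, Xch 7,
      App 6 0 1, Xch 3, Rev 7 4 1, Rev 8 5 0]"])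
    (simp_all add: run_simps)

lemma wdl1_xM: "wdl1 L A M R ph A' M' R' ph' v xM xr"
proof -
  interpret MR: wdl_pair L A R M ph
    by unfold_locales (rule wdl_ph)
  have "wl L v MR.k = ev L A [v, fst R, fst M] [(1, mc R), (2, lc M R ph), (3, ec R)]"
    using shift_context[of A "[fst R, fst M]" "[(0, mc R), (1, lc M R ph), (2, ec R)]" A "[]" "[v]"]
    unfolding MR.k_ev by (simp add: shift_def)
  moreover have "ev L A [fst M', fst R', v] ([(1, mc R), (2, lc M R ph), (3, ec R)] @
        [(0, xc R' v R xr), (1, xc M' v M xM), (0, lc M' R' ph')]) =
      vcomp L (ev L A [v, fst R, fst M] [(1, mc R), (2, lc M R ph), (3, ec R)])
        (ev L A [fst M', fst R', v] [(0, xc R' v R xr), (1, xc M' v M xM), (0, lc M' R' ph')])"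
    by (subst ev_append) simp_all
  ultimately show ?thesis
    using xM_ph mnd1_xM wdl1_sr by (simp add: wdl1_def)
qed

end

section \<open>2-cells, and composition of 1-cells\<close>

locale wdl_2cell = two_cat L + V: wdl_1cell L A S T l M i p A' S' T' l' M' i' p' v xs xt xM
    + U: wdl_1cell L A S T l M i p A' S' T' l' M' i' p' u xs2 xt2 xM2
  for L :: "('o,'a,'c) tcat" and A S T l M i p A' S' T' l' M' i' p' v xs xt xM u xs2 xt2 xM2 +
  fixes w :: 'c
  assumes mnd2_s: "mnd2 L S S' v xs u xs2 w" and mnd2_t: "mnd2 L T T' v xt u xt2 w"
begin

lemma arr_w [simp]: "arr L A [v] w [u]"
  using mnd2_s by (simp add: mnd2_def arr_def)

lemma w_s: "sound L (A, [fst S', v], [(0, xc S' u S xs2), (1, [v], w, [u])], [(0, [v], w, [u]), (0, xc S' v S xs)])"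
  and w_t: "sound L (A, [fst T', v], [(0, xc T' u T xt2), (1, [v], w, [u])], [(0, [v], w, [u]), (0, xc T' v T xt)])"
  using mnd2_s mnd2_t by (simp_all add: mnd2_def)

lemma w_M:
  "sound L (A, [fst M', v],
      [(0, xc M' u M xM2), (1, ([v], w, [u]))],
      [(0, ([v], w, [u])), (0, xc M' v M xM)])"
  by (rule run_sound[OF rule_Cons[OF U.xM_def rule_Cons[OF w_t rule_Cons[OF w_s rule_Cons[OF V.xM_def
      rule_Nil]]]],
      where cs="[App 0 0 0, Xch 3, App 1 2 1, App 2 1 0, Xch 0, Rev 3 1 0]"])
    (simp_all add: run_simps)

lemma mnd2_M: "mnd2 L M M' v xM u xM2 w"
  using w_M mnd2_s by (simp add: mnd2_def)

end

locale wdl_1cell_comp = two_cat L + F: wdl_1cell L A S T l M i p A' S' T' l' M' i' p' v xs xt xM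
    + G: wdl_1cell L A' S' T' l' M' i' p' A'' S'' T'' l'' M'' i'' p'' v' xs' xt' xM'
  for L :: "('o,'a,'c) tcat" and A S T l M i p A' S' T' l' M' i' p' v xs xt xM
    A'' S'' T'' l'' M'' i'' p'' v' xs' xt' xM'
begin

text \<open>The projection at the end of the inner component is consumed by \<open>F.xM_p\<close>,
  so the middle splitting disappears.\<close>

lemma xM_comp:
  "sound L (A, [fst M'', v', v],
      [(1, xc M' v M xM), (0, xc M'' v' M' xM')],
      [(2, pc M S T p), (1, xc S' v S xs), (0, xc S'' v' S' xs'), (2, xc T' v T xt), (1, xc T'' v' T' xt'), (0, ic M'' S'' T'' i'')])"
  by (rule run_sound[OF rule_Cons[OF G.xM_def rule_Cons[OF F.xM_p rule_Nil]],
      where cs="[App 0 1 0, App 1 0 1, Xch 2]"])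
    (simp_all add: run_simps)

text \<open>The idempotent at the source is absorbed by the inner 1-cell once the idempotent of the
  middle law is available; \<open>F.k_xsxt_k\<close> inserts that one and removes it again.\<close>

lemma kk_xx_k:
  "sound L (A, [fst S'', fst T'', v', v],
      [(2, kc S T F.k), (2, kc S T F.k), (1, xc S' v S xs), (0, xc S'' v' S' xs'), (2, xc T' v T xt), (1, xc T'' v' T' xt'), (0, kc S'' T'' G.P.k)],
      [(2, kc S T F.k), (1, xc S' v S xs), (0, xc S'' v' S' xs'), (2, xc T' v T xt), (1, xc T'' v' T' xt')])"
  by (rule run_sound[OF rule_Cons[OF F.k_k rule_Cons[OF F.k_xsxt_k rule_Cons[OF G.k_xsxt_k rule_Nil]]],
      where cs="[Xch 3, App 0 0 2, Rev 1 0 1, App 2 3 0, App 1 0 1, Xch 2]"])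
    (simp_all add: run_simps)

lemma p_xx_i:
  "sound L (A, [fst M'', v', v],
      [(2, pc M S T p), (2, kc S T F.k), (1, xc S' v S xs), (0, xc S'' v' S' xs'), (2, xc T' v T xt), (1, xc T'' v' T' xt'), (0, ic M'' S'' T'' i'')],
      [(1, xc M' v M xM), (0, xc M'' v' M' xM')])"
  by (rule run_sound[OF rule_Cons[OF F.p_k rule_Cons[OF xM_comp rule_Nil]],
      where cs="[Xch 3, App 0 0 2, Xch 2, Rev 1 0 0]"])
    (simp_all add: run_simps)

text \<open>The formula of \<open>Ck1\<close> for the composite 1-cell, before retyping.\<close>

abbreviation xx :: 'c where
  "xx \<equiv> vcomp L (wl L (comp1 L v' v) F.k) (vcomp L (wr L (vcomp L (wl L v' xs) (wr L xs' v)) (fst T))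
     (wl L (fst S'') (vcomp L (wl L v' xt) (wr L xt' v))))"

lemma xx_ev: "xx = ev L A [fst S'', fst T'', v', v]
    [(2, kc S T F.k), (1, xc S' v S xs), (0, xc S'' v' S' xs'), (2, xc T' v T xt), (1, xc T'' v' T' xt')]"
proof -
  have s: "wr L (vcomp L (wl L v' xs) (wr L xs' v)) (fst T) =
      ev L A [fst S'', v', v, fst T] [(1, xc S' v S xs), (0, xc S'' v' S' xs')]"
    using shift_context[of A "[fst S'', v', v]" "[(1, xc S' v S xs), (0, xc S'' v' S' xs')]" A "[fst T]" "[]"]
    by (simp add: shift_def)
  have t: "wl L (fst S'') (vcomp L (wl L v' xt) (wr L xt' v)) =
      ev L A [fst S'', fst T'', v', v] [(2, xc T' v T xt), (1, xc T'' v' T' xt')]"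
    using shift_context[of A "[fst T'', v', v]" "[(1, xc T' v T xt), (0, xc T'' v' T' xt')]" A "[]" "[fst S'']"]
    by (simp add: shift_def)
  have "wl L (comp1 L v' v) F.k = ev L A [v', v, fst S, fst T] [(2, kc S T F.k)]"
    using F.arr_k[unfolded arr_def hom2_def] by (simp add: wl_comp1 tc_simps)
  then have "xx = vcomp L (ev L A [v', v, fst S, fst T] [(2, kc S T F.k)])
      (vcomp L (ev L A [fst S'', v', v, fst T] [(1, xc S' v S xs), (0, xc S'' v' S' xs')])
        (ev L A [fst S'', fst T'', v', v] [(2, xc T' v T xt), (1, xc T'' v' T' xt')]))"
    by (simp only: s t)
  also have "\<dots> = ev L A [fst S'', fst T'', v', v] ([(2, kc S T F.k)] @
      [(1, xc S' v S xs), (0, xc S'' v' S' xs')] @ [(2, xc T' v T xt), (1, xc T'' v' T' xt')])"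
    by (subst ev_append, simp, subst ev_append) simp_all
  finally show ?thesis by simp
qed

lemma xx_absorb: "vcomp L (wl L (comp1 L v' v) F.k) (vcomp L xx (wr L G.P.k (comp1 L v' v))) = xx"
proof -
  have "wl L (comp1 L v' v) F.k = wl L v' (wl L v F.k)"
    "wr L G.P.k (comp1 L v' v) = wr L (wr L G.P.k v') v"
    using F.arr_k[unfolded arr_def hom2_def] G.P.arr_k[unfolded arr_def hom2_def]
    by (simp_all add: wl_comp1 wr_comp1 tc_simps)
  moreover have "ev L A [fst S'', fst T'', v', v] ([(2, kc S T F.k)] @ [(2, kc S T F.k), (1, xc S' v S xs),
        (0, xc S'' v' S' xs'), (2, xc T' v T xt), (1, xc T'' v' T' xt')] @ [(0, kc S'' T'' G.P.k)]) =
      vcomp L (wl L v' (wl L v F.k)) (vcomp L xx (wr L (wr L G.P.k v') v))"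
    unfolding xx_ev by (subst ev_append, simp, subst ev_append) simp_all
  ultimately show ?thesis
    using kk_xx_k xx_ev by simp
qed

lemma xM_xx: "vcomp L (wl L (comp1 L v' v) p) (vcomp L xx (wr L i'' (comp1 L v' v))) =
    vcomp L (wl L v' xM) (wr L xM' v)"
proof -
  have "wl L (comp1 L v' v) p = wl L v' (wl L v p)"
    "wr L i'' (comp1 L v' v) = wr L (wr L i'' v') v"
    using F.arrs_ip[unfolded arr_def hom2_def] G.P.arrs_ip[unfolded arr_def hom2_def]
    by (simp_all add: wl_comp1 wr_comp1 tc_simps)
  moreover have "ev L A [fst M'', v', v] ([(2, pc M S T p)] @ [(2, kc S T F.k), (1, xc S' v S xs),
        (0, xc S'' v' S' xs'), (2, xc T' v T xt), (1, xc T'' v' T' xt')] @ [(0, ic M'' S'' T'' i'')]) =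
      vcomp L (wl L v' (wl L v p)) (vcomp L xx (wr L (wr L i'' v') v))"
    unfolding xx_ev by (subst ev_append, simp, subst ev_append) simp_all
  ultimately show ?thesis
    using p_xx_i by simp
qed

end

section \<open>The local idempotent closure\<close>

lemma lic_sel [simp]:
  "Ob (lic K) = Ob K" "Ar (lic K) = lic_Ar K"
  "src1 (lic K) u = src1 K (fst u)" "trg1 (lic K) u = trg1 K (fst u)"
  "dom2 (lic K) x = fst x" "cod2 (lic K) x = snd (snd x)"
  "id1 (lic K) A = (id1 K A, id2 K (id1 K A))"
  by (simp_all add: lic_def)

lemma lic_ops:
  "comp1 (lic K) u w = (comp1 K (fst u) (fst w), hcomp K (snd u) (snd w))"
  "id2 (lic K) u = (u, snd u, u)"
  "vcomp (lic K) x y = (fst y, vcomp K (und x) (und y), snd (snd x))"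
  "hcomp (lic K) x y = (comp1 (lic K) (fst x) (fst y), hcomp K (und x) (und y), comp1 (lic K) (snd (snd x)) (snd (snd y)))"
  by (simp_all add: lic_def und_def)

lemma lic_Cl: "x \<in> Cl (lic K) \<longleftrightarrow> fst x \<in> lic_Ar K \<and> snd (snd x) \<in> lic_Ar K \<and> und x \<in> Cl K \<and>
    dom2 K (und x) = fst (fst x) \<and> cod2 K (und x) = fst (snd (snd x)) \<and>
    vcomp K (snd (snd (snd x))) (und x) = und x \<and> vcomp K (und x) (snd (fst x)) = und x"
  by (cases x) (auto simp: lic_def und_def)

lemma lic_Ar: "u \<in> lic_Ar K \<longleftrightarrow> fst u \<in> Ar K \<and> snd u \<in> Cl K \<and> dom2 K (snd u) = fst u \<and>
    cod2 K (snd u) = fst u \<and> vcomp K (snd u) (snd u) = snd u"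
  by (cases u) (auto simp: lic_Ar_def)

lemma und_ops [simp]:
  "und (vcomp (lic K) x y) = vcomp K (und x) (und y)"
  "und (hcomp (lic K) x y) = hcomp K (und x) (und y)"
  "und (id2 (lic K) u) = snd u"
  "und (rt a x b) = und x"
  "fst (rt a x b) = a" "snd (snd (rt a x b)) = b"
  by (simp_all add: lic_ops und_def rt_def)

lemma und_triple [simp]: "und (a, w, b) = w"
  by (simp add: und_def)

text \<open>Equations are inherited through underlying cells. What has to be proved is closure: by
  interchange, horizontal composites of idempotents are idempotent and horizontal composites of
  2-cells absorb the composite idempotents.\<close>

lemma two_category_lic:
  fixes K :: "('o,'a,'c) tcat"
  assumes "two_category K"
  shows "two_category (lic K)"
proof -
  interpret K: two_cat K by unfold_locales (rule assms)
  have eq: "x = y \<longleftrightarrow> fst x = fst y \<and> und x = und y \<and> snd (snd x) = snd (snd y)"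
    for x y :: "('a \<times> 'c) \<times> 'c \<times> ('a \<times> 'c)"
    by (cases x; cases y) (auto simp: und_def)
  have ar: "comp1 (lic K) u w \<in> lic_Ar K"
    if "u \<in> lic_Ar K" "w \<in> lic_Ar K" "trg1 K (fst w) = src1 K (fst u)" for u w
    using that by (auto simp: lic_Ar lic_ops K.tc_simps simp flip: K.interchange)
  have i1: "id1 (lic K) A \<in> lic_Ar K" if "A \<in> Ob K" for A
    using that by (simp add: lic_Ar K.tc_simps)
  have t: "src1 K (fst (snd (snd x))) = src1 K (fst (fst x))" "trg1 K (fst (snd (snd x))) = trg1 K (fst (fst x))"
    if "x \<in> Cl (lic K)" for x
    using that K.src1_cod2[of "und x"] K.trg1_cod2[of "und x"] by (auto simp: lic_Cl)
  have i2: "id2 (lic K) u \<in> Cl (lic K)" if "u \<in> lic_Ar K" for u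
    using that by (simp add: lic_Cl lic_ops lic_Ar)
  have v: "vcomp (lic K) x y \<in> Cl (lic K)"
    if "x \<in> Cl (lic K)" "y \<in> Cl (lic K)" "fst x = snd (snd y)" for x y
  proof -
    have "vcomp K (snd (snd (snd x))) (vcomp K (und x) (und y)) = vcomp K (und x) (und y)"
      using that by (simp add: lic_Cl lic_Ar flip: K.vcomp_assoc)
    moreover have "vcomp K (vcomp K (und x) (und y)) (snd (fst y)) = vcomp K (und x) (und y)"
      using that by (simp add: lic_Cl lic_Ar K.vcomp_assoc)
    ultimately show ?thesis
      using that by (simp add: lic_Cl lic_ops K.tc_simps)
  qed
  have h: "hcomp (lic K) x y \<in> Cl (lic K)"
    if "x \<in> Cl (lic K)" "y \<in> Cl (lic K)" "trg1 K (fst (fst y)) = src1 K (fst (fst x))" for x y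
    using that t[OF that(1)] t[OF that(2)] ar
    by (simp add: lic_Cl lic_ops lic_Ar K.tc_simps flip: K.interchange)
  have ic: "hcomp (lic K) (vcomp (lic K) \<alpha> \<beta>) (vcomp (lic K) \<gamma> \<delta>) =
      vcomp (lic K) (hcomp (lic K) \<alpha> \<gamma>) (hcomp (lic K) \<beta> \<delta>)"
    if "\<alpha> \<in> Cl (lic K)" "\<beta> \<in> Cl (lic K)" "\<gamma> \<in> Cl (lic K)" "\<delta> \<in> Cl (lic K)"
      "fst \<alpha> = snd (snd \<beta>)" "fst \<gamma> = snd (snd \<delta>)" "trg1 K (fst (fst \<gamma>)) = src1 K (fst (fst \<alpha>))"
    for \<alpha> \<beta> \<gamma> \<delta>
    using that by (auto simp: eq lic_Cl lic_ops intro!: K.interchange)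
  have hu: "hcomp (lic K) (id2 (lic K) (id1 (lic K) (trg1 K (fst (fst x))))) x = x"
    "hcomp (lic K) x (id2 (lic K) (id1 (lic K) (src1 K (fst (fst x))))) = x" if "x \<in> Cl (lic K)" for x
    using that t[OF that] by (simp_all add: eq prod_eq_iff lic_Cl lic_ops lic_Ar K.tc_simps)
  have ha: "hcomp (lic K) (hcomp (lic K) x y) z = hcomp (lic K) x (hcomp (lic K) y z)"
    if "x \<in> Cl (lic K)" "y \<in> Cl (lic K)" "z \<in> Cl (lic K)"
      "trg1 K (fst (fst z)) = src1 K (fst (fst y))" "trg1 K (fst (fst y)) = src1 K (fst (fst x))" for x y z
    using that t[OF that(1)] t[OF that(2)] t[OF that(3)]
    by (simp add: eq prod_eq_iff lic_Cl lic_ops lic_Ar K.tc_simps K.hcomp_assoc K.comp1_assoc)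
  show ?thesis
    unfolding two_category_def lic_sel
    by (intro conjI ballI impI; ((simp add: ar i1[simplified] i2 v h ic ha t; fail) | (rule hu[unfolded lic_sel], assumption) |
       simp add: eq prod_eq_iff lic_Cl lic_ops lic_Ar K.tc_simps K.comp1_assoc K.hcomp_assoc K.vcomp_assoc K.hcomp_id2))
qed

section \<open>Contraction of two neighbouring monads\<close>

text \<open>In the local idempotent closure a 2-cell that absorbs idempotents at both ends is the
  conjugate of itself by the corresponding splittings.\<close>

lemma rt_absorb:
  assumes "vcomp (lic K) e (vcomp (lic K) \<alpha> f) = \<alpha>" "und p = und e" "und i = und f"
  shows "rt (fst i) \<alpha> (snd (snd p)) = vcomp (lic K) p (vcomp (lic K) \<alpha> i)"
proof -
  have "vcomp K (und e) (vcomp K (und \<alpha>) (und f)) = und \<alpha>"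
    using arg_cong[OF assms(1), of und] by simp
  then show ?thesis using assms(2,3) by (simp add: rt_def lic_ops)
qed

lemma und_wl: "und (wl (lic K) v x) = hcomp K (snd v) (und x)"
  and und_wr: "und (wr (lic K) x v) = hcomp K (und x) (snd v)"
  and fst_wl: "fst (wl (lic K) v x) = comp1 (lic K) v (fst x)"
  and fst_wr: "fst (wr (lic K) x v) = comp1 (lic K) (fst x) v"
  and snd_wl: "snd (snd (wl (lic K) v x)) = comp1 (lic K) v (snd (snd x))"
  and snd_wr: "snd (snd (wr (lic K) x v)) = comp1 (lic K) (snd (snd x)) v"
  by (simp_all add: wl_def wr_def) (simp_all add: lic_ops)

text \<open>Here \<open>a\<close> is \<open>k - 1\<close>, which keeps truncated subtraction out of
  the indices.\<close>

locale contraction =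
  fixes K :: "('o,'a,'c) tcat" and n a :: nat
    and A :: 'o
    and s :: "nat \<Rightarrow> ('a \<times> 'c, ('a \<times> 'c) \<times> 'c \<times> ('a \<times> 'c)) mnd"
    and lam :: "nat \<Rightarrow> nat \<Rightarrow> ('a \<times> 'c) \<times> 'c \<times> ('a \<times> 'c)"
  assumes two_category: "two_category K"
    and wdln0: "wdln0 (lic K) n (A, s, lam)"
    and a: "Suc a \<le> n"
begin

abbreviation "L \<equiv> lic K"
abbreviation "S \<equiv> s a"
abbreviation "T \<equiv> s (Suc a)"
abbreviation "l \<equiv> lam a (Suc a)"
abbreviation "kap \<equiv> lambar L T S l"
abbreviation "M \<equiv> wwp K T S l"
text \<open>Both halves of the splitting are the idempotent itself, retyped. Both composites have it
  as underlying 2-cell again, and as an endomorphism of \<open>M\<close> it is the identity.\<close>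

abbreviation "i \<equiv> rt (fst M) kap (comp1 L (fst S) (fst T))"
abbreviation "p \<equiv> rt (comp1 L (fst S) (fst T)) kap (fst M)"
abbreviation "th j \<equiv> rt (comp1 L (fst (s j)) (fst M))
  (vcomp L (wl L (fst S) (lam (Suc a) j)) (vcomp L (wr L (lam a j) (fst T)) (wl L (fst (s j)) kap)))
  (comp1 L (fst M) (fst (s j)))"
abbreviation "ph j \<equiv> rt (comp1 L (fst M) (fst (s j)))
  (vcomp L (wr L (lam j a) (fst T)) (vcomp L (wl L (fst S) (lam j (Suc a))) (wr L kap (fst (s j)))))
  (comp1 L (fst (s j)) (fst M))"

lemma monad: "j \<le> n \<Longrightarrow> is_monad L A (s j)"
  and law: "j < j' \<Longrightarrow> j' \<le> n \<Longrightarrow> wdl L A (s j') (s j) (lam j j')"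
  and yang_baxter: "j < j' \<Longrightarrow> j' < j'' \<Longrightarrow> j'' \<le> n \<Longrightarrow>
    vcomp L (wr L (lam j j') (fst (s j''))) (vcomp L (wl L (fst (s j')) (lam j j'')) (wr L (lam j' j'') (fst (s j)))) =
    vcomp L (wl L (fst (s j)) (lam j' j'')) (vcomp L (wr L (lam j j'') (fst (s j'))) (wl L (fst (s j'')) (lam j j')))"
  using wdln0 by (simp_all add: wdln0_def)

sublocale two_cat L
  by unfold_locales (rule two_category_lic[OF two_category])

lemma pair: "j < j' \<Longrightarrow> j' \<le> n \<Longrightarrow> wdl_pair L A (s j) (s j') (lam j j')"
  by unfold_locales (rule law)

lemma split: "wdl_split L A S T l M i p"
proof -
  interpret wdl_pair L A S T l by (rule pair) (use a in simp_all)
  have kC: "k \<in> Cl L" and kd: "fst k = comp1 L (fst S) (fst T)" "snd (snd k) = comp1 L (fst S) (fst T)"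
    using arrD(4-6)[OF arr_k] by simp_all
  note kk = kC[unfolded lic_Cl kd]
  have "vcomp L k k = k" using k_k by simp
  then have k2: "vcomp K (und k) (und k) = und k"
    by (metis und_ops(1))
  have M: "fst M = (fst (comp1 L (fst S) (fst T)), und k)"
    by (simp add: wwp_def Let_def)
  have mM: "fst (snd M) = rt (comp1 L (fst M) (fst M)) mST (fst M)"
    and eM: "snd (snd M) = rt (id1 L (src1 L (fst T))) eST (fst M)"
    by (simp_all add: wwp_def Let_def)
  have ST: "comp1 L (fst S) (fst T) \<in> Ar L"
    using comp1_Ar[of "fst S" "fst T"] types by simp
  have fM: "fst M \<in> Ar L"
    using kk k2 ST by (auto simp: M lic_Ar)
  have "src1 L (fst M) = A \<and> trg1 L (fst M) = A"
    using src1_comp1[of "fst S" "fst T"] trg1_comp1[of "fst S" "fst T"] types by (simp add: M)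
  moreover have "i \<in> Cl L" "p \<in> Cl L"
    using kk k2 fM ST by (auto simp: lic_Cl M)
  moreover have "fst (snd M) = vcomp L p (vcomp L mST (hcomp L i i))"
  proof -
    have "rt (fst (hcomp L i i)) mST (snd (snd p)) = vcomp L p (vcomp L mST (hcomp L i i))"
      by (rule rt_absorb[OF mST_absorb]) simp_all
    then show ?thesis by (simp add: mM lic_ops)
  qed
  moreover have "snd (snd M) = vcomp L p eST"
  proof -
    \<comment> \<open>The source of the unit is an identity 1-cell, whose idempotent is trivial, so
      only the target needs absorption. With \<open>lic_sel\<close> active, the typing facts would
      be unfolded to \<open>K\<close> and no longer match.\<close>
    have "arr L A [] eST [fst S, fst T]"
      by (rule arr_evI[OF eST_ev]) (simp_all del: lic_sel)
    then have "fst eST = id1 L A" by (simp add: arr_def hom2_def)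
    moreover have "vcomp K (und k) (und eST) = und eST"
      using arg_cong[OF eST_absorb, of und] by simp
    ultimately show ?thesis
      using types by (simp add: eM rt_def lic_ops)
  qed
  moreover have "vcomp L p i = id2 L (fst M)"
    using k2 by (simp add: lic_ops(2,3) M)
  moreover have "vcomp L i p = k"
    using k2 kd by (simp add: lic_ops(3) und_def rt_def prod_eq_iff)
  ultimately show ?thesis
    using fM by unfold_locales (simp_all add: hom1_def hom2_def)
qed

lemma rt: "Suc a < j \<Longrightarrow> j \<le> n \<Longrightarrow> wdl_rt L A S T l (s j) (lam a j) (lam (Suc a) j)"
  by (intro wdl_rt.intro wdl_rt_axioms.intro pair yang_baxter) simp_all

lemma right: "Suc a < j \<Longrightarrow> j \<le> n \<Longrightarrow> wdl_right L A S T l (s j) (lam a j) (lam (Suc a) j) M i p (th j)"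
proof (intro wdl_right.intro wdl_right_axioms.intro rt split)
  assume "Suc a < j" "j \<le> n"
  from rt[OF this] interpret wdl_rt L A S T l "s j" "lam a j" "lam (Suc a) j" .
  show "th j = vcomp L (wr L p (fst (s j))) (vcomp L theta (wl L (fst (s j)) i))"
    using rt_absorb[OF theta_absorb, of "wr L p (fst (s j))" "wl L (fst (s j)) i"]
    by (simp add: und_wl und_wr fst_wl snd_wr)
qed

lemma lt: "j < a \<Longrightarrow> wdl_lt L A S T l (s j) (lam j a) (lam j (Suc a))"
  using a by (intro wdl_lt.intro wdl_lt_axioms.intro pair yang_baxter) simp_all

lemma left: "j < a \<Longrightarrow> wdl_left L A S T l (s j) (lam j a) (lam j (Suc a)) M i p (ph j)"
proof (intro wdl_left.intro wdl_left_axioms.intro lt split)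
  assume "j < a"
  from lt[OF this] interpret wdl_lt L A S T l "s j" "lam j a" "lam j (Suc a)" .
  show "ph j = vcomp L (wl L (fst (s j)) p) (vcomp L phi (wr L i (fst (s j))))"
    using rt_absorb[OF phi_absorb, of "wl L (fst (s j)) p" "wr L i (fst (s j))"]
    by (simp add: und_wl und_wr fst_wr snd_wl)
qed

text \<open>The old index of the monad now at position \<open>j\<close>. Position \<open>a\<close>
  itself is overridden by \<open>M\<close> wherever this is used.\<close>

definition skip :: "nat \<Rightarrow> nat" where
  "skip j = (if j < a then j else Suc j)"

lemma skip: "j < j' \<Longrightarrow> skip j < skip j'" "Suc j \<le> n \<Longrightarrow> skip j \<le> n"
  by (auto simp: skip_def)

lemma Ck0_eq: "Ck0 K (Suc a) (A, s, lam) = (A, \<lambda>j. if j = a then M else s (skip j),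
    \<lambda>j j'. if j' = a then ph j else if j = a then th (Suc j') else lam (skip j) (skip j'))"
  by (simp add: Ck0_def Let_def skip_def fun_eq_iff)

lemma wdln0_Ck0: "wdln0 L (n - 1) (Ck0 K (Suc a) (A, s, lam))"
proof -
  let ?s = "\<lambda>j. if j = a then M else s (skip j)"
  let ?lam = "\<lambda>j j'. if j' = a then ph j else if j = a then th (Suc j') else lam (skip j) (skip j')"
  have mon: "is_monad L A (?s j)" if "j \<le> n - 1" for j
    using that a wdl_split.is_monad_M[OF split] monad[OF skip(2)[of j]] by auto
  have wdl: "wdl L A (?s j') (?s j) (?lam j j')" if "j < j'" "j' \<le> n - 1" for j j'
    using that a wdl_left.wdl_ph[OF left, of j] wdl_right.wdl_th[OF right, of "Suc j'"]
      law[OF skip(1) skip(2), of j j'] by (auto simp: skip_def)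
  have yb: "vcomp L (wr L (?lam j j') (fst (?s j''))) (vcomp L (wl L (fst (?s j')) (?lam j j'')) (wr L (?lam j' j'') (fst (?s j)))) =
    vcomp L (wl L (fst (?s j)) (?lam j' j'')) (vcomp L (wr L (?lam j j'') (fst (?s j'))) (wl L (fst (?s j'')) (?lam j j')))"
    if j: "j < j'" "j' < j''" "j'' \<le> n - 1" for j j' j''
  proof -
    \<comment> \<open>\<open>M\<close> is the last, the middle or the first monad of the triple, or
      absent. A monad above \<open>M\<close> has old index one higher, whence
      \<open>Suc\<close>.\<close>
    consider "j'' = a" | "j' = a" | "j = a" | "j \<noteq> a" "j' \<noteq> a" "j'' \<noteq> a" by blast
    then show ?thesis
    proof cases
      case 1
      have "yang_baxter_LL L A S T l (s j) (lam j a) (lam j (Suc a)) M i p (ph j)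
          (s j') (lam j' a) (lam j' (Suc a)) (ph j') (lam j j')"
        using j 1 a by (intro yang_baxter_LL.intro yang_baxter_LL_axioms.intro left pair yang_baxter two_cat_axioms) simp_all
      from yang_baxter_LL.yang_baxter_M[OF this] show ?thesis using j 1 by (simp add: skip_def)
    next
      case 2
      have "yang_baxter_LR L A S T l (s j) (lam j a) (lam j (Suc a)) M i p (ph j)
          (s (Suc j'')) (lam a (Suc j'')) (lam (Suc a) (Suc j'')) (th (Suc j'')) (lam j (Suc j''))"
        using j 2 a by (intro yang_baxter_LR.intro yang_baxter_LR_axioms.intro left right pair yang_baxter two_cat_axioms) simp_all
      from yang_baxter_LR.yang_baxter_M[OF this] show ?thesis using j 2 by (simp add: skip_def)
    next
      case 3
      have "yang_baxter_RR L A S T l (s (Suc j')) (lam a (Suc j')) (lam (Suc a) (Suc j')) M i p (th (Suc j'))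
          (s (Suc j'')) (lam a (Suc j'')) (lam (Suc a) (Suc j'')) (th (Suc j'')) (lam (Suc j') (Suc j''))"
        using j 3 a by (intro yang_baxter_RR.intro yang_baxter_RR_axioms.intro right pair yang_baxter two_cat_axioms) simp_all
      from yang_baxter_RR.yang_baxter_M[OF this] show ?thesis using j 3 by (simp add: skip_def)
    next
      case 4
      then show ?thesis
        using yang_baxter[OF skip(1)[OF j(1)] skip(1)[OF j(2)] skip(2)] j(3) a by simp
    qed
  qed
  show ?thesis
    unfolding Ck0_eq wdln0_def Let_def fst_conv snd_conv using mon wdl yb by blast
qed

end

section \<open>Action of the contraction on 1-cells, 2-cells, composites and identities\<close>

locale contraction1 = contraction K n a A s lam + P: contraction K n a A' s' lam'
  for K :: "('o,'a,'c) tcat" and n a A s lam A' s' lam' +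
  fixes v :: "'a \<times> 'c" and xi :: "nat \<Rightarrow> ('a \<times> 'c) \<times> 'c \<times> ('a \<times> 'c)"
  assumes wdln1: "wdln1 (lic K) n (A, s, lam) (A', s', lam') (v, xi)"
begin

abbreviation "xM \<equiv> rt (comp1 L (fst P.M) v)
  (vcomp L (wl L v kap) (vcomp L (wr L (xi a) (fst T)) (wl L (fst P.S) (xi (Suc a))))) (comp1 L v (fst M))"

lemma v_hom: "v \<in> hom1 L A A'"
  and mnd1: "j \<le> n \<Longrightarrow> mnd1 L A (s j) A' (s' j) v (xi j)"
  and wdl1: "j < j' \<Longrightarrow> j' \<le> n \<Longrightarrow>
    wdl1 L A (s j') (s j) (lam j j') A' (s' j') (s' j) (lam' j j') v (xi j') (xi j)"
  using wdln1 by (simp_all add: wdln1_def)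

lemma cell0: "wdl_1cell0 L A S T l A' P.S P.T P.l v (xi a) (xi (Suc a))"
  using a by (intro wdl_1cell0.intro wdl_1cell0_axioms.intro pair P.pair wdl1) simp_all

lemma cell: "wdl_1cell L A S T l M i p A' P.S P.T P.l P.M P.i P.p v (xi a) (xi (Suc a)) xM"
proof (intro wdl_1cell.intro wdl_1cell_axioms.intro cell0 split P.split)
  from cell0 interpret X: wdl_1cell0 L A S T l A' P.S P.T P.l v "xi a" "xi (Suc a)" .
  show "xM = vcomp L (wl L v p) (vcomp L X.xi (wr L P.i v))"
    using rt_absorb[OF X.xi_absorb, of "wl L v p" "wr L P.i v"]
    by (simp add: und_wl und_wr fst_wr snd_wl)
qed

lemma Ck1_eq: "Ck1 K (Suc a) (A, s, lam) (A', s', lam') (v, xi) =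
    (v, \<lambda>j. if j = a then xM else xi (skip j))"
  by (simp add: Ck1_def Ck0_eq P.Ck0_eq Let_def skip_def fun_eq_iff)

lemma wdln1_Ck1: "wdln1 L (n - 1) (Ck0 K (Suc a) (A, s, lam)) (Ck0 K (Suc a) (A', s', lam'))
    (Ck1 K (Suc a) (A, s, lam) (A', s', lam') (v, xi))"
proof -
  let ?s = "\<lambda>j. if j = a then M else s (skip j)" and ?s' = "\<lambda>j. if j = a then P.M else s' (skip j)"
  let ?lam = "\<lambda>j j'. if j' = a then ph j else if j = a then th (Suc j') else lam (skip j) (skip j')"
  let ?lam' = "\<lambda>j j'. if j' = a then P.ph j else if j = a then P.th (Suc j') else lam' (skip j) (skip j')"
  let ?xi = "\<lambda>j. if j = a then xM else xi (skip j)"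
  have m: "mnd1 L A (?s j) A' (?s' j) v (?xi j)" if "j \<le> n - 1" for j
    using that a wdl_1cell.mnd1_xM[OF cell] mnd1[OF skip(2)[of j]] by auto
  have w: "wdl1 L A (?s j') (?s j) (?lam j j') A' (?s' j') (?s' j) (?lam' j j') v (?xi j') (?xi j)"
    if j: "j < j'" "j' \<le> n - 1" for j j'
  proof -
    consider "j' = a" | "j = a" | "j \<noteq> a" "j' \<noteq> a" by blast
    then show ?thesis
    proof cases
      case 1
      have "wdl_1cell_left L A S T l M i p A' P.S P.T P.l P.M P.i P.p v (xi a) (xi (Suc a)) xM
          (s j) (lam j a) (lam j (Suc a)) (ph j) (s' j) (lam' j a) (lam' j (Suc a)) (P.ph j) (xi j)"
        using j 1 a by (intro wdl_1cell_left.intro wdl_1cell_left_axioms.intro cell left P.left wdl1) simp_all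
      from wdl_1cell_left.wdl1_xM[OF this] show ?thesis using j 1 by (simp add: skip_def)
    next
      case 2
      have "wdl_1cell_right L A S T l M i p A' P.S P.T P.l P.M P.i P.p v (xi a) (xi (Suc a)) xM
          (s (Suc j')) (lam a (Suc j')) (lam (Suc a) (Suc j')) (th (Suc j'))
          (s' (Suc j')) (lam' a (Suc j')) (lam' (Suc a) (Suc j')) (P.th (Suc j')) (xi (Suc j'))"
        using j 2 a by (intro wdl_1cell_right.intro wdl_1cell_right_axioms.intro cell right P.right wdl1) simp_all
      from wdl_1cell_right.wdl1_xM[OF this] show ?thesis using j 2 by (simp add: skip_def)
    next
      case 3
      then show ?thesis using wdl1[OF skip(1)[OF j(1)] skip(2)] j(2) a by simp
    qed
  qed
  show ?thesis
    unfolding Ck0_eq P.Ck0_eq Ck1_eq wdln1_def Let_def fst_conv snd_conv using v_hom m w by blast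
qed

end

locale contraction2 = V: contraction1 K n a A s lam A' s' lam' v xi + U: contraction1 K n a A s lam A' s' lam' u xi'
  for K :: "('o,'a,'c) tcat" and n a A s lam A' s' lam' v xi u xi' +
  fixes w
  assumes wdln2: "wdln2 (lic K) n (A, s, lam) (A', s', lam') (v, xi) (u, xi') w"
begin

lemma wdln2_Ck1: "wdln2 (lic K) (n - 1) (Ck0 K (Suc a) (A, s, lam)) (Ck0 K (Suc a) (A', s', lam'))
    (Ck1 K (Suc a) (A, s, lam) (A', s', lam') (v, xi)) (Ck1 K (Suc a) (A, s, lam) (A', s', lam') (u, xi')) w"
proof -
  have w: "w \<in> hom2 (lic K) v u" "\<And>j. j \<le> n \<Longrightarrow> mnd2 (lic K) (s j) (s' j) v (xi j) u (xi' j) w"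
    using wdln2 by (simp_all add: wdln2_def)
  have "wdl_2cell V.L A V.S V.T V.l V.M V.i V.p A' V.P.S V.P.T V.P.l V.P.M V.P.i V.P.p
      v (xi a) (xi (Suc a)) V.xM u (xi' a) (xi' (Suc a)) U.xM w"
    using V.a by (intro wdl_2cell.intro wdl_2cell_axioms.intro V.cell U.cell V.two_cat_axioms w(2)) simp_all
  from wdl_2cell.mnd2_M[OF this] w V.skip(2) V.a show ?thesis
    by (simp add: wdln2_def V.Ck0_eq V.P.Ck0_eq V.Ck1_eq U.Ck1_eq)
qed

end

locale contraction_comp = F: contraction1 K n a A s lam A' s' lam' v xi
    + G: contraction1 K n a A' s' lam' A'' s'' lam'' v' xi'
  for K :: "('o,'a,'c) tcat" and n a A s lam A' s' lam' v xi A'' s'' lam'' v' xi'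
begin

text \<open>Only the component at \<open>a\<close> needs an argument: \<open>xx_absorb\<close> makes
  the retyped formula for the composite a conjugate by the splittings, and \<open>xM_xx\<close>
  identifies this with the composite of the two components.\<close>

lemma Ck1_comp: "Ck1 K (Suc a) (A, s, lam) (A'', s'', lam'') (wdln_comp (lic K) (v', xi') (v, xi)) =
    wdln_comp (lic K) (Ck1 K (Suc a) (A', s', lam') (A'', s'', lam'') (v', xi'))
      (Ck1 K (Suc a) (A, s, lam) (A', s', lam') (v, xi))"
proof -
  interpret X: wdl_1cell_comp F.L A F.S F.T F.l F.M F.i F.p A' F.P.S F.P.T F.P.l F.P.M F.P.i F.P.p
      v "xi a" "xi (Suc a)" F.xM A'' G.P.S G.P.T G.P.l G.P.M G.P.i G.P.p v' "xi' a" "xi' (Suc a)" G.xM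
    by (intro wdl_1cell_comp.intro F.cell G.cell F.two_cat_axioms)
  have "rt (comp1 F.L (fst G.P.M) (comp1 F.L v' v)) X.xx (comp1 F.L (comp1 F.L v' v) (fst F.M)) =
      vcomp F.L (wl F.L v' F.xM) (wr F.L G.xM v)"
    using rt_absorb[OF X.xx_absorb, of "wl F.L (comp1 F.L v' v) F.p" "wr F.L G.P.i (comp1 F.L v' v)"] X.xM_xx
    by (simp add: und_wl und_wr fst_wr snd_wl)
  then show ?thesis
    by (simp add: F.Ck1_eq G.Ck1_eq wdln_comp_def Ck1_def F.Ck0_eq F.P.Ck0_eq G.P.Ck0_eq Let_def
        F.skip_def fun_eq_iff)
qed

end

context contraction
begin

text \<open>With identity components the formula at \<open>a\<close> collapses to the idempotent
  alone, and retyped as an endomorphism of \<open>M\<close> this is the identity 2-cell.\<close>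

lemma Ck1_id: "Ck1 K (Suc a) (A, s, lam) (A, s, lam) (wdln_id L (A, s, lam)) = wdln_id L (Ck0 K (Suc a) (A, s, lam))"
proof -
  interpret X: wdl_split L A S T l M i p by (rule split)
  note c = X.arr_k[unfolded arr_def hom2_def]
  have "wl L (id1 L A) kap = kap"
    unfolding wl_def using c by (intro hcomp_id1_left) (simp_all del: lic_sel add: tc_simps)
  moreover have "vcomp L kap (vcomp L (wr L (id2 L (fst S)) (fst T)) (wl L (fst S) (id2 L (fst T)))) = kap"
    unfolding wl_def wr_def using c by (simp del: lic_sel add: tc_simps hcomp_id2)
  moreover have "comp1 L (fst M) (id1 L A) = fst M" "comp1 L (id1 L A) (fst M) = fst M"
    by (simp_all del: lic_sel add: tc_simps)
  moreover have "rt (fst M) kap (fst M) = id2 L (fst M)"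
    by (simp add: rt_def lic_ops wwp_def Let_def)
  ultimately show ?thesis
    by (simp del: lic_sel add: Ck1_def wdln_id_def Ck0_eq Let_def skip_def fun_eq_iff)
qed

end

theorem theorem2p6:
  fixes K :: "('o,'a,'c) tcat" and n k :: nat
  assumes "two_category K" and "1 \<le> n" and "1 \<le> k" and "k \<le> n"
  shows
    "(\<forall>X. wdln0 (lic K) n X \<longrightarrow> wdln0 (lic K) (n - 1) (Ck0 K k X)) \<and>
     (\<forall>X X' f. wdln0 (lic K) n X \<longrightarrow> wdln0 (lic K) n X' \<longrightarrow> wdln1 (lic K) n X X' f \<longrightarrow>
        wdln1 (lic K) (n - 1) (Ck0 K k X) (Ck0 K k X') (Ck1 K k X X' f)) \<and>
     (\<forall>X X' f g \<omega>. wdln0 (lic K) n X \<longrightarrow> wdln0 (lic K) n X' \<longrightarrow>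
        wdln1 (lic K) n X X' f \<longrightarrow> wdln1 (lic K) n X X' g \<longrightarrow> wdln2 (lic K) n X X' f g \<omega> \<longrightarrow>
        wdln2 (lic K) (n - 1) (Ck0 K k X) (Ck0 K k X') (Ck1 K k X X' f) (Ck1 K k X X' g) \<omega>) \<and>
     (\<forall>X X' X'' f g. wdln0 (lic K) n X \<longrightarrow> wdln0 (lic K) n X' \<longrightarrow> wdln0 (lic K) n X'' \<longrightarrow>
        wdln1 (lic K) n X X' f \<longrightarrow> wdln1 (lic K) n X' X'' g \<longrightarrow>
        fst (Ck1 K k X X'' (wdln_comp (lic K) g f)) =
          fst (wdln_comp (lic K) (Ck1 K k X' X'' g) (Ck1 K k X X' f)) \<and>
        (\<forall>i<n. snd (Ck1 K k X X'' (wdln_comp (lic K) g f)) i =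
          snd (wdln_comp (lic K) (Ck1 K k X' X'' g) (Ck1 K k X X' f)) i)) \<and>
     (\<forall>X. wdln0 (lic K) n X \<longrightarrow>
        fst (Ck1 K k X X (wdln_id (lic K) X)) = fst (wdln_id (lic K) (Ck0 K k X)) \<and>
        (\<forall>i<n. snd (Ck1 K k X X (wdln_id (lic K) X)) i = snd (wdln_id (lic K) (Ck0 K k X)) i))"
proof -
  define a where "a = k - 1"
  have a: "k = Suc a" "Suc a \<le> n" using assms by (simp_all add: a_def)
  have c: "contraction K n a (fst X) (fst (snd X)) (snd (snd X))" if "wdln0 (lic K) n X" for X
    using that assms(1) a by (simp add: contraction_def)
  have c1: "contraction1 K n a (fst X) (fst (snd X)) (snd (snd X)) (fst X') (fst (snd X')) (snd (snd X')) (fst f) (snd f)"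
    if "wdln0 (lic K) n X" "wdln0 (lic K) n X'" "wdln1 (lic K) n X X' f" for X X' f
    using that by (simp add: contraction1_def contraction1_axioms_def c)
  have c2: "contraction2 K n a (fst X) (fst (snd X)) (snd (snd X)) (fst X') (fst (snd X')) (snd (snd X'))
      (fst f) (snd f) (fst g) (snd g) w"
    if "wdln0 (lic K) n X" "wdln0 (lic K) n X'" "wdln1 (lic K) n X X' f" "wdln1 (lic K) n X X' g"
      "wdln2 (lic K) n X X' f g w" for X X' f g w
    using that by (simp add: contraction2_def contraction2_axioms_def c1)
  have cc: "contraction_comp K n a (fst X) (fst (snd X)) (snd (snd X)) (fst X') (fst (snd X')) (snd (snd X'))
      (fst f) (snd f) (fst X'') (fst (snd X'')) (snd (snd X'')) (fst g) (snd g)"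
    if "wdln0 (lic K) n X" "wdln0 (lic K) n X'" "wdln0 (lic K) n X''" "wdln1 (lic K) n X X' f"
      "wdln1 (lic K) n X' X'' g" for X X' X'' f g
    using that by (simp add: contraction_comp_def c1)
  show ?thesis
    unfolding a(1)
    using contraction.wdln0_Ck0[OF c] contraction1.wdln1_Ck1[OF c1] contraction2.wdln2_Ck1[OF c2]
      contraction_comp.Ck1_comp[OF cc] contraction.Ck1_id[OF c]
    by simp
qed

end
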